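(* Let $Q\subset\mathbb{P}^8$ be a quadric hypersurface of signature $(4,5)$ (respectively, $(3,6)$). Then there exists a double Segre surface $X\subset Q$, unique up to automorphisms of $Q$, such that $\operatorname{Aut}_\circ(X)\subset\operatorname{Aut}_\circ(Q)$ and $X$ is isomorphic to $\mathbb{S}^1\times\mathbb{S}^1$ (respectively, $\mathbb{S}^2$).
   Context: A real variety is a complex variety together with an antiholomorphic involution $\sigma$ (its real structure). Varieties, morphisms and automorphisms are real, i.e. compatible with the real structures, and $\mathbb{P}^8$ has the real structure given by coordinatewise complex conjugation. $Q$ is the zero set of a real quadratic form of the given signature (a form being identified with its negative). For a variety $V$ whose automorphism group $\operatorname{Aut}(V)$ is a Lie group, $\operatorname{Aut}_\circ(V)$ is its identity component. Both $\operatorname{Aut}_\circ(X)$ and $\operatorname{Aut}_\circ(Q)$ are regarded as subgroups of $\operatorname{Aut}(\mathbb{P}^8)$. A surface $X\subset\mathbb{P}^8$ is a double Segre surface if there exists a biregular isomorphism $\mathbb{P}^1\times\mathbb{P}^1\to X$ whose components form a basis of the vector space of bidegree $(2,2)$ forms (with $\mathbb{P}^1\times\mathbb{P}^1$ carrying some real structure). $\mathbb{S}^n=\{x\in\mathbb{P}^{n+1}\mid -x_0^2+x_1^2+\ldots+x_{n+1}^2=0\}$ with real structure coordinatewise conjugation. As a real variety, $\mathbb{S}^1\times\mathbb{S}^1$ is $\mathbb{P}^1\times\mathbb{P}^1$ with real structure $(s:t;u:w)\mapsto(\overline{s}:\overline{t};\overline{u}:\overline{w})$, and $\mathbb{S}^2$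 is $\mathbb{P}^1\times\mathbb{P}^1$ with real structure $(s:t;u:w)\mapsto(\overline{u}:\overline{w};\overline{s}:\overline{t})$. *)

theory Defs
  imports "HOL-Analysis.Analysis"
begin

section \<open>Complex projective space\<close>

text \<open>The type \<open>'n proj\<close> is the projective space of dimension \<open>CARD('n) - 1\<close>. The point with
  homogeneous coordinates \<open>v\<close> is \<open>abs_proj v\<close>; this is meaningful for \<open>v \<noteq> 0\<close> only.\<close>

definition proportional :: "complex^'n \<Rightarrow> complex^'n \<Rightarrow> bool" where
  "proportional v w \<longleftrightarrow> v \<noteq> 0 \<and> w \<noteq> 0 \<and> (\<exists>c. v = c *s w)"

lemma part_equivp_proportional: "part_equivp (proportional :: complex^'n \<Rightarrow> complex^'n \<Rightarrow> bool)"
proof (rule part_equivpI)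
  show "\<exists>v :: complex^'n. proportional v v"
    unfolding proportional_def by (rule exI[of _ 1]) (auto intro: exI[of _ 1])
  show "symp (proportional :: complex^'n \<Rightarrow> complex^'n \<Rightarrow> bool)"
  proof (rule sympI)
    fix v w :: "complex^'n"
    assume "proportional v w"
    then obtain c where c: "v \<noteq> 0" "w \<noteq> 0" "v = c *s w"
      unfolding proportional_def by blast
    then have "c \<noteq> 0" by auto
    then have "w = inverse c *s v" using c by (simp add: vector_smult_assoc)
    with c show "proportional w v" unfolding proportional_def by blast
  qed
  show "transp (proportional :: complex^'n \<Rightarrow> complex^'n \<Rightarrow> bool)"
    unfolding transp_def proportional_def by (metis vector_smult_assoc)
qed

quotient_type 'n proj = "complex^'n::finite" / partial: proportional
  by (rule part_equivp_proportional)

lemma proj_cases: obtains v where "v \<noteq> 0" "p = abs_proj v"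
proof -
  have "proportional (rep_proj p) (rep_proj p)"
    by (meson Quotient3_proj Quotient3_rep_reflp)
  moreover have "abs_proj (rep_proj p) = p"
    by (meson Quotient3_proj Quotient3_abs_rep)
  ultimately show ?thesis using that[of "rep_proj p"] unfolding proportional_def by simp
qed

lemma abs_proj_eq_iff:
  assumes "v \<noteq> 0" "w \<noteq> 0"
  shows "abs_proj v = abs_proj w \<longleftrightarrow> (\<exists>c. v = c *s w)"
proof -
  have refl: "proportional u u" if "u \<noteq> 0" for u :: "complex^'a"
    using that unfolding proportional_def by (auto intro: exI[of _ 1])
  show ?thesis
    using Quotient3_rel[OF Quotient3_proj, of v w] refl[OF assms(1)] refl[OF assms(2)] assms
    unfolding proportional_def by blast
qed

text \<open>The quotient topology inherited from the non-zero vectors.\<close>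

instantiation proj :: (finite) topological_space
begin

definition open_proj :: "'a proj set \<Rightarrow> bool" where
  "open_proj U \<longleftrightarrow> open {v. v \<noteq> 0 \<and> abs_proj v \<in> U}"

instance
proof
  have "{v :: complex^'a. v \<noteq> 0 \<and> abs_proj v \<in> UNIV} = - {0}" by auto
  then show "open (UNIV :: 'a proj set)" unfolding open_proj_def by (metis open_Compl closed_singleton)
next
  fix S T :: "'a proj set"
  assume "open S" "open T"
  moreover have "{v. v \<noteq> 0 \<and> abs_proj v \<in> S \<inter> T} =
      {v. v \<noteq> 0 \<and> abs_proj v \<in> S} \<inter> {v. v \<noteq> 0 \<and> abs_proj v \<in> T}" by auto
  ultimately show "open (S \<inter> T)" unfolding open_proj_def by auto
next
  fix K :: "'a proj set set"
  assume "\<forall>S\<in>K. open S"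
  moreover have "{v. v \<noteq> 0 \<and> abs_proj v \<in> \<Union>K} =
      (\<Union>S\<in>K. {v. v \<noteq> 0 \<and> abs_proj v \<in> S})" by auto
  ultimately show "open (\<Union>K)" unfolding open_proj_def by auto
qed

end

text \<open>The standard real structure: coordinatewise complex conjugation.\<close>

lift_definition cnj_proj :: "'n::finite proj \<Rightarrow> 'n proj" is "\<lambda>v. \<chi> i. cnj (v $ i)"
proof -
  fix v w :: "complex^'n"
  assume "proportional v w"
  then obtain c where "v \<noteq> 0" "w \<noteq> 0" "v = c *s w"
    unfolding proportional_def by blast
  then show "proportional (\<chi> i. cnj (v $ i)) (\<chi> i. cnj (w $ i))"
    unfolding proportional_def by (auto simp: vec_eq_iff intro!: exI[of _ "cnj c"])
qed

lemma cnj_proj_abs: "v \<noteq> 0 \<Longrightarrow> cnj_proj (abs_proj v) = abs_proj (\<chi> i. cnj (v $ i))"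
  by (rule cnj_proj.abs_eq) (auto simp: proportional_def intro: exI[of _ 1])


section \<open>Forms and morphisms\<close>

definition form :: "nat \<Rightarrow> (complex^'n \<Rightarrow> complex) \<Rightarrow> bool" where
  "form d P \<longleftrightarrow> (\<exists>c. \<forall>x. P x =
     (\<Sum>m | sum m UNIV = d. c m * (\<Prod>i\<in>UNIV. (x $ i) ^ m i)))"

definition biform :: "nat \<Rightarrow> nat \<Rightarrow> (complex^'a \<Rightarrow> complex^'b \<Rightarrow> complex) \<Rightarrow> bool" where
  "biform d e P \<longleftrightarrow> (\<exists>c. \<forall>x y. P x y =
     (\<Sum>m | sum m UNIV = d. \<Sum>n | sum n UNIV = e.
        c m n * (\<Prod>i\<in>UNIV. (x $ i) ^ m i) * (\<Prod>j\<in>UNIV. (y $ j) ^ n j)))"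

text \<open>The sums over exponents are finite, so they are not silently zero.\<close>

lemma finite_exponents: "finite {m :: 'n::finite \<Rightarrow> nat. sum m UNIV = d}"
proof (rule finite_subset)
  show "{m :: 'n \<Rightarrow> nat. sum m UNIV = d} \<subseteq> (UNIV :: 'n set) \<rightarrow>\<^sub>E {..d}"
    using member_le_sum[of _ "UNIV :: 'n set"] by fastforce
  show "finite ((UNIV :: 'n set) \<rightarrow>\<^sub>E {..d})" by (rule finite_PiE) auto
qed

text \<open>A map defined on \<open>V\<close> is regular if, in a Zariski neighbourhood in \<open>V\<close> of each point of \<open>V\<close>, it is
  given by forms of equal degree without common zero.\<close>

definition regular_on :: "'n::finite proj set \<Rightarrow> ('n proj \<Rightarrow> 'm::finite proj) \<Rightarrow> bool" where
  "regular_on V f \<longleftrightarrow> (\<forall>p\<in>V. \<exists>d (F :: complex^'n \<Rightarrow> complex^'m).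
     (\<forall>i. form d (\<lambda>x. F x $ i)) \<and>
     (\<exists>v. v \<noteq> 0 \<and> abs_proj v = p \<and> F v \<noteq> 0) \<and>
     (\<forall>v. v \<noteq> 0 \<and> abs_proj v \<in> V \<and> F v \<noteq> 0 \<longrightarrow> f (abs_proj v) = abs_proj (F v)))"

definition regular_prod :: "('a::finite proj \<times> 'b::finite proj \<Rightarrow> 'm::finite proj) \<Rightarrow> bool" where
  "regular_prod f \<longleftrightarrow> (\<forall>p. \<exists>d e (F :: complex^'a \<Rightarrow> complex^'b \<Rightarrow> complex^'m).
     (\<forall>i. biform d e (\<lambda>x y. F x y $ i)) \<and>
     (\<exists>v w. v \<noteq> 0 \<and> w \<noteq> 0 \<and> (abs_proj v, abs_proj w) = p \<and> F v w \<noteq> 0) \<and>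
     (\<forall>v w. v \<noteq> 0 \<and> w \<noteq> 0 \<and> F v w \<noteq> 0 \<longrightarrow> f (abs_proj v, abs_proj w) = abs_proj (F v w)))"

definition biregular_prod :: "('a::finite proj \<times> 'b::finite proj \<Rightarrow> 'n::finite proj) \<Rightarrow> 'n proj set \<Rightarrow> bool" where
  "biregular_prod f X \<longleftrightarrow> bij_betw f UNIV X \<and> regular_prod f \<and>
     regular_on X (fst \<circ> inv f) \<and> regular_on X (snd \<circ> inv f)"


section \<open>Real structures\<close>

text \<open>An involution is antiholomorphic iff its composition with coordinatewise conjugation is a morphism.\<close>

definition real_structure :: "('a::finite proj \<times> 'b::finite proj \<Rightarrow> 'a proj \<times> 'b proj) \<Rightarrow> bool" where
  "real_structure \<tau> \<longleftrightarrow> (\<forall>p. \<tau> (\<tau> p) = p) \<and>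
     regular_prod (\<lambda>p. cnj_proj (fst (\<tau> p))) \<and> regular_prod (\<lambda>p. cnj_proj (snd (\<tau> p)))"

definition S1xS1_structure :: "2 proj \<times> 2 proj \<Rightarrow> 2 proj \<times> 2 proj" where
  "S1xS1_structure p = (cnj_proj (fst p), cnj_proj (snd p))"

definition S2_structure :: "2 proj \<times> 2 proj \<Rightarrow> 2 proj \<times> 2 proj" where
  "S2_structure p = (cnj_proj (snd p), cnj_proj (fst p))"

definition real_isomorphic_prod ::
    "('a::finite proj \<times> 'b::finite proj \<Rightarrow> 'a proj \<times> 'b proj) \<Rightarrow> 'n::finite proj set \<Rightarrow> bool" where
  "real_isomorphic_prod \<tau> X \<longleftrightarrow>
     (\<exists>f. biregular_prod f X \<and> (\<forall>p. f (\<tau> p) = cnj_proj (f p)))"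


section \<open>Automorphisms\<close>

text \<open>Here \<open>V\<close> is meant to be a variety that is stable under conjugation. The group of its real
  automorphisms carries the compact-open topology, which is its Lie group topology.\<close>

definition aut :: "'n::finite proj set \<Rightarrow> ('n proj \<Rightarrow> 'n proj) set" where
  "aut V = {f \<in> extensional V. bij_betw f V V \<and> regular_on V f \<and> regular_on V (inv_into V f) \<and>
     (\<forall>p\<in>V. f (cnj_proj p) = cnj_proj (f p))}"

definition aut_topology :: "'n::finite proj set \<Rightarrow> ('n proj \<Rightarrow> 'n proj) topology" where
  "aut_topology V =
     topology_generated_by {{f \<in> aut V. f ` K \<subseteq> U} | K U. compact K \<and> K \<subseteq> V \<and> open U}"

definition aut_id_component :: "'n::finite proj set \<Rightarrow> ('n proj \<Rightarrow> 'n proj) set" where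
  "aut_id_component V = connected_component_of_set (aut_topology V) (restrict id V)"

text \<open>The identity component regarded as a group of automorphisms of the ambient projective space.\<close>

definition aut_id_component_ambient :: "'n::finite proj set \<Rightarrow> ('n proj \<Rightarrow> 'n proj) set" where
  "aut_id_component_ambient V = {g \<in> aut UNIV. restrict g V \<in> aut_id_component V}"

definition exists_unique_upto_aut :: "'n::finite proj set \<Rightarrow> ('n proj set \<Rightarrow> bool) \<Rightarrow> bool" where
  "exists_unique_upto_aut Q \<Phi> \<longleftrightarrow>
     (\<exists>X. \<Phi> X) \<and> (\<forall>X Y. \<Phi> X \<and> \<Phi> Y \<longrightarrow> (\<exists>f\<in>aut Q. f ` X = Y))"


section \<open>Quadrics and double Segre surfaces\<close>

text \<open>A real quadratic form is given by its symmetric matrix; \<open>p\<close> and \<open>q\<close> are the numbers of positive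
  and negative entries in a diagonalization.\<close>

definition has_signature :: "real^'n^'n \<Rightarrow> nat \<Rightarrow> nat \<Rightarrow> bool" where
  "has_signature A p q \<longleftrightarrow> transpose A = A \<and>
     (\<exists>P D :: real^'n^'n. invertible P \<and> D = transpose P ** A ** P \<and>
        (\<forall>i j. i \<noteq> j \<longrightarrow> D $ i $ j = 0) \<and>
        card {i. D $ i $ i > 0} = p \<and> card {i. D $ i $ i < 0} = q)"

definition quadric_of :: "real^'n^'n \<Rightarrow> 'n::finite proj set" where
  "quadric_of A = {abs_proj z | z. z \<noteq> 0 \<and>
     (\<Sum>i\<in>UNIV. \<Sum>j\<in>UNIV. complex_of_real (A $ i $ j) * z $ i * z $ j) = 0}"

definition quadric_of_signature :: "nat \<Rightarrow> nat \<Rightarrow> 'n::finite proj set \<Rightarrow> bool" where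
  "quadric_of_signature p q Q \<longleftrightarrow>
     (\<exists>A. (has_signature A p q \<or> has_signature A q p) \<and> Q = quadric_of A)"

definition bidegree22_basis :: "(complex^2 \<Rightarrow> complex^2 \<Rightarrow> complex^9) \<Rightarrow> bool" where
  "bidegree22_basis F \<longleftrightarrow> (\<forall>k. biform 2 2 (\<lambda>x y. F x y $ k)) \<and>
     (\<forall>G. biform 2 2 G \<longrightarrow> (\<exists>!c :: complex^9. \<forall>x y. G x y = (\<Sum>k\<in>UNIV. c $ k * F x y $ k)))"

definition double_segre_surface :: "9 proj set \<Rightarrow> bool" where
  "double_segre_surface X \<longleftrightarrow>
     (\<exists>\<tau> \<nu> F. real_structure \<tau> \<and> biregular_prod \<nu> X \<and> (\<forall>p. \<nu> (\<tau> p) = cnj_proj (\<nu> p)) \<and>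
        bidegree22_basis F \<and>
        (\<forall>x y. x \<noteq> 0 \<and> y \<noteq> 0 \<longrightarrow> \<nu> (abs_proj x, abs_proj y) = abs_proj (F x y)))"

end

(* Up to a linear change of coordinates the surface is the image of (x, y) |-> Sym^2 x # Sym^2 y in P(C^3 # C^3),
   where # denotes the tensor product. The nondegenerate quadratic forms on C^3 # C^3 semi-invariant under a torus element with
   independent weights and a unipotent element of the automorphism group of the surface are the multiples of
   disc # disc. If Aut_o(X) lies in Aut_o(Q), it preserves Q, so this is the form defining Q, and the linear map carrying
   one model to another is an automorphism of Q. For the two real structures disc # disc has signature (4,5) and (3,6);
   diagonalising over the reals gives existence.

   Automorphisms are only regular maps a priori. On a line of P^1 x P^1 (or of P^n), the Jacobian of a local homogeneous
   representation is a polynomial whose zeros come only from the common factors of the representation. Comparing degrees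
   shows that the map has degree one on the line. This makes automorphisms of P^1 x P^1 and of P^n linear. A projective
   frame on the surface recovers the matrix of the linear extension from values of the automorphism by Cramer's rule;
   therefore extension is continuous and maps the identity component of Aut(X) into that of Aut(Q). *)

theory Submission
  imports Defs "HOL-Computational_Algebra.Fundamental_Theorem_Algebra"
begin

text \<open>Regular maps are given by forms only locally, and two local representations agree only
  up to polynomial factors, so no global degree is at hand. On a line, common factors are factors of
  polynomials in one variable. If the inverse is regular too, a tangent vector killed by the
  differential is killed by the identity; hence a representation that is nonzero at a point has
  nonzero Jacobian there, and the zeros of any Jacobian are exactly those forced by common factors.
  On P^1 x P^1, components of degrees a and c along the line give degree 2a + 2c - 2, and common
  factors phi and psi account for 2 deg phi + 2 deg psi; so (a - deg phi) + (c - deg psi) = 1, and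
  one component is linear, the other constant. In n homogeneous coordinates, forms of degree f give
  n(f - 1) = n deg phi, so the reduced degree is 1.

  The inclusion of identity components is a topological claim: a connected set of automorphisms of X
  has to be moved continuously into Aut(Q), although the compact-open topology sees an automorphism
  only through images of compact sets and not through a matrix.\<close>

lemma abs_proj_scale: "c \<noteq> 0 \<Longrightarrow> v \<noteq> 0 \<Longrightarrow> abs_proj (c *s v) = abs_proj v"
  by (subst abs_proj_eq_iff) (auto simp: vector_mul_eq_0)

lemma scale_vec_zero_iff: "c *s (v :: complex^'n) = 0 \<longleftrightarrow> c = 0 \<or> v = 0"
  by (simp add: vector_mul_eq_0)

lemma abs_proj_eq_cross:
  assumes "v \<noteq> 0" "w \<noteq> 0" "abs_proj v = abs_proj w"
  shows "v $ i * w $ j = v $ j * w $ i"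
  using assms by (auto simp: abs_proj_eq_iff)

lemma cross_imp_scale:
  fixes v w :: "complex^'n"
  assumes "v \<noteq> 0" "\<And>i j. v $ i * w $ j = v $ j * w $ i"
  obtains c where "w = c *s v"
proof -
  obtain k where k: "v $ k \<noteq> 0" using assms(1) by (metis vec_eq_iff zero_index)
  have "w = (w $ k / v $ k) *s v"
    using k assms(2)[of k] by (simp add: vec_eq_iff field_simps)
  then show ?thesis using that by blast
qed

lemma abs_proj_eqI_cross:
  assumes "v \<noteq> 0" "w \<noteq> 0" "\<And>i j. v $ i * w $ j = v $ j * w $ i"
  shows "abs_proj v = abs_proj w"
proof -
  obtain c where "w = c *s v" using cross_imp_scale assms by metis
  then show ?thesis using assms abs_proj_scale[of c v] by (metis vector_smult_lzero)
qed

section \<open>Polynomial functions\<close>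

text \<open>Polynomials are kept as functions in a generated ring, so that composition, restriction
  to lines and differentiation go by induction on the generation, without monomials.\<close>

inductive_set polyring :: "('v \<Rightarrow> complex) set \<Rightarrow> ('v \<Rightarrow> complex) set" for G where
  const: "(\<lambda>_. c) \<in> polyring G"
| gen: "g \<in> G \<Longrightarrow> g \<in> polyring G"
| add: "f \<in> polyring G \<Longrightarrow> h \<in> polyring G \<Longrightarrow> (\<lambda>x. f x + h x) \<in> polyring G"
| mult: "f \<in> polyring G \<Longrightarrow> h \<in> polyring G \<Longrightarrow> (\<lambda>x. f x * h x) \<in> polyring G"

lemma polyring_diff: "f \<in> polyring G \<Longrightarrow> h \<in> polyring G \<Longrightarrow> (\<lambda>x. f x - h x) \<in> polyring G"
  using polyring.add[OF _ polyring.mult[OF polyring.const[of "-1"]], of f G h] by simp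

lemma polyring_sum: "(\<And>i. i \<in> A \<Longrightarrow> f i \<in> polyring G) \<Longrightarrow> (\<lambda>x. \<Sum>i\<in>A. f i x) \<in> polyring G"
  by (induction A rule: infinite_finite_induct) (auto intro: polyring.intros)

lemma polyring_prod: "(\<And>i. i \<in> A \<Longrightarrow> f i \<in> polyring G) \<Longrightarrow> (\<lambda>x. \<Prod>i\<in>A. f i x) \<in> polyring G"
  by (induction A rule: infinite_finite_induct) (auto intro: polyring.intros)

lemma polyring_power: "f \<in> polyring G \<Longrightarrow> (\<lambda>x. f x ^ n) \<in> polyring G"
  by (induction n) (auto intro: polyring.intros)

lemma polyring_compose:
  assumes "f \<in> polyring G" "\<And>g. g \<in> G \<Longrightarrow> (\<lambda>x. g (c x)) \<in> polyring H"
  shows "(\<lambda>x. f (c x)) \<in> polyring H"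
  using assms by (induction rule: polyring.induct) (auto intro: polyring.intros)

lemmas polyring_intros = polyring.const polyring.add polyring.mult polyring_diff polyring_sum
  polyring_prod polyring_power

lemma polyring_poly:
  assumes "f \<in> polyring {\<lambda>t. t}"
  obtains p where "\<And>t. f t = poly p t"
proof -
  have "\<exists>p. \<forall>t. f t = poly p t"
    using assms
  proof induction
    case (const c) show ?case by (rule exI[of _ "[:c:]"]) simp
  next
    case (gen g) then show ?case by (auto intro!: exI[of _ "[:0,1:]"])
  next
    case (add f h) then show ?case by (metis poly_add)
  next
    case (mult f h) then show ?case by (metis poly_mult)
  qed
  then show ?thesis using that by blast
qed

text \<open>The Leibniz rule uses only ring operations, so the partial derivatives stay in the ring.
  Indexing them by the generators makes one statement serve both for the coordinates of C^n and for
  the two parameters of a plane.\<close>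

lemma polyring_has_derivative:
  fixes f :: "'v::real_normed_vector \<Rightarrow> complex"
  assumes "f \<in> polyring G" "finite G" "\<And>g. g \<in> G \<Longrightarrow> bounded_linear g"
  obtains c where "\<And>g. c g \<in> polyring G"
    "\<And>v. (f has_derivative (\<lambda>w. \<Sum>g\<in>G. c g v * g w)) (at v)"
proof -
  have "\<exists>c. (\<forall>g. c g \<in> polyring G) \<and> (\<forall>v. (f has_derivative (\<lambda>w. \<Sum>g\<in>G. c g v * g w)) (at v))"
    using assms(1)
  proof induction
    case (const a)
    show ?case
      by (rule exI[of _ "\<lambda>g v. 0"]) (auto intro: polyring.const)
  next
    case (gen h)
    have eq: "(\<Sum>g\<in>G. (if g = h then 1 else 0) * g w) = h w" for w
    proof -
      have "(\<Sum>g\<in>G. (if g = h then 1 else 0) * g w) = (\<Sum>g\<in>G. (if g = h then g w else 0))"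
        by (intro sum.cong) auto
      then show ?thesis using gen assms(2) by simp
    qed
    show ?case
      using bounded_linear.has_derivative[OF assms(3)[OF gen], OF has_derivative_ident]
      by (intro exI[of _ "\<lambda>g v. if g = h then 1 else 0"] conjI allI)
        (auto intro: polyring.const simp: eq)
  next
    case (add f h)
    then obtain c d where c: "\<And>g. c g \<in> polyring G"
       "\<And>v. (f has_derivative (\<lambda>w. \<Sum>g\<in>G. c g v * g w)) (at v)"
      and d: "\<And>g. d g \<in> polyring G"
       "\<And>v. (h has_derivative (\<lambda>w. \<Sum>g\<in>G. d g v * g w)) (at v)" by blast
    have "((\<lambda>x. f x + h x) has_derivative (\<lambda>w. \<Sum>g\<in>G. (c g v + d g v) * g w)) (at v)" for v
      using has_derivative_add[OF c(2)[of v] d(2)[of v]]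
      by (simp add: sum.distrib distrib_right)
    then show ?case using c(1) d(1)
      by (intro exI[of _ "\<lambda>g v. c g v + d g v"]) (auto intro: polyring.add)
  next
    case (mult f h)
    then obtain c d where c: "\<And>g. c g \<in> polyring G"
       "\<And>v. (f has_derivative (\<lambda>w. \<Sum>g\<in>G. c g v * g w)) (at v)"
      and d: "\<And>g. d g \<in> polyring G"
       "\<And>v. (h has_derivative (\<lambda>w. \<Sum>g\<in>G. d g v * g w)) (at v)" by blast
    have "((\<lambda>x. f x * h x) has_derivative (\<lambda>w. \<Sum>g\<in>G. (f v * d g v + c g v * h v) * g w)) (at v)" for v
      using has_derivative_mult[OF c(2)[of v] d(2)[of v]]
      by (simp add: sum.distrib distrib_right distrib_left sum_distrib_left sum_distrib_right mult_ac)
    then show ?case using c(1) d(1) mult.hyps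
      by (intro exI[of _ "\<lambda>g v. f v * d g v + c g v * h v"]) (auto intro!: polyring.add polyring.mult)
  qed
  then show ?thesis using that by blast
qed

text \<open>A first-order chain rule without gradients: it allows a curve to be replaced by another
  one with the same position and velocity on which the polynomial is easy to evaluate.\<close>

lemma polyring_same_jet:
  assumes "f \<in> polyring G"
    and "\<And>g. g \<in> G \<Longrightarrow> g (x 0) = g (y 0)"
    and "\<And>g. g \<in> G \<Longrightarrow> \<exists>D. ((\<lambda>u. g (x u)) has_field_derivative D) (at (0::complex)) \<and>
           ((\<lambda>u. g (y u)) has_field_derivative D) (at 0)"
  shows "f (x 0) = f (y 0) \<and> (\<exists>D. ((\<lambda>u. f (x u)) has_field_derivative D) (at 0) \<and>
           ((\<lambda>u. f (y u)) has_field_derivative D) (at 0))"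
  using assms(1)
proof induction
  case (const c)
  then show ?case by (auto intro!: exI[of _ 0])
next
  case (gen g)
  then show ?case using assms by auto
next
  case (add f h)
  then obtain D E where D: "((\<lambda>u. f (x u)) has_field_derivative D) (at 0)"
       "((\<lambda>u. f (y u)) has_field_derivative D) (at 0)"
     and E: "((\<lambda>u. h (x u)) has_field_derivative E) (at 0)"
       "((\<lambda>u. h (y u)) has_field_derivative E) (at 0)" by blast
  show ?case using DERIV_add[OF D(1) E(1)] DERIV_add[OF D(2) E(2)] add.IH by auto
next
  case (mult f h)
  then obtain D E where D: "((\<lambda>u. f (x u)) has_field_derivative D) (at 0)"
       "((\<lambda>u. f (y u)) has_field_derivative D) (at 0)"
     and E: "((\<lambda>u. h (x u)) has_field_derivative E) (at 0)"
       "((\<lambda>u. h (y u)) has_field_derivative E) (at 0)" by blast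
  show ?case using DERIV_mult[OF D(1) E(1)] DERIV_mult[OF D(2) E(2)] mult.IH by auto
qed

section \<open>One-variable polynomials\<close>

text \<open>Over the complex numbers the degree counts roots with multiplicity, and factors that do
  not vanish at \<open>t\<close> leave the order at \<open>t\<close> unchanged.\<close>

lemma degree_eq_of_local_equiv:
  fixes N M :: "complex poly"
  assumes "M \<noteq> 0" "\<And>t. \<exists>u v. poly u t \<noteq> 0 \<and> poly v t \<noteq> 0 \<and> N * u = M * v"
  shows "N \<noteq> 0" "degree N = degree M"
proof -
  show N: "N \<noteq> 0" using assms(2)[of 0] assms(1) by force
  have "order t N = order t M" for t
  proof -
    obtain u v where uv: "poly u t \<noteq> 0" "poly v t \<noteq> 0" "N * u = M * v" using assms(2) by blast
    then have "u \<noteq> 0" "v \<noteq> 0" by auto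
    then have "order t N + order t u = order t M + order t v"
      using order_mult[of N u t] order_mult[of M v t] uv(3) N assms(1) by simp
    then show ?thesis using uv by (simp add: order_0I)
  qed
  then have "proots N = proots M" using N assms(1) by (intro multiset_eqI) simp
  then show "degree N = degree M" by (metis size_proots_complex)
qed

text \<open>A form of degree \<open>a\<close> on the projective line reads \<open>p\<close> in one
  chart and \<open>r\<close> in the other. Multiplication by \<open>t ^ degree r\<close> clears the
  denominators, so the identity becomes one of polynomials; the coefficient in degree
  \<open>a\<close> is the value at infinity.\<close>

lemma poly_reversal:
  fixes p r :: "complex poly"
  assumes "\<And>t. t \<noteq> 0 \<Longrightarrow> poly p t = t ^ a * poly r (1 / t)"
  shows "degree p \<le> a" "coeff p a = poly r 0"
proof -
  define m where "m = degree r"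
  have "poly (monom 1 m * p) t = poly (monom 1 a * reflect_poly r) t" if "t \<noteq> 0" for t
    using assms[OF that] that
    by (simp add: poly_monom poly_reflect_poly_nz m_def field_simps)
  then have "\<forall>t\<in>UNIV-{0}. poly (monom 1 m * p - monom 1 a * reflect_poly r) t = 0" by simp
  then have "UNIV - {0} \<subseteq> {t. poly (monom 1 m * p - monom 1 a * reflect_poly r) t = 0}" by blast
  then have "infinite {t. poly (monom 1 m * p - monom 1 a * reflect_poly r) t = 0}"
    by (rule infinite_super) (simp add: infinite_UNIV_char_0)
  then have eq: "monom 1 m * p = monom 1 a * reflect_poly r"
    using poly_roots_finite by (metis eq_iff_diff_eq_0)
  have c: "coeff p k = (if k + m < a then 0 else coeff (reflect_poly r) (k + m - a))" for k
    using arg_cong[OF eq, of "\<lambda>p. coeff p (k + m)"] by (simp add: coeff_monom_mult)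
  have "coeff p k = 0" if "k > a" for k
    unfolding c using that degree_reflect_poly_le[of r]
    by (auto simp: m_def intro!: coeff_eq_0)
  then show "degree p \<le> a" by (simp add: degree_le)
  show "coeff p a = poly r 0"
    unfolding c by (simp add: m_def coeff_reflect_poly poly_0_coeff_0)
qed

text \<open>A common zero \<open>t\<close> is divided out as a linear factor from all members at
  once; the degree of the nonzero member \<open>P i0\<close> drops each time.\<close>

lemma remove_common_factor:
  fixes P :: "'i \<Rightarrow> complex poly"
  assumes "P i0 \<noteq> 0"
  obtains \<phi> R where "\<phi> \<noteq> 0" "\<And>i. P i = \<phi> * R i" "\<And>t. \<exists>i. poly (R i) t \<noteq> 0"
proof -
  have "\<exists>\<phi> R. \<phi> \<noteq> 0 \<and> (\<forall>i. P i = \<phi> * R i) \<and> (\<forall>t. \<exists>i. poly (R i) t \<noteq> 0)"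
    using assms
  proof (induction "degree (P i0)" arbitrary: P rule: less_induct)
    case less
    show ?case
    proof (cases "\<forall>t. \<exists>i. poly (P i) t \<noteq> 0")
      case True
      then show ?thesis by (intro exI[of _ 1] exI[of _ P]) auto
    next
      case False
      then obtain t where "\<And>i. poly (P i) t = 0" by auto
      then have "\<forall>i. [:-t, 1:] dvd P i" by (simp add: poly_eq_0_iff_dvd)
      then obtain P' where P': "\<And>i. P i = [:-t, 1:] * P' i" unfolding dvd_def by metis
      have nz: "P' i0 \<noteq> 0" using less.prems P' by auto
      have "degree (P i0) = Suc (degree (P' i0))"
        unfolding P' using nz by (subst degree_mult_eq) auto
      then obtain \<phi> R where "\<phi> \<noteq> 0" "\<forall>i. P' i = \<phi> * R i" "\<forall>t. \<exists>i. poly (R i) t \<noteq> 0"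
        using less.hyps[of P'] nz by auto
      note this(3)
      moreover have "[:-t, 1:] * \<phi> \<noteq> 0" using \<open>\<phi> \<noteq> 0\<close> by (metis mult_eq_0_iff one_neq_zero pCons_eq_0_iff)
      moreover have "P i = [:-t, 1:] * \<phi> * R i" for i
        unfolding P' using \<open>\<forall>i. P' i = \<phi> * R i\<close> by (metis mult.assoc)
      ultimately show ?thesis by blast
    qed
  qed
  then show ?thesis using that by blast
qed

lemma poly_eqI_infinite:
  fixes p q :: "complex poly"
  assumes "\<And>t. poly p t = poly q t"
  shows "p = q"
  using assms by (simp add: poly_eq_poly_eq_iff[symmetric] fun_eq_iff)

section \<open>Regular maps\<close>

definition coords :: "(complex^'n \<Rightarrow> complex) set" where
  "coords = range (\<lambda>i v. v $ i)"

definition coords2 :: "((complex^'a) \<times> (complex^'b) \<Rightarrow> complex) set" where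
  "coords2 = range (\<lambda>i z. fst z $ i) \<union> range (\<lambda>j z. snd z $ j)"

lemma polyring_coord: "(\<lambda>v. v $ i) \<in> polyring coords"
  by (rule polyring.gen) (auto simp: coords_def)

lemma coords2_cases:
  assumes "g \<in> coords2"
  obtains i where "g = (\<lambda>z. fst z $ i)" | j where "g = (\<lambda>z. snd z $ j)"
  using assms unfolding coords2_def by blast

lemma polyring_coord2: "(\<lambda>z. fst z $ i) \<in> polyring coords2" "(\<lambda>z. snd z $ j) \<in> polyring coords2"
  by (auto intro!: polyring.gen simp: coords2_def)

text \<open>A local representation by forms, reduced to polynomial coordinates and homogeneity.
  Nothing is claimed at the points where \<open>F\<close> vanishes.\<close>

definition vrep :: "'n::finite proj set \<Rightarrow> ('n proj \<Rightarrow> 'm::finite proj) \<Rightarrow> nat \<Rightarrow> (complex^'n \<Rightarrow> complex^'m) \<Rightarrow> bool" where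
  "vrep V f d F \<longleftrightarrow> (\<forall>i. (\<lambda>v. F v $ i) \<in> polyring coords) \<and> (\<forall>c v. F (c *s v) = c ^ d *s F v) \<and>
     (\<forall>v. v \<noteq> 0 \<and> abs_proj v \<in> V \<and> F v \<noteq> 0 \<longrightarrow> f (abs_proj v) = abs_proj (F v))"

definition vreg :: "'n::finite proj set \<Rightarrow> ('n proj \<Rightarrow> 'm::finite proj) \<Rightarrow> bool" where
  "vreg V f \<longleftrightarrow> (\<forall>v. v \<noteq> 0 \<and> abs_proj v \<in> V \<longrightarrow> (\<exists>d F. vrep V f d F \<and> F v \<noteq> 0))"

definition prep :: "('a::finite proj \<times> 'b::finite proj \<Rightarrow> 'm::finite proj) \<Rightarrow> nat \<Rightarrow> nat \<Rightarrow>
    (complex^'a \<Rightarrow> complex^'b \<Rightarrow> complex^'m) \<Rightarrow> bool" where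
  "prep f d e F \<longleftrightarrow> (\<forall>i. (\<lambda>z. F (fst z) (snd z) $ i) \<in> polyring coords2) \<and>
     (\<forall>a b x y. F (a *s x) (b *s y) = (a ^ d * b ^ e) *s F x y) \<and>
     (\<forall>v w. v \<noteq> 0 \<and> w \<noteq> 0 \<and> F v w \<noteq> 0 \<longrightarrow> f (abs_proj v, abs_proj w) = abs_proj (F v w))"

definition preg :: "('a::finite proj \<times> 'b::finite proj \<Rightarrow> 'm::finite proj) \<Rightarrow> bool" where
  "preg f \<longleftrightarrow> (\<forall>v w. v \<noteq> 0 \<and> w \<noteq> 0 \<longrightarrow> (\<exists>d e F. prep f d e F \<and> F v w \<noteq> 0))"

lemma form_polyring:
  assumes "form d P" shows "P \<in> polyring coords" "P (c *s v) = c ^ d * P v"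
proof -
  obtain a where a: "\<And>x. P x = (\<Sum>m | sum m UNIV = d. a m * (\<Prod>i\<in>UNIV. (x $ i) ^ m i))"
    using assms unfolding form_def by blast
  have "P = (\<lambda>x. \<Sum>m | sum m UNIV = d. a m * (\<Prod>i\<in>UNIV. (x $ i) ^ m i))" using a by auto
  then show "P \<in> polyring coords"
    by (auto intro!: polyring_intros polyring_coord)
  have "(\<Prod>i\<in>UNIV. (c * v $ i) ^ m i) = c ^ d * (\<Prod>i\<in>UNIV. (v $ i) ^ m i)" if "sum m UNIV = d" for m :: "'a \<Rightarrow> nat"
    by (simp add: power_mult_distrib prod.distrib power_sum that[symmetric])
  then show "P (c *s v) = c ^ d * P v"
    unfolding a by (auto simp: sum_distrib_left intro!: sum.cong)
qed

lemma biform_polyring: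
  assumes "biform d e P"
  shows "(\<lambda>z. P (fst z) (snd z)) \<in> polyring coords2" "P (a *s v) (b *s w) = (a ^ d * b ^ e) * P v w"
proof -
  obtain c where c: "\<And>x y. P x y = (\<Sum>m | sum m UNIV = d. \<Sum>n | sum n UNIV = e.
        c m n * (\<Prod>i\<in>UNIV. (x $ i) ^ m i) * (\<Prod>j\<in>UNIV. (y $ j) ^ n j))"
    using assms unfolding biform_def by blast
  have "(\<lambda>z. P (fst z) (snd z)) = (\<lambda>z. \<Sum>m | sum m UNIV = d. \<Sum>n | sum n UNIV = e.
        c m n * (\<Prod>i\<in>UNIV. (fst z $ i) ^ m i) * (\<Prod>j\<in>UNIV. (snd z $ j) ^ n j))" using c by auto
  then show "(\<lambda>z. P (fst z) (snd z)) \<in> polyring coords2"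
    by (auto intro!: polyring_intros polyring_coord2)
  have *: "(\<Prod>i\<in>UNIV. (a * v $ i) ^ m i) = a ^ d * (\<Prod>i\<in>UNIV. (v $ i) ^ m i)" if "sum m UNIV = d"
    for m :: "_ \<Rightarrow> nat" and a d and v :: "complex^'c"
    by (simp add: power_mult_distrib prod.distrib power_sum that[symmetric])
  show "P (a *s v) (b *s w) = (a ^ d * b ^ e) * P v w"
    unfolding c by (auto simp: sum_distrib_left * mult_ac intro!: sum.cong)
qed

lemma regular_on_imp_vreg:
  assumes "regular_on V f" shows "vreg V f"
  unfolding vreg_def
proof (intro allI impI)
  fix v :: "complex^'a" assume v: "v \<noteq> 0 \<and> abs_proj v \<in> V"
  then obtain d and F :: "complex^'a \<Rightarrow> complex^'b" and v' where F: "\<And>i. form d (\<lambda>x. F x $ i)"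
    "v' \<noteq> 0" "abs_proj v' = abs_proj v" "F v' \<noteq> 0"
    "\<forall>v. v \<noteq> 0 \<and> abs_proj v \<in> V \<and> F v \<noteq> 0 \<longrightarrow> f (abs_proj v) = abs_proj (F v)"
    using assms unfolding regular_on_def by metis
  have sc: "F (c *s w) = c ^ d *s F w" for c w
    using form_polyring(2)[OF F(1)] by (simp add: vec_eq_iff)
  obtain c where "v' = c *s v" using F(2,3) v abs_proj_eq_iff by metis
  then have "F v \<noteq> 0" using F(4) sc[of c v] by auto
  moreover have "vrep V f d F"
    unfolding vrep_def using form_polyring(1)[OF F(1)] sc F(5) by blast
  ultimately show "\<exists>d F. vrep V f d F \<and> F v \<noteq> 0" by blast
qed

lemma regular_prod_imp_preg:
  assumes "regular_prod f" shows "preg f"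
  unfolding preg_def
proof (intro allI impI)
  fix v :: "complex^'a" and w :: "complex^'b" assume v: "v \<noteq> 0 \<and> w \<noteq> 0"
  obtain d e and F :: "complex^'a \<Rightarrow> complex^'b \<Rightarrow> complex^'c" and v' w' where F: "\<And>i. biform d e (\<lambda>x y. F x y $ i)"
    "v' \<noteq> 0" "w' \<noteq> 0" "abs_proj v' = abs_proj v" "abs_proj w' = abs_proj w" "F v' w' \<noteq> 0"
    "\<forall>v w. v \<noteq> 0 \<and> w \<noteq> 0 \<and> F v w \<noteq> 0 \<longrightarrow> f (abs_proj v, abs_proj w) = abs_proj (F v w)"
    using assms[unfolded regular_prod_def, rule_format, of "(abs_proj v, abs_proj w)"] by blast
  have sc: "F (a *s x) (b *s y) = (a ^ d * b ^ e) *s F x y" for a b x y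
    using biform_polyring(2)[OF F(1)] by (simp add: vec_eq_iff)
  obtain c where "v' = c *s v" using F v abs_proj_eq_iff by metis
  moreover obtain c' where "w' = c' *s w" using F v abs_proj_eq_iff by metis
  ultimately have "F v w \<noteq> 0" using F(6) sc[of c v c' w] by auto
  moreover have "prep f d e F"
    unfolding prep_def using biform_polyring(1)[OF F(1)] sc F(7) by blast
  ultimately show "\<exists>d e F. prep f d e F \<and> F v w \<noteq> 0" by blast
qed

text \<open>Homogeneity with scalar 0 leaves only degree 0. This is the degenerate case of a
  composition in which the inner representation vanishes at a point but the outer one does
  not.\<close>

lemma vrep_at_zero:
  assumes "vrep V f d F" "F 0 \<noteq> 0"
  shows "F v = F 0"
proof -
  have sc: "F (c *s v) = c ^ d *s F v" for c v using assms unfolding vrep_def by blast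
  have "d = 0"
  proof (rule ccontr)
    assume "d \<noteq> 0"
    then show False using sc[of 0 0] assms(2) by (simp add: zero_power)
  qed
  then show ?thesis using sc[of 0 v] by simp
qed

lemma preg_compose:
  assumes "preg \<nu>" "\<And>p. \<nu> p \<in> X" "vreg X h"
  shows "preg (h \<circ> \<nu>)"
  unfolding preg_def
proof (intro allI impI)
  fix v :: "complex^'a" and w :: "complex^'b" assume vw: "v \<noteq> 0 \<and> w \<noteq> 0"
  obtain d e F where F: "prep \<nu> d e F" "F v w \<noteq> 0" using assms(1) vw unfolding preg_def by blast
  then have "\<nu> (abs_proj v, abs_proj w) = abs_proj (F v w)" using vw unfolding prep_def by blast
  then have "abs_proj (F v w) \<in> X" using assms(2) by metis
  then obtain k E where E: "vrep X h k E" "E (F v w) \<noteq> 0"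
    using assms(3) F(2) unfolding vreg_def by blast
  have "prep (h \<circ> \<nu>) (d * k) (e * k) (\<lambda>x y. E (F x y))"
    unfolding prep_def
  proof (intro conjI allI impI)
    fix i
    have "(\<lambda>v. E v $ i) \<in> polyring coords" using E unfolding vrep_def by blast
    then show "(\<lambda>z. E (F (fst z) (snd z)) $ i) \<in> polyring coords2"
      by (rule polyring_compose) (use F(1) in \<open>auto simp: coords_def prep_def\<close>)
  next
    fix a b x y
    have "E (F (a *s x) (b *s y)) = E ((a ^ d * b ^ e) *s F x y)"
      using F(1) unfolding prep_def by metis
    then show "E (F (a *s x) (b *s y)) = (a ^ (d * k) * b ^ (e * k)) *s E (F x y)"
      using E(1) unfolding vrep_def by (metis power_mult power_mult_distrib)
  next
    fix x :: "complex^'a" and y :: "complex^'b" assume xy: "x \<noteq> 0 \<and> y \<noteq> 0 \<and> E (F x y) \<noteq> 0"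
    show "(h \<circ> \<nu>) (abs_proj x, abs_proj y) = abs_proj (E (F x y))"
    proof (cases "F x y = 0")
      case False
      then have "\<nu> (abs_proj x, abs_proj y) = abs_proj (F x y)" using F(1) xy unfolding prep_def by blast
      moreover from this have "h (abs_proj (F x y)) = abs_proj (E (F x y))"
        using E(1) xy assms(2) False unfolding vrep_def by metis
      ultimately show ?thesis by simp
    next
      case True
      obtain u where u: "u \<noteq> 0" "\<nu> (abs_proj x, abs_proj y) = abs_proj u" using proj_cases by metis
      then have "h (abs_proj u) = abs_proj (E u)"
        using E(1) xy assms(2) True vrep_at_zero[OF E(1)] unfolding vrep_def by metis
      then show ?thesis using vrep_at_zero[OF E(1), of u] True xy u by simp
    qed
  qed
  then show "\<exists>d e F. prep (h \<circ> \<nu>) d e F \<and> F v w \<noteq> 0" using E(2) by blast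
qed

lemma vreg_compose:
  assumes "vreg X f" "\<And>p. p \<in> X \<Longrightarrow> f p \<in> Y" "vreg Y h"
  shows "vreg X (h \<circ> f)"
  unfolding vreg_def
proof (intro allI impI)
  fix v :: "complex^'a" assume v: "v \<noteq> 0 \<and> abs_proj v \<in> X"
  obtain d F where F: "vrep X f d F" "F v \<noteq> 0" using assms(1) v unfolding vreg_def by blast
  then have "f (abs_proj v) = abs_proj (F v)" using v unfolding vrep_def by blast
  then have "abs_proj (F v) \<in> Y" using assms(2) v by metis
  then obtain k E where E: "vrep Y h k E" "E (F v) \<noteq> 0"
    using assms(3) F(2) unfolding vreg_def by blast
  have "vrep X (h \<circ> f) (d * k) (\<lambda>x. E (F x))"
    unfolding vrep_def
  proof (intro conjI allI impI)
    fix i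
    have "(\<lambda>v. E v $ i) \<in> polyring coords" using E unfolding vrep_def by blast
    then show "(\<lambda>z. E (F z) $ i) \<in> polyring coords"
      by (rule polyring_compose) (use F(1) in \<open>auto simp: coords_def vrep_def\<close>)
  next
    fix a x
    have "E (F (a *s x)) = E ((a ^ d) *s F x)"
      using F(1) unfolding vrep_def by metis
    then show "E (F (a *s x)) = (a ^ (d * k)) *s E (F x)"
      using E(1) unfolding vrep_def by (metis power_mult)
  next
    fix x :: "complex^'a" assume xy: "x \<noteq> 0 \<and> abs_proj x \<in> X \<and> E (F x) \<noteq> 0"
    show "(h \<circ> f) (abs_proj x) = abs_proj (E (F x))"
    proof (cases "F x = 0")
      case False
      then have "f (abs_proj x) = abs_proj (F x)" using F(1) xy unfolding vrep_def by blast
      moreover from this have "h (abs_proj (F x)) = abs_proj (E (F x))"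
        using E(1) xy assms(2) False unfolding vrep_def by metis
      ultimately show ?thesis by simp
    next
      case True
      obtain u where u: "u \<noteq> 0" "f (abs_proj x) = abs_proj u" using proj_cases by metis
      then have "h (abs_proj u) = abs_proj (E u)"
        using E(1) xy assms(2) True vrep_at_zero[OF E(1)] unfolding vrep_def by metis
      then show ?thesis using vrep_at_zero[OF E(1), of u] True xy u by simp
    qed
  qed
  then show "\<exists>d F. vrep X (h \<circ> f) d F \<and> F v \<noteq> 0" using E(2) by blast
qed

lemma preg_swap:
  assumes "preg f" shows "preg (f \<circ> prod.swap)"
  unfolding preg_def
proof (intro allI impI)
  fix v :: "complex^'b" and w :: "complex^'a" assume vw: "v \<noteq> 0 \<and> w \<noteq> 0"
  obtain d e F where F: "prep f d e F" "F w v \<noteq> 0" using assms(1) vw unfolding preg_def by blast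
  have "prep (f \<circ> prod.swap) e d (\<lambda>x y. F y x)"
    unfolding prep_def
  proof (intro conjI allI impI)
    fix i
    have "(\<lambda>z. F (fst z) (snd z) $ i) \<in> polyring coords2" using F unfolding prep_def by blast
    then have "(\<lambda>z. F (fst (prod.swap z)) (snd (prod.swap z)) $ i) \<in> polyring coords2"
      by (rule polyring_compose[where c = prod.swap]) (auto elim!: coords2_cases intro: polyring_coord2)
    then show "(\<lambda>z. F (snd z) (fst z) $ i) \<in> polyring coords2" by simp
  qed (use F(1) in \<open>auto simp: prep_def mult.commute\<close>)
  then show "\<exists>d e F'. prep (f \<circ> prod.swap) d e F' \<and> F' v w \<noteq> 0" using F(2) by blast
qed

lemma prep_cross:
  assumes "prep f a b A" "prep f c d E" "x \<noteq> 0" "y \<noteq> 0"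
  shows "A x y $ i * E x y $ j = A x y $ j * E x y $ i"
proof (cases "A x y = 0 \<or> E x y = 0")
  case False
  then have "abs_proj (A x y) = abs_proj (E x y)" using assms unfolding prep_def by metis
  then show ?thesis using abs_proj_eq_cross False by blast
qed auto

lemma vrep_cross:
  assumes "vrep V f a A" "vrep V f c E" "x \<noteq> 0" "abs_proj x \<in> V"
  shows "A x $ i * E x $ j = A x $ j * E x $ i"
proof (cases "A x = 0 \<or> E x = 0")
  case False
  then have "abs_proj (A x) = abs_proj (E x)" using assms unfolding vrep_def by metis
  then show ?thesis using abs_proj_eq_cross False by blast
qed auto

section \<open>Automorphisms of a product of two projective lines\<close>

lemma eventually_nonzero_vec:
  fixes A :: "complex \<Rightarrow> complex^'n"
  assumes "\<And>i. ((\<lambda>u. A u $ i) has_field_derivative D i) (at 0)" "A 0 \<noteq> 0"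
  shows "\<forall>\<^sub>F u in nhds 0. A u \<noteq> 0"
proof -
  obtain k where k: "A 0 $ k \<noteq> 0" using assms(2) by (metis vec_eq_iff zero_index)
  have "isCont (\<lambda>u. A u $ k) 0" using assms(1) DERIV_isCont by blast
  then have "((\<lambda>u. A u $ k) \<longlongrightarrow> A 0 $ k) (nhds 0)"
    by (metis isContD tendsto_at_iff_tendsto_nhds)
  from tendsto_imp_eventually_ne[OF this k]
  show ?thesis by eventually_elim auto
qed

text \<open>A curve whose homogeneous velocities are multiples of the positions \<open>A 0\<close>
  and \<open>B 0\<close> stands still in the product to first order, and a regular map cannot set it
  in motion. Applied to the components of an inverse map, it shows that a direction killed by the
  differential is radial.\<close>

lemma tangent_in_kernel:
  fixes A :: "complex \<Rightarrow> complex^'c" and B :: "complex \<Rightarrow> complex^'d" and x0 x1 :: "complex^'a"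
  assumes "preg \<gamma>" "A 0 \<noteq> 0" "B 0 \<noteq> 0" "x0 \<noteq> 0"
    and val: "\<And>u. A u \<noteq> 0 \<Longrightarrow> B u \<noteq> 0 \<Longrightarrow> x0 + u *s x1 \<noteq> 0 \<Longrightarrow> \<gamma> (abs_proj (A u), abs_proj (B u)) = abs_proj (x0 + u *s x1)"
    and dA: "\<And>i. ((\<lambda>u. A u $ i) has_field_derivative (\<mu> * A 0 $ i)) (at 0)"
    and dB: "\<And>i. ((\<lambda>u. B u $ i) has_field_derivative (\<eta> * B 0 $ i)) (at 0)"
  shows "\<exists>k. x1 = k *s x0"
proof -
  obtain d e C where C: "prep \<gamma> d e C" "C (A 0) (B 0) \<noteq> 0"
    using assms(1-3) unfolding preg_def by blast
  \<comment> \<open>By bihomogeneity, \<open>C\<close> is multiplied by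
    \<open>1 + \<kappa> * u\<close> to first order when its arguments are scaled by
    \<open>1 + \<mu> * u\<close> and \<open>1 + \<eta> * u\<close>.\<close>
  define \<kappa> where "\<kappa> = of_nat d * \<mu> + of_nat e * \<eta>"
  define g where "g u = C (A u) (B u)" for u
  have dg: "((\<lambda>u. g u $ i) has_field_derivative (\<kappa> * g 0 $ i)) (at 0)" for i
  proof -
    have "(\<lambda>z. C (fst z) (snd z) $ i) \<in> polyring coords2" using C unfolding prep_def by blast
    note jet = polyring_same_jet[OF this, of "\<lambda>u. (A u, B u)" "\<lambda>u. ((1 + \<mu> * u) *s A 0, (1 + \<eta> * u) *s B 0)"]
    have d1: "((\<lambda>u. (1 + \<mu> * u) * A 0 $ i) has_field_derivative \<mu> * A 0 $ i) (at 0)" for i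
      by (auto intro!: derivative_eq_intros)
    have d2: "((\<lambda>u. (1 + \<eta> * u) * B 0 $ j) has_field_derivative \<eta> * B 0 $ j) (at 0)" for j
      by (auto intro!: derivative_eq_intros)
    have "\<exists>D. ((\<lambda>u. C (fst (A u, B u)) (snd (A u, B u)) $ i) has_field_derivative D) (at 0) \<and>
      ((\<lambda>u. C (fst ((1 + \<mu> * u) *s A 0, (1 + \<eta> * u) *s B 0)) (snd ((1 + \<mu> * u) *s A 0, (1 + \<eta> * u) *s B 0)) $ i)
          has_field_derivative D) (at 0)"
    proof (rule conjunct2[OF jet])
      fix g :: "(complex^'c) \<times> (complex^'d) \<Rightarrow> complex" assume g: "g \<in> coords2"
      show "g (A 0, B 0) = g ((1 + \<mu> * 0) *s A 0, (1 + \<eta> * 0) *s B 0)"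
        using g by (auto elim!: coords2_cases)
      show "\<exists>D. ((\<lambda>u. g (A u, B u)) has_field_derivative D) (at 0) \<and>
        ((\<lambda>u. g ((1 + \<mu> * u) *s A 0, (1 + \<eta> * u) *s B 0)) has_field_derivative D) (at 0)"
        using g
      proof (cases rule: coords2_cases)
        case (1 i)
        show ?thesis unfolding 1 using conjI[OF dA[of i] d1[of i]] by (auto simp: algebra_simps)
      next
        case (2 j)
        show ?thesis unfolding 2 using conjI[OF dB[of j] d2[of j]] by (auto simp: algebra_simps)
      qed
    qed
    then obtain D where D: "((\<lambda>u. C (A u) (B u) $ i) has_field_derivative D) (at 0)"
      "((\<lambda>u. C ((1 + \<mu> * u) *s A 0) ((1 + \<eta> * u) *s B 0) $ i) has_field_derivative D) (at 0)"
      by auto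
    have eq: "C ((1 + \<mu> * u) *s A 0) ((1 + \<eta> * u) *s B 0) $ i = (1 + \<mu> * u) ^ d * (1 + \<eta> * u) ^ e * g 0 $ i" for u
      using C(1) unfolding prep_def g_def by (metis vector_smult_component)
    have dd: "((\<lambda>u. (1 + \<mu> * u) ^ d * (1 + \<eta> * u) ^ e * g 0 $ i) has_field_derivative \<kappa> * g 0 $ i) (at 0)"
      by (auto intro!: derivative_eq_intros simp: \<kappa>_def algebra_simps)
    have "D = \<kappa> * g 0 $ i" by (rule DERIV_unique[OF D(2)[unfolded eq] dd])
    then show ?thesis using D(1) unfolding g_def by simp
  qed
  define x where "x u = x0 + u *s x1" for u
  have dx: "((\<lambda>u. x u $ i) has_field_derivative (x1 $ i)) (at 0)" for i
    unfolding x_def by (auto intro!: derivative_eq_intros)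
  have x0: "x 0 = x0" by (simp add: x_def)
  have ev: "\<forall>\<^sub>F u in nhds 0. x u $ i * g u $ j - x u $ j * g u $ i = 0" for i j
    using eventually_nonzero_vec[OF dA assms(2)] eventually_nonzero_vec[OF dB assms(3)]
      eventually_nonzero_vec[OF dx, unfolded x0, OF assms(4)]
  proof eventually_elim
    case (elim u)
    have "g u = 0 \<or> abs_proj (g u) = abs_proj (x u)"
      using elim val[of u] C(1) unfolding prep_def g_def x_def by metis
    then show ?case using abs_proj_eq_cross[of "g u" "x u" i j] elim by (cases "g u = 0") (auto simp: mult.commute)
  qed
  have zero: "x0 $ i * (\<kappa> * g 0 $ j) + x1 $ i * g 0 $ j - (x0 $ j * (\<kappa> * g 0 $ i) + x1 $ j * g 0 $ i) = 0" for i j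
  proof -
    have "((\<lambda>u. x u $ i * g u $ j - x u $ j * g u $ i) has_field_derivative
       (x 0 $ i * (\<kappa> * g 0 $ j) + x1 $ i * g 0 $ j - (x 0 $ j * (\<kappa> * g 0 $ i) + x1 $ j * g 0 $ i))) (at 0)"
      by (auto intro!: derivative_eq_intros dx dg)
    moreover have "((\<lambda>u. x u $ i * g u $ j - x u $ j * g u $ i) has_field_derivative 0) (at 0) \<longleftrightarrow>
        ((\<lambda>u::complex. 0::complex) has_field_derivative 0) (at 0)"
      by (rule DERIV_cong_ev) (use ev in auto)
    then have "((\<lambda>u. x u $ i * g u $ j - x u $ j * g u $ i) has_field_derivative 0) (at 0)"
      by simp
    ultimately show ?thesis unfolding x0 by (rule DERIV_unique)
  qed
  have "g 0 \<noteq> 0" using C(2) g_def by simp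
  moreover from this have eq: "abs_proj (g 0) = abs_proj x0"
    using val[of 0] assms(2-4) C(1) unfolding prep_def g_def by simp
  ultimately obtain k where k: "g 0 = k *s x0" "k \<noteq> 0"
    using abs_proj_eq_iff assms(4) by (metis vector_smult_lzero)
  have "x0 $ i * x1 $ j = x0 $ j * x1 $ i" for i j
    using zero[of i j] k by (simp add: algebra_simps)
  then show ?thesis using cross_imp_scale[OF assms(4)] by metis
qed

section \<open>Wedges and Jacobians along a line of P^1 x P^1, and their degrees\<close>

definition wedge :: "'a::comm_ring_1^2 \<Rightarrow> 'a^2 \<Rightarrow> 'a" where
  "wedge u v = u $ 1 * v $ 2 - u $ 2 * v $ 1"

lemma wedge_cross: "wedge u v = 0 \<longleftrightarrow> (\<forall>i j. u $ i * v $ j = u $ j * v $ i)"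
  unfolding wedge_def forall_2 by (auto simp: algebra_simps)

lemma wedge_zero_imp_scale:
  assumes "wedge u v = 0" "u \<noteq> (0 :: complex^2)"
  obtains c where "v = c *s u"
  using assms cross_imp_scale unfolding wedge_cross by metis

text \<open>Formally \<open>b = h a\<close>, hence \<open>b' = h' a + h a'\<close>; the wedge with
  \<open>b\<close> kills the term with \<open>h'\<close>, so the wedge of position and velocity is
  multiplied by the square of \<open>h = b_i / a_i\<close>.\<close>

lemma wedge_derivative_ratio:
  fixes a b a' b' :: "'a::idom^2"
  assumes "wedge a b = 0" "wedge a' b + wedge a b' = 0"
  shows "(b $ i)\<^sup>2 * wedge a a' = (a $ i)\<^sup>2 * wedge b b'"
proof -
  have e: "a $ 1 * b $ 2 = a $ 2 * b $ 1"
      "a' $ 1 * b $ 2 + a $ 1 * b' $ 2 = a' $ 2 * b $ 1 + a $ 2 * b' $ 1"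
    using assms by (auto simp: wedge_def algebra_simps)
  have "(b $ 1)\<^sup>2 * (a $ 1 * a' $ 2 - a $ 2 * a' $ 1) = (a $ 1)\<^sup>2 * (b $ 1 * b' $ 2 - b $ 2 * b' $ 1)"
    using e by algebra
  moreover have "(b $ 2)\<^sup>2 * (a $ 1 * a' $ 2 - a $ 2 * a' $ 1) = (a $ 2)\<^sup>2 * (b $ 1 * b' $ 2 - b $ 2 * b' $ 1)"
    using e by algebra
  ultimately show ?thesis using exhaust_2[of i] unfolding wedge_def by auto
qed

lemma two_by_two_kernel:
  fixes a b c d :: complex
  assumes "a * d - b * c = 0"
  obtains \<tau> \<sigma> where "(\<tau>, \<sigma>) \<noteq> (0, 0)" "\<tau> * a + \<sigma> * b = 0" "\<tau> * c + \<sigma> * d = 0"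
proof (cases "a = 0 \<and> b = 0")
  case True
  show ?thesis
  proof (cases "c = 0 \<and> d = 0")
    case False then show ?thesis using True by (intro that[of d "-c"]) auto
  qed (use True that[of 1 0] in auto)
next
  case False
  then show ?thesis using assms by (intro that[of b "-a"]) (auto simp: algebra_simps)
qed

text \<open>\<open>P0\<close> is the restriction of a local representation to the line \<open>t \<mapsto> q + t p\<close> at \<open>y0\<close>, and \<open>P2\<close> is its
  derivative in the direction \<open>y1\<close>.\<close>

definition line_jet :: "(complex^'a \<Rightarrow> complex^'b \<Rightarrow> complex^'m) \<Rightarrow> complex^'a \<Rightarrow> complex^'a \<Rightarrow> complex^'b \<Rightarrow> complex^'b \<Rightarrow>
    complex poly^'m \<Rightarrow> complex poly^'m \<Rightarrow> bool" where
  "line_jet A q p y0 y1 P0 P2 \<longleftrightarrow>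
     (\<forall>t i. A (q + t *s p) y0 $ i = poly (P0 $ i) t) \<and>
     (\<forall>t \<tau> \<sigma> i. ((\<lambda>u. A (q + (t + \<tau> * u) *s p) (y0 + (\<sigma> * u) *s y1) $ i) has_field_derivative
        (\<tau> * poly (pderiv (P0 $ i)) t + \<sigma> * poly (P2 $ i) t)) (at 0))"

definition vpderiv :: "complex poly^'m \<Rightarrow> complex poly^'m" where
  "vpderiv P = (\<chi> i. pderiv (P $ i))"

lemma line_jet_exists:
  assumes "prep f a b A"
  obtains P0 P2 where "line_jet A q p y0 y1 P0 P2"
proof -
  define good where "good i P0 P2 \<longleftrightarrow> (\<forall>t. A (q + t *s p) y0 $ i = poly P0 t) \<and>
     (\<forall>t \<tau> \<sigma>. ((\<lambda>u. A (q + (t + \<tau> * u) *s p) (y0 + (\<sigma> * u) *s y1) $ i) has_field_derivative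
        (\<tau> * poly (pderiv P0) t + \<sigma> * poly P2 t)) (at 0))" for i P0 P2
  have "\<exists>P0 P2. good i P0 P2" for i
  proof -
    define f where "f z = A (q + fst z *s p) (y0 + snd z *s y1) $ i" for z :: "complex \<times> complex"
    have "(\<lambda>z. A (fst z) (snd z) $ i) \<in> polyring coords2" using assms unfolding prep_def by blast
    then have "(\<lambda>z. A (fst (q + fst z *s p, y0 + snd z *s y1)) (snd (q + fst z *s p, y0 + snd z *s y1)) $ i)
        \<in> polyring {fst, snd}"
      by (rule polyring_compose) (auto elim!: coords2_cases intro!: polyring_intros intro: polyring.gen)
    then have f: "f \<in> polyring {fst, snd}" unfolding f_def by simp
    obtain c where c: "\<And>g. c g \<in> polyring {fst, snd}"
      "\<And>v. (f has_derivative (\<lambda>w. \<Sum>g\<in>{fst,snd}. c g v * g w)) (at v)"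
      using polyring_has_derivative[OF f] bounded_linear_fst bounded_linear_snd by blast
    \<comment> \<open>If the two projections coincided as functions, the sum over the set of
      generators would have a single term.\<close>
    have ne: "(fst :: complex \<times> complex \<Rightarrow> complex) \<noteq> snd"
      by (metis fst_conv snd_conv zero_neq_one)
    have poly: "\<exists>p. \<forall>t. h (t, 0) = poly p t" if "h \<in> polyring {fst, snd}" for h :: "complex \<times> complex \<Rightarrow> complex"
    proof -
      have "(\<lambda>t. h (t, 0)) \<in> polyring {\<lambda>t. t}"
        using that by (rule polyring_compose) (auto intro: polyring.const polyring.gen)
      then show ?thesis using polyring_poly by metis
    qed
    obtain P0 where P0: "\<And>t. f (t, 0) = poly P0 t" using poly f by blast
    obtain P1 where P1: "\<And>t. c fst (t, 0) = poly P1 t" using poly c(1) by blast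
    obtain P2 where P2: "\<And>t. c snd (t, 0) = poly P2 t" using poly c(1) by blast
    have der: "((\<lambda>u. f (t + \<tau> * u, \<sigma> * u)) has_field_derivative (\<tau> * poly P1 t + \<sigma> * poly P2 t)) (at 0)" for t \<tau> \<sigma>
    proof -
      have h1: "((\<lambda>u::complex. (t + \<tau> * u, \<sigma> * u)) has_derivative (\<lambda>u. (\<tau> * u, \<sigma> * u))) (at 0)"
        by (auto intro!: derivative_eq_intros)
      have h2: "(f has_derivative (\<lambda>w. c fst (t, 0) * fst w + c snd (t, 0) * snd w)) (at (t + \<tau> * 0, \<sigma> * 0))"
        using c(2)[of "(t, 0)"] ne by simp
      have "((\<lambda>u. f (t + \<tau> * u, \<sigma> * u)) has_derivative
          (\<lambda>u. c fst (t, 0) * (\<tau> * u) + c snd (t, 0) * (\<sigma> * u))) (at 0)"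
        using has_derivative_compose[OF h1 h2] by simp
      then show ?thesis unfolding has_field_derivative_def P1 P2
        by (rule has_derivative_eq_rhs) (auto simp: algebra_simps)
    qed
    have "P1 = pderiv P0"
    proof (rule poly_eqI_infinite)
      fix t
      have "((\<lambda>u. poly P0 (t + u)) has_field_derivative poly P1 t) (at 0)"
        using der[of t 1 0] P0 by simp
      moreover have "((\<lambda>u. poly P0 (t + u)) has_field_derivative poly (pderiv P0) t) (at 0)"
        by (auto intro!: derivative_eq_intros poly_DERIV[THEN DERIV_chain2])
      ultimately show "poly P1 t = poly (pderiv P0) t" by (rule DERIV_unique)
    qed
    then have "good i P0 P2" using der P0 unfolding f_def good_def by simp
    then show ?thesis by blast
  qed
  then obtain P0 P2 where "\<And>i. good i (P0 i) (P2 i)" by metis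
  then have "line_jet A q p y0 y1 (\<chi> i. P0 i) (\<chi> i. P2 i)"
    unfolding line_jet_def good_def by simp
  then show ?thesis using that by blast
qed

lemma line_jet_slice:
  assumes "line_jet A q p y0 y1 P0 P2"
  shows "((\<lambda>\<sigma>. A (q + t *s p) (y0 + \<sigma> *s y1) $ i) has_field_derivative poly (P2 $ i) t) (at 0)"
    "A (q + t *s p) y0 $ i = poly (P0 $ i) t"
  using assms[unfolded line_jet_def, THEN conjunct2, rule_format, of t 0 1 i] assms
  by (simp_all add: line_jet_def)

text \<open>Two representations are proportional at all points of the product, so the vanishing
  cross product may be differentiated along the line and transversally to it.\<close>

lemma line_jet_wedge:
  assumes reps: "prep f a b A" "prep f c d E"
    and nz: "\<And>t. q + t *s p \<noteq> 0" "\<And>s. y0 + s *s y1 \<noteq> 0"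
    and jets: "line_jet A q p y0 y1 P0 P2" "line_jet E q p y0 y1 E0 E2"
  shows "wedge P0 E0 = 0" "wedge (vpderiv P0) E0 + wedge P0 (vpderiv E0) = 0"
    "wedge P2 E0 + wedge P0 E2 = 0"
proof -
  have "P0 $ i * E0 $ j = P0 $ j * E0 $ i" for i j
  proof (rule poly_eqI_infinite)
    fix t
    show "poly (P0 $ i * E0 $ j) t = poly (P0 $ j * E0 $ i) t"
      using prep_cross[OF reps nz(1)[of t] nz(2)[of 0], of i j] jets
      by (simp add: line_jet_slice(2))
  qed
  then show w: "wedge P0 E0 = 0" unfolding wedge_cross by blast
  then have "pderiv (wedge P0 E0) = 0" by simp
  then show "wedge (vpderiv P0) E0 + wedge P0 (vpderiv E0) = 0"
    unfolding wedge_def vpderiv_def by (simp add: pderiv_diff pderiv_mult algebra_simps)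
  show "wedge P2 E0 + wedge P0 E2 = 0"
  proof (rule poly_eqI_infinite)
    fix t
    let ?A = "\<lambda>\<sigma>. A (q + t *s p) (y0 + \<sigma> *s y1)" and ?E = "\<lambda>\<sigma>. E (q + t *s p) (y0 + \<sigma> *s y1)"
    have z: "?A \<sigma> $ 1 * ?E \<sigma> $ 2 - ?A \<sigma> $ 2 * ?E \<sigma> $ 1 = 0" for \<sigma>
      using prep_cross[OF reps nz(1)[of t] nz(2)[of \<sigma>], of 1 2] by simp
    have "((\<lambda>\<sigma>. ?A \<sigma> $ 1 * ?E \<sigma> $ 2 - ?A \<sigma> $ 2 * ?E \<sigma> $ 1) has_field_derivative
       poly (wedge P2 E0 + wedge P0 E2) t) (at 0)"
      by (rule derivative_eq_intros line_jet_slice[OF jets(1)] line_jet_slice[OF jets(2)] refl)+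
        (simp add: line_jet_slice(2)[OF jets(1)] line_jet_slice(2)[OF jets(2)] wedge_def algebra_simps)
    then have "((\<lambda>\<sigma>. 0) has_field_derivative poly (wedge P2 E0 + wedge P0 E2) t) (at 0)"
      unfolding z .
    then show "poly (wedge P2 E0 + wedge P0 E2) t = poly 0 t"
      using DERIV_unique[OF _ DERIV_const] by simp
  qed
qed

lemma prep_value:
  assumes "prep f a b A" "x \<noteq> 0" "y \<noteq> 0" "A x y \<noteq> 0"
  shows "f (abs_proj x, abs_proj y) = abs_proj (A x y)"
  using assms unfolding prep_def by blast

text \<open>The derivative of the affine coordinate \<open>x2 / x1\<close> is the wedge of position
  and velocity divided by \<open>x1^2\<close>. Up to such squares this is the two by two Jacobian
  determinant, with one row per component and with the direction of the line and the transversal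
  direction as columns.\<close>

definition jacobian :: "complex poly^2 \<Rightarrow> complex poly^2 \<Rightarrow> complex poly^2 \<Rightarrow> complex poly^2 \<Rightarrow> complex poly" where
  "jacobian P0 P2 Q0 Q2 = wedge P0 (vpderiv P0) * wedge Q0 Q2 - wedge P0 P2 * wedge Q0 (vpderiv Q0)"

lemma independent_line:
  assumes "\<And>k. q \<noteq> k *s p" "p \<noteq> 0" shows "q + t *s p \<noteq> (0 :: complex^'n)"
  using assms(1)[of "-t"] by (auto simp: add_eq_0_iff2 vec_eq_iff)

text \<open>A zero yields a direction \<open>(\<tau>, \<sigma>)\<close> in which both components of
  \<open>\<alpha>\<close> stand still to first order. Then \<open>\<beta> \<circ> \<alpha>\<close>,
  the identity, stands still as well, so the direction is radial in both factors, which independence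
  of \<open>p, q\<close> and of \<open>y0, y1\<close> excludes.\<close>

lemma jacobian_nonzero:
  fixes \<alpha> :: "2 proj \<times> 2 proj \<Rightarrow> 2 proj \<times> 2 proj"
  assumes inv: "preg (fst \<circ> \<beta>)" "preg (snd \<circ> \<beta>)" "\<And>p. \<beta> (\<alpha> p) = p"
    and reps: "prep (fst \<circ> \<alpha>) a b A" "prep (snd \<circ> \<alpha>) c d B"
    and ind: "p \<noteq> 0" "\<And>k. q \<noteq> k *s p" "y1 \<noteq> 0" "\<And>k. y0 \<noteq> k *s y1"
    and jets: "line_jet A q p y0 y1 P0 P2" "line_jet B q p y0 y1 Q0 Q2"
    and nz: "A (q + t *s p) y0 \<noteq> 0" "B (q + t *s p) y0 \<noteq> 0"
  shows "poly (jacobian P0 P2 Q0 Q2) t \<noteq> 0"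
proof
  let ?w = "\<lambda>P0 P1. poly (wedge P0 P1) t"
  assume "poly (jacobian P0 P2 Q0 Q2) t = 0"
  then have "?w P0 (vpderiv P0) * ?w Q0 Q2 - ?w P0 P2 * ?w Q0 (vpderiv Q0) = 0"
    by (simp add: jacobian_def)
  then obtain \<tau> \<sigma> where ts: "(\<tau>, \<sigma>) \<noteq> (0, 0)"
      "\<tau> * ?w P0 (vpderiv P0) + \<sigma> * ?w P0 P2 = 0" "\<tau> * ?w Q0 (vpderiv Q0) + \<sigma> * ?w Q0 Q2 = 0"
    using two_by_two_kernel by metis
  define A' where "A' u = A (q + (t + \<tau> * u) *s p) (y0 + (\<sigma> * u) *s y1)" for u
  define B' where "B' u = B (q + (t + \<tau> * u) *s p) (y0 + (\<sigma> * u) *s y1)" for u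
  have nzx: "q + t *s p \<noteq> 0" for t using independent_line ind(1,2) by blast
  have nzy: "y0 + s *s y1 \<noteq> 0" for s using independent_line ind(3,4) by blast
  have nz0: "A' 0 \<noteq> 0" "B' 0 \<noteq> 0" using nz by (auto simp: A'_def B'_def)
  have der: "((\<lambda>u. A' u $ i) has_field_derivative (\<tau> * poly (pderiv (P0 $ i)) t + \<sigma> * poly (P2 $ i) t)) (at 0)"
    "((\<lambda>u. B' u $ i) has_field_derivative (\<tau> * poly (pderiv (Q0 $ i)) t + \<sigma> * poly (Q2 $ i) t)) (at 0)" for i
    using jets unfolding line_jet_def A'_def B'_def by blast+
  have c0: "A' 0 $ i = poly (P0 $ i) t" "B' 0 $ i = poly (Q0 $ i) t" for i
    using line_jet_slice(2)[OF jets(1)] line_jet_slice(2)[OF jets(2)] by (auto simp: A'_def B'_def)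
  have "wedge (A' 0) (\<chi> i. \<tau> * poly (pderiv (P0 $ i)) t + \<sigma> * poly (P2 $ i) t) = 0"
    using ts(2) by (simp add: wedge_def c0 vpderiv_def algebra_simps)
  then obtain \<mu> where \<mu>: "(\<chi> i. \<tau> * poly (pderiv (P0 $ i)) t + \<sigma> * poly (P2 $ i) t) = \<mu> *s A' 0"
    using wedge_zero_imp_scale nz0 by metis
  have "wedge (B' 0) (\<chi> i. \<tau> * poly (pderiv (Q0 $ i)) t + \<sigma> * poly (Q2 $ i) t) = 0"
    using ts(3) by (simp add: wedge_def c0 vpderiv_def algebra_simps)
  then obtain \<eta> where \<eta>: "(\<chi> i. \<tau> * poly (pderiv (Q0 $ i)) t + \<sigma> * poly (Q2 $ i) t) = \<eta> *s B' 0"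
    using wedge_zero_imp_scale nz0 by metis
  have dA: "((\<lambda>u. A' u $ i) has_field_derivative (\<mu> * A' 0 $ i)) (at 0)" for i
    using der(1)[of i] arg_cong[OF \<mu>, of "\<lambda>v. v $ i"] by simp
  have dB: "((\<lambda>u. B' u $ i) has_field_derivative (\<eta> * B' 0 $ i)) (at 0)" for i
    using der(2)[of i] arg_cong[OF \<eta>, of "\<lambda>v. v $ i"] by simp
  have val: "\<beta> (abs_proj (A' u), abs_proj (B' u)) =
      (abs_proj (q + (t + \<tau> * u) *s p), abs_proj (y0 + (\<sigma> * u) *s y1))"
    if "A' u \<noteq> 0" "B' u \<noteq> 0" for u
  proof -
    let ?z = "(abs_proj (q + (t + \<tau> * u) *s p), abs_proj (y0 + (\<sigma> * u) *s y1))"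
    have "(fst \<circ> \<alpha>) ?z = abs_proj (A' u)" "(snd \<circ> \<alpha>) ?z = abs_proj (B' u)"
      using prep_value[OF reps(1) nzx nzy that(1)[unfolded A'_def]]
        prep_value[OF reps(2) nzx nzy that(2)[unfolded B'_def]] unfolding A'_def B'_def .
    then have "\<alpha> ?z = (abs_proj (A' u), abs_proj (B' u))" by (simp add: prod_eq_iff)
    then show ?thesis using inv(3) by metis
  qed
  have "\<exists>k. \<tau> *s p = k *s (q + t *s p)"
    by (rule tangent_in_kernel[OF inv(1) nz0 nzx[of t] _ dA dB])
      (use val in \<open>auto simp: vec_eq_iff algebra_simps\<close>)
  then obtain k where k: "\<tau> *s p = k *s (q + t *s p)" by blast
  have "\<tau> = 0"
  proof (rule ccontr)
    assume "\<tau> \<noteq> 0"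
    then have "k \<noteq> 0" using k ind(1) by (auto simp: scale_vec_zero_iff)
    then have "q = ((\<tau> - k * t) / k) *s p" using k by (simp add: vec_eq_iff field_simps)
    then show False using ind(2) by blast
  qed
  moreover have "\<exists>k. \<sigma> *s y1 = k *s y0"
    by (rule tangent_in_kernel[OF inv(2) nz0 nzy[of 0, simplified] _ dA dB])
      (use val in \<open>auto simp: vec_eq_iff algebra_simps\<close>)
  then obtain k where k: "\<sigma> *s y1 = k *s y0" by blast
  have "\<sigma> = 0"
  proof (rule ccontr)
    assume "\<sigma> \<noteq> 0"
    then have "k \<noteq> 0" using k ind(3) by (auto simp: scale_vec_zero_iff)
    then have "y0 = (\<sigma> / k) *s y1" using k by (simp add: vec_eq_iff field_simps)
    then show False using ind(4) by blast
  qed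
  ultimately show False using ts(1) by simp
qed


text \<open>The two charts of the line are related by
  \<open>q + t *s p = t *s (p + (1 / t) *s q)\<close> and homogeneity. The factor
  \<open>t\<^sup>2\<close> in the last formula cancels the denominator of the derivative of
  \<open>1 / t\<close>.\<close>

lemma line_jet_reversal:
  assumes "prep f a b A" "line_jet A q p y0 y1 P0 P2" "line_jet A p q y0 y1 R0 R2" "t \<noteq> 0"
  shows "poly (P0 $ i) t = t ^ a * poly (R0 $ i) (1 / t)"
    "poly (P2 $ i) t = t ^ a * poly (R2 $ i) (1 / t)"
    "t\<^sup>2 * poly (pderiv (P0 $ i)) t =
       of_nat a * t ^ Suc a * poly (R0 $ i) (1 / t) - t ^ a * poly (pderiv (R0 $ i)) (1 / t)"
proof -
  have sc: "A (q + t *s p) y $ i = t ^ a * A (p + (1 / t) *s q) y $ i" if "t \<noteq> 0" for y t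
  proof -
    have "q + t *s p = t *s (p + (1 / t) *s q)" using that by (simp add: vec_eq_iff field_simps)
    then have "A (q + t *s p) y = A (t *s (p + (1 / t) *s q)) (1 *s y)" by (metis vector_smult_lid)
    also have "\<dots> = (t ^ a * 1 ^ b) *s A (p + (1 / t) *s q) y"
      using assms(1) unfolding prep_def by blast
    finally show ?thesis by simp
  qed
  have v: "poly (P0 $ i) t = t ^ a * poly (R0 $ i) (1 / t)" if "t \<noteq> 0" for t
    using sc[OF that, of y0] line_jet_slice(2)[OF assms(2)] line_jet_slice(2)[OF assms(3)] by simp
  show "poly (P0 $ i) t = t ^ a * poly (R0 $ i) (1 / t)" by (rule v[OF assms(4)])
  have "((\<lambda>\<sigma>. t ^ a * A (p + (1 / t) *s q) (y0 + \<sigma> *s y1) $ i) has_field_derivative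
      t ^ a * poly (R2 $ i) (1 / t)) (at 0)"
    by (rule DERIV_cmult[OF line_jet_slice(1)[OF assms(3)]])
  then have "((\<lambda>\<sigma>. A (q + t *s p) (y0 + \<sigma> *s y1) $ i) has_field_derivative
      t ^ a * poly (R2 $ i) (1 / t)) (at 0)"
    unfolding sc[OF assms(4)] .
  then show "poly (P2 $ i) t = t ^ a * poly (R2 $ i) (1 / t)"
    using line_jet_slice(1)[OF assms(2)] DERIV_unique by blast
  have "\<forall>\<^sub>F u in nhds t. u \<in> - {0}"
    using assms(4) by (intro eventually_nhds_in_open) auto
  then have ev: "\<forall>\<^sub>F u in nhds t. poly (P0 $ i) u = u ^ a * poly (R0 $ i) (1 / u)"
    by eventually_elim (simp add: v)
  have "((\<lambda>u. poly (P0 $ i) u) has_field_derivative poly (pderiv (P0 $ i)) t) (at t)"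
    by (rule poly_DERIV)
  moreover have "(poly (P0 $ i) has_field_derivative poly (pderiv (P0 $ i)) t) (at t) \<longleftrightarrow>
     ((\<lambda>u. u ^ a * poly (R0 $ i) (1 / u)) has_field_derivative poly (pderiv (P0 $ i)) t) (at t)"
    by (rule DERIV_cong_ev) (use ev in auto)
  moreover have "((\<lambda>u. u ^ a * poly (R0 $ i) (1 / u)) has_field_derivative
     of_nat a * t ^ (a - 1) * poly (R0 $ i) (1 / t) + t ^ a * (poly (pderiv (R0 $ i)) (1 / t) * (- 1 / t\<^sup>2))) (at t)"
    using assms(4) by (auto intro!: derivative_eq_intros poly_DERIV[THEN DERIV_chain2] simp: power2_eq_square)
  ultimately have D: "poly (pderiv (P0 $ i)) t =
     of_nat a * t ^ (a - 1) * poly (R0 $ i) (1 / t) + t ^ a * (poly (pderiv (R0 $ i)) (1 / t) * (- 1 / t\<^sup>2))"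
    using DERIV_unique by blast
  show "t\<^sup>2 * poly (pderiv (P0 $ i)) t =
       of_nat a * t ^ Suc a * poly (R0 $ i) (1 / t) - t ^ a * poly (pderiv (R0 $ i)) (1 / t)"
    unfolding D using assms(4) by (cases a) (simp_all add: field_simps power2_eq_square)
qed

text \<open>The term with \<open>of_nat a\<close> in the reversed derivative is radial and
  disappears in the wedge. So \<open>t^2\<close> times the Jacobian is minus
  \<open>t^(2a + 2c)\<close> times the Jacobian of the other chart at \<open>1 / t\<close>; as the
  latter is nonzero at 0, the degree is exact.\<close>

lemma jacobian_degree:
  assumes reps: "prep f a b A" "prep g c d B"
    and jets: "line_jet A q p y0 y1 P0 P2" "line_jet B q p y0 y1 Q0 Q2"
      "line_jet A p q y0 y1 R0 R2" "line_jet B p q y0 y1 S0 S2"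
    and nz: "poly (jacobian R0 R2 S0 S2) 0 \<noteq> 0"
  shows "degree (jacobian P0 P2 Q0 Q2) + 2 = 2 * a + 2 * c"
proof -
  note r = line_jet_reversal[OF reps(1) jets(1,3)] line_jet_reversal[OF reps(2) jets(2,4)]
  have "poly (monom 1 2 * jacobian P0 P2 Q0 Q2) t = t ^ (2 * a + 2 * c) * poly (- jacobian R0 R2 S0 S2) (1 / t)"
    if t: "t \<noteq> 0" for t
  proof -
    have w2: "poly (wedge P0 P2) t = t ^ (2 * a) * poly (wedge R0 R2) (1 / t)"
         "poly (wedge Q0 Q2) t = t ^ (2 * c) * poly (wedge S0 S2) (1 / t)"
      unfolding wedge_def by (simp_all add: r[OF t] algebra_simps power_mult power2_eq_square)
    have "t\<^sup>2 * poly (wedge P0 (vpderiv P0)) t =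
        poly (P0 $ 1) t * (t\<^sup>2 * poly (pderiv (P0 $ 2)) t) - poly (P0 $ 2) t * (t\<^sup>2 * poly (pderiv (P0 $ 1)) t)"
      unfolding wedge_def vpderiv_def by (simp add: algebra_simps)
    also have "\<dots> = - (t ^ (2 * a) * poly (wedge R0 (vpderiv R0)) (1 / t))"
      unfolding r[OF t] wedge_def vpderiv_def by (simp add: algebra_simps power_mult power2_eq_square)
    finally have w1: "t\<^sup>2 * poly (wedge P0 (vpderiv P0)) t = - (t ^ (2 * a) * poly (wedge R0 (vpderiv R0)) (1 / t))" .
    have "t\<^sup>2 * poly (wedge Q0 (vpderiv Q0)) t =
        poly (Q0 $ 1) t * (t\<^sup>2 * poly (pderiv (Q0 $ 2)) t) - poly (Q0 $ 2) t * (t\<^sup>2 * poly (pderiv (Q0 $ 1)) t)"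
      unfolding wedge_def vpderiv_def by (simp add: algebra_simps)
    also have "\<dots> = - (t ^ (2 * c) * poly (wedge S0 (vpderiv S0)) (1 / t))"
      unfolding r[OF t] wedge_def vpderiv_def by (simp add: algebra_simps power_mult power2_eq_square)
    finally have w3: "t\<^sup>2 * poly (wedge Q0 (vpderiv Q0)) t = - (t ^ (2 * c) * poly (wedge S0 (vpderiv S0)) (1 / t))" .
    have "poly (monom 1 2 * jacobian P0 P2 Q0 Q2) t =
       (t\<^sup>2 * poly (wedge P0 (vpderiv P0)) t) * poly (wedge Q0 Q2) t -
        poly (wedge P0 P2) t * (t\<^sup>2 * poly (wedge Q0 (vpderiv Q0)) t)"
      unfolding jacobian_def by (simp add: poly_monom algebra_simps)
    also have "\<dots> = t ^ (2 * a + 2 * c) * poly (- jacobian R0 R2 S0 S2) (1 / t)"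
      unfolding w1 w2 w3 jacobian_def by (simp add: power_add algebra_simps)
    finally show ?thesis .
  qed
  note rev = poly_reversal[OF this]
  have c: "coeff (monom 1 2 * jacobian P0 P2 Q0 Q2) (2 * a + 2 * c) \<noteq> 0" using rev(2) nz by simp
  then have "degree (monom 1 2 * jacobian P0 P2 Q0 Q2) = 2 * a + 2 * c"
    using rev(1) le_degree[OF c] by simp
  moreover have "jacobian P0 P2 Q0 Q2 \<noteq> 0" using c by auto
  ultimately show ?thesis by (simp add: degree_mult_eq monom_eq_0_iff degree_monom_eq)
qed


section \<open>Common factors and the reduced map on a line\<close>

lemma degree_of_reduced:
  fixes P :: "complex poly^'m"
  assumes "\<phi> \<noteq> 0" "\<And>i. P $ i = \<phi> * R i" "\<And>i. degree (P $ i) \<le> a" "coeff (P $ k) a \<noteq> 0"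
  shows "degree \<phi> \<le> a" "degree (R i) \<le> a - degree \<phi>"
    "coeff (P $ i) a = lead_coeff \<phi> * coeff (R i) (a - degree \<phi>)"
proof -
  have d: "degree (P $ i) = degree \<phi> + degree (R i)" if "R i \<noteq> 0" for i
    using that assms(1,2) by (simp add: degree_mult_eq)
  have "R k \<noteq> 0" using assms(2,4) by (metis coeff_0 mult_zero_right)
  then show le: "degree \<phi> \<le> a" using d[of k] assms(3)[of k] by simp
  show dR: "degree (R i) \<le> a - degree \<phi>" for i
    using d[of i] assms(3)[of i] by (cases "R i = 0") auto
  have "coeff (\<phi> * R i) (degree \<phi> + (a - degree \<phi>)) = lead_coeff \<phi> * coeff (R i) (a - degree \<phi>)"
  proof (cases "degree (R i) = a - degree \<phi>")
    case True then show ?thesis using coeff_mult_degree_sum[of \<phi> "R i"] by simp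
  next
    case False
    then have "degree (R i) < a - degree \<phi>" using dR[of i] by simp
    moreover from this have "degree (\<phi> * R i) < degree \<phi> + (a - degree \<phi>)"
      using degree_mult_le[of \<phi> "R i"] by simp
    ultimately show ?thesis by (simp add: coeff_eq_0)
  qed
  then show "coeff (P $ i) a = lead_coeff \<phi> * coeff (R i) (a - degree \<phi>)"
    using assms(2) le by simp
qed

text \<open>Pulled out of the representation, a common factor \<open>\<phi>\<close> leaves a representation \<open>R\<close> of degree \<open>a - degree \<phi>\<close> on the
  line; its coefficients in that degree give the value at the point \<open>p\<close> at infinity.\<close>

lemma reduced_line:
  fixes f :: "2 proj \<times> 'b::finite proj \<Rightarrow> 2 proj"
  assumes reg: "preg f" and rep: "prep f a b A"
    and ind: "p \<noteq> 0" "\<And>k. q \<noteq> k *s p" "y1 \<noteq> 0" "\<And>k. y0 \<noteq> k *s y1"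
    and jets: "line_jet A q p y0 y1 P0 P2"
    and nz: "A p y0 \<noteq> 0"
    and red: "\<phi> \<noteq> 0" "\<And>i. P0 $ i = \<phi> * R i" "\<And>t. \<exists>i. poly (R i) t \<noteq> 0"
  shows "f (abs_proj (q + t *s p), abs_proj y0) = abs_proj (\<chi> i. poly (R i) t)"
    "degree \<phi> \<le> a" "degree (R i) \<le> a - degree \<phi>"
    "f (abs_proj p, abs_proj y0) = abs_proj (\<chi> i. coeff (R i) (a - degree \<phi>))"
    "(\<chi> i. coeff (R i) (a - degree \<phi>)) \<noteq> 0"
proof -
  have nzx: "q + t *s p \<noteq> 0" for t using independent_line ind(1,2) by blast
  have nzy: "y0 + s *s y1 \<noteq> 0" for s using independent_line ind(3,4) by blast
  have y0: "y0 \<noteq> 0" using nzy[of 0] by simp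
  obtain R0 R2 where R: "line_jet A p q y0 y1 R0 R2" using line_jet_exists[OF rep] .
  have rev: "degree (P0 $ i) \<le> a" "coeff (P0 $ i) a = A p y0 $ i" for i
    using poly_reversal[OF line_jet_reversal(1)[OF rep jets R]] line_jet_slice(2)[OF R, of 0 i]
    by simp_all
  obtain k where k: "A p y0 $ k \<noteq> 0" using nz by (metis vec_eq_iff zero_index)
  note deg = degree_of_reduced[OF red(1,2) rev(1) k[folded rev(2)]]
  show "degree \<phi> \<le> a" "degree (R i) \<le> a - degree \<phi>" by (rule deg)+
  have lead: "A p y0 = lead_coeff \<phi> *s (\<chi> i. coeff (R i) (a - degree \<phi>))"
    using deg(3) rev(2) by (simp add: vec_eq_iff)
  then show nz': "(\<chi> i. coeff (R i) (a - degree \<phi>)) \<noteq> 0" using nz by (metis vector_smult_rzero)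
  have "f (abs_proj p, abs_proj y0) = abs_proj (A p y0)"
    using prep_value[OF rep _ _ nz] ind y0 by blast
  then show "f (abs_proj p, abs_proj y0) = abs_proj (\<chi> i. coeff (R i) (a - degree \<phi>))"
    using abs_proj_scale[OF _ nz', of "lead_coeff \<phi>"] red(1) unfolding lead by simp
  obtain c d E where E: "prep f c d E" "E (q + t *s p) y0 \<noteq> 0"
    using reg nzx y0 unfolding preg_def by blast
  obtain E0 E2 where E0: "line_jet E q p y0 y1 E0 E2" using line_jet_exists[OF E(1)] .
  have "\<phi> * (R 1 * E0 $ 2 - R 2 * E0 $ 1) = 0"
    using line_jet_wedge(1)[OF rep E(1) nzx nzy jets E0] unfolding wedge_def red(2)
    by (simp add: algebra_simps)
  then have "R 1 * E0 $ 2 - R 2 * E0 $ 1 = 0" using red(1) by simp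
  then have "poly (R 1 * E0 $ 2 - R 2 * E0 $ 1) t = 0" by simp
  then have "wedge (E (q + t *s p) y0) (\<chi> i. poly (R i) t) = 0"
    using line_jet_slice(2)[OF E0] by (simp add: wedge_def algebra_simps)
  moreover have "(\<chi> i. poly (R i) t) \<noteq> 0" using red(3)[of t] by (auto simp: vec_eq_iff)
  ultimately have "abs_proj (E (q + t *s p) y0) = abs_proj (\<chi> i. poly (R i) t)"
    using E(2) abs_proj_eqI_cross unfolding wedge_cross by blast
  then show "f (abs_proj (q + t *s p), abs_proj y0) = abs_proj (\<chi> i. poly (R i) t)"
    using prep_value[OF E(1) nzx y0 E(2)] by simp
qed

lemma vec2_decompose: "(x :: complex^2) = x $ 2 *s axis 2 1 + x $ 1 *s axis 1 1"
  by (simp add: vec_eq_iff forall_2 axis_def)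

lemma reduced_line_degree0:
  fixes f :: "2 proj \<times> 'b::finite proj \<Rightarrow> 2 proj"
  assumes val: "\<And>t. f (abs_proj (axis 2 1 + t *s axis 1 1), y) = abs_proj (\<chi> i. poly (R i) t)"
    and deg: "\<And>i. degree (R i) \<le> 0"
    and inf: "f (abs_proj (axis 1 1), y) = abs_proj (\<chi> i. coeff (R i) 0)"
  shows "\<exists>v. \<forall>x. f (x, y) = v"
proof (intro exI allI)
  fix x
  obtain v :: "complex^2" where v: "v \<noteq> 0" "x = abs_proj v" by (rule proj_cases)
  have c: "poly (R i) t = coeff (R i) 0" for i t
    using deg[of i] by (metis degree_eq_zeroE le_zero_eq coeff_pCons_0 poly_0 poly_pCons mult_zero_right add.right_neutral)
  show "f (x, y) = abs_proj (\<chi> i. coeff (R i) 0)"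
  proof (cases "v $ 2 = 0")
    case True
    then have "v = v $ 1 *s axis 1 1" "v $ 1 \<noteq> 0" using vec2_decompose[of v] v(1) by auto
    then show ?thesis using inf abs_proj_scale[of "v $ 1" "axis 1 1"] v by (metis axis_eq_0_iff one_neq_zero)
  next
    case False
    have ne: "axis 2 1 + (v $ 1 / v $ 2) *s axis 1 1 \<noteq> (0 :: complex^2)" by (simp add: vec_eq_iff axis_def forall_2)
    have "v = v $ 2 *s (axis 2 1 + (v $ 1 / v $ 2) *s axis 1 1)"
      using False by (simp add: vec_eq_iff axis_def forall_2)
    then have "x = abs_proj (axis 2 1 + (v $ 1 / v $ 2) *s axis 1 1)"
      using abs_proj_scale[OF False ne] v(2) by metis
    then show ?thesis using val c by simp
  qed
qed

lemma reduced_line_degree1: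
  fixes f :: "2 proj \<times> 'b::finite proj \<Rightarrow> 2 proj"
  assumes val: "\<And>t. f (abs_proj (axis 2 1 + t *s axis 1 1), y) = abs_proj (\<chi> i. poly (R i) t)"
    and red: "\<And>t. \<exists>i. poly (R i) t \<noteq> 0" and deg: "\<And>i. degree (R i) \<le> 1"
    and inf: "f (abs_proj (axis 1 1), y) = abs_proj (\<chi> i. coeff (R i) 1)" "(\<chi> i. coeff (R i) 1) \<noteq> 0"
  shows "\<exists>m :: complex^2^2. \<forall>x. x \<noteq> 0 \<longrightarrow> m *v x \<noteq> 0 \<and> f (abs_proj x, y) = abs_proj (m *v x)"
proof (intro exI allI impI)
  \<comment> \<open>The first column belongs to \<open>axis 1 1\<close>, the point at infinity of
    the line, where the value consists of the coefficients in degree 1.\<close>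
  define m :: "complex^2^2" where "m = (\<chi> i j. if j = 1 then coeff (R i) 1 else coeff (R i) 0)"
  fix v :: "complex^2"
  assume v: "v \<noteq> 0"
  have R: "poly (R i) t = coeff (R i) 0 + t * coeff (R i) 1" for i t
  proof -
    have "R i = [:coeff (R i) 0, coeff (R i) 1:]"
    proof (rule poly_eqI)
      fix n show "coeff (R i) n = coeff [:coeff (R i) 0, coeff (R i) 1:] n"
        using deg[of i] coeff_eq_0[of "R i" n] by (auto simp: coeff_pCons split: nat.split)
    qed
    then have "poly (R i) t = poly [:coeff (R i) 0, coeff (R i) 1:] t" by simp
    then show ?thesis by simp
  qed
  have m: "m *v v = v $ 2 *s (\<chi> i. coeff (R i) 0) + v $ 1 *s (\<chi> i. coeff (R i) 1)" for v
    by (simp add: m_def matrix_vector_mult_def vec_eq_iff sum_2 algebra_simps)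
  show "m *v v \<noteq> 0 \<and> f (abs_proj v, y) = abs_proj (m *v v)"
  proof (cases "v $ 2 = 0")
    case True
    then have e: "v = v $ 1 *s axis 1 1" and n1: "v $ 1 \<noteq> 0" using vec2_decompose[of v] v by auto
    have "f (abs_proj v, y) = abs_proj (\<chi> i. coeff (R i) 1)"
      using inf(1) abs_proj_scale[OF n1, of "axis 1 1"] e by (metis axis_eq_0_iff one_neq_zero)
    then show ?thesis using abs_proj_scale[OF n1 inf(2)] inf(2) n1 True m[of v] by (simp add: scale_vec_zero_iff)
  next
    case False
    let ?t = "v $ 1 / v $ 2"
    have ne: "axis 2 1 + ?t *s axis 1 1 \<noteq> (0 :: complex^2)" by (simp add: vec_eq_iff axis_def forall_2)
    have "v = v $ 2 *s (axis 2 1 + ?t *s axis 1 1)"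
      using False by (simp add: vec_eq_iff axis_def forall_2)
    then have e: "abs_proj v = abs_proj (axis 2 1 + ?t *s axis 1 1)"
      using abs_proj_scale[OF False ne] by metis
    have n: "(\<chi> i. poly (R i) ?t) \<noteq> 0" using red[of ?t] by (auto simp: vec_eq_iff)
    have "m *v v = v $ 2 *s (\<chi> i. poly (R i) ?t)"
      unfolding m R using False by (simp add: vec_eq_iff field_simps)
    then show ?thesis using e val abs_proj_scale[OF False n] n False by (simp add: scale_vec_zero_iff)
  qed
qed

lemma exists_independent:
  assumes "y0 \<noteq> 0"
  obtains y1 :: "complex^2" where "y1 \<noteq> 0" "\<And>k. y0 \<noteq> k *s y1"
proof (cases "y0 $ 1 = 0")
  case True
  show ?thesis
  proof (rule that[of "axis 1 1"])
    fix k
    show "y0 \<noteq> k *s axis 1 1" using True assms by (auto simp: vec_eq_iff axis_def forall_2)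
  qed simp
next
  case False
  show ?thesis
    by (rule that[of "axis 2 1"]) (use False in \<open>auto simp: vec_eq_iff axis_def forall_2\<close>)
qed

text \<open>The degrees of the two components, after removal of their common factors, add up to 1.
  So one component is a Moebius map of the line and the other is constant on it.\<close>

lemma horizontal_line:
  fixes \<alpha> :: "2 proj \<times> 2 proj \<Rightarrow> 2 proj \<times> 2 proj"
  assumes reg: "preg (fst \<circ> \<alpha>)" "preg (snd \<circ> \<alpha>)"
    and inv: "preg (fst \<circ> \<beta>)" "preg (snd \<circ> \<beta>)" "\<And>p. \<beta> (\<alpha> p) = p"
  shows "(\<exists>m :: complex^2^2. \<forall>x. x \<noteq> 0 \<longrightarrow> m *v x \<noteq> 0 \<and> fst (\<alpha> (abs_proj x, y)) = abs_proj (m *v x)) \<and>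
         (\<exists>v. \<forall>x. snd (\<alpha> (x, y)) = v) \<or>
       (\<exists>m :: complex^2^2. \<forall>x. x \<noteq> 0 \<longrightarrow> m *v x \<noteq> 0 \<and> snd (\<alpha> (abs_proj x, y)) = abs_proj (m *v x)) \<and>
         (\<exists>v. \<forall>x. fst (\<alpha> (x, y)) = v)"
proof -
  define p q :: "complex^2" where "p = axis 1 1" and "q = axis 2 1"
  have pq: "p \<noteq> 0" "q \<noteq> 0" "q \<noteq> k *s p" "p \<noteq> k *s q" for k
    by (auto simp: p_def q_def vec_eq_iff axis_def forall_2)
  obtain y0 where y0: "y0 \<noteq> 0" "y = abs_proj y0" by (rule proj_cases)
  obtain y1 where y1: "y1 \<noteq> 0" "\<And>k. y0 \<noteq> k *s y1" using exists_independent y0(1) by blast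
  have nzx: "q + t *s p \<noteq> 0" for t using independent_line pq by blast
  have nzy: "y0 + s *s y1 \<noteq> 0" for s using independent_line y1 by blast
  \<comment> \<open>The representations are taken nonzero at \<open>p\<close>, the point at infinity
    of the line \<open>q + t *s p\<close>. The Jacobian in the chart at infinity is then nonzero at
    0, which fixes its degree.\<close>
  obtain a b A where A: "prep (fst \<circ> \<alpha>) a b A" "A p y0 \<noteq> 0"
    using reg(1) pq y0 unfolding preg_def by blast
  obtain c d B where B: "prep (snd \<circ> \<alpha>) c d B" "B p y0 \<noteq> 0"
    using reg(2) pq y0 unfolding preg_def by blast
  obtain P0 P2 where P: "line_jet A q p y0 y1 P0 P2" using line_jet_exists[OF A(1)] .
  obtain Q0 Q2 where Q: "line_jet B q p y0 y1 Q0 Q2" using line_jet_exists[OF B(1)] .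
  obtain R0 R2 where R: "line_jet A p q y0 y1 R0 R2" using line_jet_exists[OF A(1)] .
  obtain S0 S2 where S: "line_jet B p q y0 y1 S0 S2" using line_jet_exists[OF B(1)] .
  have "poly (jacobian R0 R2 S0 S2) 0 \<noteq> 0"
    by (rule jacobian_nonzero[OF inv A(1) B(1) pq(2) pq(4) y1 R S]) (use A B in simp_all)
  then have dN: "degree (jacobian P0 P2 Q0 Q2) + 2 = 2 * a + 2 * c"
    by (rule jacobian_degree[OF A(1) B(1) P Q R S])
  have rev: "coeff (P0 $ i) a = A p y0 $ i" "coeff (Q0 $ i) c = B p y0 $ i" for i
    using poly_reversal(2)[OF line_jet_reversal(1)[OF A(1) P R]] line_jet_slice(2)[OF R, of 0 i]
      poly_reversal(2)[OF line_jet_reversal(1)[OF B(1) Q S]] line_jet_slice(2)[OF S, of 0 i]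
    by simp_all
  obtain k where "A p y0 $ k \<noteq> 0" using A(2) by (metis vec_eq_iff zero_index)
  then have "P0 $ k \<noteq> 0" using rev(1)[of k] by auto
  then obtain \<phi> A' where \<phi>: "\<phi> \<noteq> 0" "\<And>i. P0 $ i = \<phi> * A' i" "\<And>t. \<exists>i. poly (A' i) t \<noteq> 0"
    using remove_common_factor[of "\<lambda>i. P0 $ i"] by blast
  obtain k where "B p y0 $ k \<noteq> 0" using B(2) by (metis vec_eq_iff zero_index)
  then have "Q0 $ k \<noteq> 0" using rev(2)[of k] by auto
  then obtain \<psi> B' where \<psi>: "\<psi> \<noteq> 0" "\<And>i. Q0 $ i = \<psi> * B' i" "\<And>t. \<exists>i. poly (B' i) t \<noteq> 0"
    using remove_common_factor[of "\<lambda>i. Q0 $ i"] by blast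
  note lA = reduced_line[OF reg(1) A(1) pq(1,3) y1 P A(2) \<phi>]
  note lB = reduced_line[OF reg(2) B(1) pq(1,3) y1 Q B(2) \<psi>]
  \<comment> \<open>Near each \<open>t\<close> the pair \<open>A, B\<close> is compared with a pair
    \<open>E, F\<close> that is nonzero there and so has nonvanishing Jacobian. The change of
    representation multiplies the Jacobian by squares of ratios of coordinates, that is by
    \<open>(\<phi> * \<psi>)\<^sup>2\<close> up to factors without zero at \<open>t\<close>.\<close>
  have "degree (jacobian P0 P2 Q0 Q2) = degree ((\<phi> * \<psi>)\<^sup>2)"
  proof (rule degree_eq_of_local_equiv(2))
    show "(\<phi> * \<psi>)\<^sup>2 \<noteq> 0" using \<phi> \<psi> by simp
    fix t
    obtain a' b' E where E: "prep (fst \<circ> \<alpha>) a' b' E" "E (q + t *s p) y0 \<noteq> 0"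
      using reg(1) nzx y0 unfolding preg_def by blast
    obtain c' d' F where F: "prep (snd \<circ> \<alpha>) c' d' F" "F (q + t *s p) y0 \<noteq> 0"
      using reg(2) nzx y0 unfolding preg_def by blast
    obtain E0 E2 where E0: "line_jet E q p y0 y1 E0 E2" using line_jet_exists[OF E(1)] .
    obtain F0 F2 where F0: "line_jet F q p y0 y1 F0 F2" using line_jet_exists[OF F(1)] .
    obtain i where i: "poly (E0 $ i) t \<noteq> 0"
      using E(2) line_jet_slice(2)[OF E0] by (metis vec_eq_iff zero_index)
    obtain j where j: "poly (F0 $ j) t \<noteq> 0"
      using F(2) line_jet_slice(2)[OF F0] by (metis vec_eq_iff zero_index)
    have wA: "wedge P0 E0 = 0" "wedge (vpderiv P0) E0 + wedge P0 (vpderiv E0) = 0" "wedge P2 E0 + wedge P0 E2 = 0"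
      by (rule line_jet_wedge[OF A(1) E(1) nzx nzy P E0])+
    have wB: "wedge Q0 F0 = 0" "wedge (vpderiv Q0) F0 + wedge Q0 (vpderiv F0) = 0" "wedge Q2 F0 + wedge Q0 F2 = 0"
      by (rule line_jet_wedge[OF B(1) F(1) nzx nzy Q F0])+
    note rel = wedge_derivative_ratio[OF wA(1,2), of i] wedge_derivative_ratio[OF wA(1,3), of i]
       wedge_derivative_ratio[OF wB(1,2), of j] wedge_derivative_ratio[OF wB(1,3), of j]
    let ?N = "jacobian E0 E2 F0 F2"
    have "jacobian P0 P2 Q0 Q2 * ((E0 $ i)\<^sup>2 * (F0 $ j)\<^sup>2) =
      ((E0 $ i)\<^sup>2 * wedge P0 (vpderiv P0)) * ((F0 $ j)\<^sup>2 * wedge Q0 Q2) -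
      ((E0 $ i)\<^sup>2 * wedge P0 P2) * ((F0 $ j)\<^sup>2 * wedge Q0 (vpderiv Q0))"
      unfolding jacobian_def by (simp add: algebra_simps)
    also have "\<dots> = (\<phi> * \<psi>)\<^sup>2 * ((A' i)\<^sup>2 * (B' j)\<^sup>2 * ?N)"
      unfolding rel \<phi>(2) \<psi>(2) jacobian_def by (simp add: algebra_simps power_mult_distrib)
    finally have eq: "jacobian P0 P2 Q0 Q2 * ((E0 $ i)\<^sup>2 * (F0 $ j)\<^sup>2) =
        (\<phi> * \<psi>)\<^sup>2 * ((A' i)\<^sup>2 * (B' j)\<^sup>2 * ?N)" .
    have "poly ?N t \<noteq> 0"
      by (rule jacobian_nonzero[OF inv E(1) F(1) pq(1) pq(3) y1 E0 F0 E(2) F(2)])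
    moreover have "poly (A' i) t \<noteq> 0"
    proof
      assume z: "poly (A' i) t = 0"
      have "\<phi> * (A' i * E0 $ k) = \<phi> * (A' k * E0 $ i)" for k
        using wA(1) unfolding wedge_cross \<phi>(2) by (metis mult.assoc)
      then have "A' i * E0 $ k = A' k * E0 $ i" for k using \<phi>(1) by simp
      then have "poly (A' i) t * poly (E0 $ k) t = poly (A' k) t * poly (E0 $ i) t" for k by (metis poly_mult)
      then show False using z i \<phi>(3) by auto
    qed
    moreover have "poly (B' j) t \<noteq> 0"
    proof
      assume z: "poly (B' j) t = 0"
      have "\<psi> * (B' j * F0 $ k) = \<psi> * (B' k * F0 $ j)" for k
        using wB(1) unfolding wedge_cross \<psi>(2) by (metis mult.assoc)
      then have "B' j * F0 $ k = B' k * F0 $ j" for k using \<psi>(1) by simp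
      then have "poly (B' j) t * poly (F0 $ k) t = poly (B' k) t * poly (F0 $ j) t" for k by (metis poly_mult)
      then show False using z j \<psi>(3) by auto
    qed
    ultimately show "\<exists>u v. poly u t \<noteq> 0 \<and> poly v t \<noteq> 0 \<and> jacobian P0 P2 Q0 Q2 * u = (\<phi> * \<psi>)\<^sup>2 * v"
      using i j eq by (intro exI[of _ "(E0 $ i)\<^sup>2 * (F0 $ j)\<^sup>2"] exI[of _ "(A' i)\<^sup>2 * (B' j)\<^sup>2 * ?N"]) simp
  qed
  then have "degree (jacobian P0 P2 Q0 Q2) = 2 * degree \<phi> + 2 * degree \<psi>"
    using \<phi>(1) \<psi>(1) by (simp add: power2_eq_square degree_mult_eq)
  then have "(a - degree \<phi>) + (c - degree \<psi>) = 1" using dN lA(2) lB(2) by linarith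
  then consider "a - degree \<phi> = 1" "c - degree \<psi> = 0" | "a - degree \<phi> = 0" "c - degree \<psi> = 1" by linarith
  then show ?thesis
  proof cases
    case 1
    have "\<exists>m :: complex^2^2. \<forall>x. x \<noteq> 0 \<longrightarrow> m *v x \<noteq> 0 \<and> (fst \<circ> \<alpha>) (abs_proj x, y) = abs_proj (m *v x)"
      by (rule reduced_line_degree1[of _ _ A']) (use lA[unfolded 1 p_def q_def] \<phi>(3) y0(2) in simp_all)
    moreover have "\<exists>v. \<forall>x. (snd \<circ> \<alpha>) (x, y) = v"
      by (rule reduced_line_degree0[of _ _ B']) (use lB[unfolded 1 p_def q_def] y0(2) in simp_all)
    ultimately show ?thesis by simp
  next
    case 2
    have "\<exists>m :: complex^2^2. \<forall>x. x \<noteq> 0 \<longrightarrow> m *v x \<noteq> 0 \<and> (snd \<circ> \<alpha>) (abs_proj x, y) = abs_proj (m *v x)"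
      by (rule reduced_line_degree1[of _ _ B']) (use lB[unfolded 2 p_def q_def] \<psi>(3) y0(2) in simp_all)
    moreover have "\<exists>v. \<forall>x. (fst \<circ> \<alpha>) (x, y) = v"
      by (rule reduced_line_degree0[of _ _ A']) (use lA[unfolded 2 p_def q_def] y0(2) in simp_all)
    ultimately show ?thesis by simp
  qed
qed

section \<open>From single lines to the whole product\<close>

lemma nonsingular_inverse:
  fixes m :: "complex^'n^'n"
  assumes "\<And>x. x \<noteq> 0 \<Longrightarrow> m *v x \<noteq> 0"
  obtains m' where "m' ** m = mat 1" "m ** m' = mat 1" "\<And>x. m' *v (m *v x) = x" "\<And>x. m *v (m' *v x) = x"
proof -
  have "\<exists>B. B ** m = mat 1" using assms matrix_left_invertible_ker by blast
  then obtain m' where m': "m' ** m = mat 1" by blast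
  then have "m ** m' = mat 1" using matrix_left_right_inverse by blast
  then show ?thesis using that m' by (metis matrix_vector_mul_assoc matrix_vector_mul_lid)
qed

lemma nonsingular_proj_surj:
  fixes m :: "complex^'n^'n"
  assumes "\<And>x. x \<noteq> 0 \<Longrightarrow> m *v x \<noteq> 0"
  obtains x where "x \<noteq> 0" "p = abs_proj (m *v x)"
proof -
  obtain m' where m': "\<And>x. m *v (m' *v x) = x" using nonsingular_inverse assms by metis
  obtain v where v: "v \<noteq> 0" "p = abs_proj v" by (rule proj_cases)
  then show ?thesis using that[of "m' *v v"] m'[of v] by (cases "m' *v v = 0") auto
qed

lemma two_proj_points: obtains x x' :: "2 proj" where "x \<noteq> x'"
proof -
  have "abs_proj (axis 1 1 :: complex^2) \<noteq> abs_proj (axis 2 1)"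
    by (subst abs_proj_eq_iff) (auto simp: vec_eq_iff axis_def forall_2)
  then show ?thesis using that by blast
qed

text \<open>Each line of a ruling goes onto a line of one of the two rulings. Injectivity makes the
  choice uniform over the ruling, and surjectivity ties the choices for the two rulings
  together.\<close>

lemma aut_product_of_lines:
  fixes \<alpha> \<beta> :: "2 proj \<times> 2 proj \<Rightarrow> 2 proj \<times> 2 proj"
  assumes reg: "preg (fst \<circ> \<alpha>)" "preg (snd \<circ> \<alpha>)" "preg (fst \<circ> \<beta>)" "preg (snd \<circ> \<beta>)"
    and inv: "\<And>p. \<beta> (\<alpha> p) = p" "\<And>p. \<alpha> (\<beta> p) = p"
  obtains m n :: "complex^2^2" where "\<And>x. x \<noteq> 0 \<Longrightarrow> m *v x \<noteq> 0" "\<And>x. x \<noteq> 0 \<Longrightarrow> n *v x \<noteq> 0"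
    "(\<forall>x y. x \<noteq> 0 \<and> y \<noteq> 0 \<longrightarrow> \<alpha> (abs_proj x, abs_proj y) = (abs_proj (m *v x), abs_proj (n *v y))) \<or>
     (\<forall>x y. x \<noteq> 0 \<and> y \<noteq> 0 \<longrightarrow> \<alpha> (abs_proj x, abs_proj y) = (abs_proj (n *v y), abs_proj (m *v x)))"
proof -
  have inj: "\<alpha> a = \<alpha> b \<Longrightarrow> a = b" for a b using inv(1) by metis
  define H1 where "H1 y \<longleftrightarrow>
     (\<exists>m :: complex^2^2. \<forall>x. x \<noteq> 0 \<longrightarrow> m *v x \<noteq> 0 \<and> fst (\<alpha> (abs_proj x, y)) = abs_proj (m *v x)) \<and>
         (\<exists>v. \<forall>x. snd (\<alpha> (x, y)) = v)" for y
  define H2 where "H2 y \<longleftrightarrow>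
     (\<exists>m :: complex^2^2. \<forall>x. x \<noteq> 0 \<longrightarrow> m *v x \<noteq> 0 \<and> snd (\<alpha> (abs_proj x, y)) = abs_proj (m *v x)) \<and>
         (\<exists>v. \<forall>x. fst (\<alpha> (x, y)) = v)" for y
  define V1 where "V1 x \<longleftrightarrow>
     (\<exists>m :: complex^2^2. \<forall>y. y \<noteq> 0 \<longrightarrow> m *v y \<noteq> 0 \<and> snd (\<alpha> (x, abs_proj y)) = abs_proj (m *v y)) \<and>
         (\<exists>v. \<forall>y. fst (\<alpha> (x, y)) = v)" for x
  define V2 where "V2 x \<longleftrightarrow>
     (\<exists>m :: complex^2^2. \<forall>y. y \<noteq> 0 \<longrightarrow> m *v y \<noteq> 0 \<and> fst (\<alpha> (x, abs_proj y)) = abs_proj (m *v y)) \<and>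
         (\<exists>v. \<forall>y. snd (\<alpha> (x, y)) = v)" for x
  have H: "H1 y \<or> H2 y" for y
    using horizontal_line[OF reg inv(1), of y] unfolding H1_def H2_def by blast
  have V: "V1 x \<or> V2 x" for x
  proof -
    have "preg (fst \<circ> (\<alpha> \<circ> prod.swap))" "preg (snd \<circ> (\<alpha> \<circ> prod.swap))"
      using preg_swap[OF reg(1)] preg_swap[OF reg(2)] by (simp_all add: comp_assoc)
    moreover have "fst \<circ> (prod.swap \<circ> \<beta>) = snd \<circ> \<beta>" "snd \<circ> (prod.swap \<circ> \<beta>) = fst \<circ> \<beta>"
      by (auto simp: fun_eq_iff)
    moreover have "(prod.swap \<circ> \<beta>) ((\<alpha> \<circ> prod.swap) p) = p" for p using inv(1) by simp
    ultimately have "(\<exists>m :: complex^2^2. \<forall>y. y \<noteq> 0 \<longrightarrow> m *v y \<noteq> 0 \<and>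
          fst ((\<alpha> \<circ> prod.swap) (abs_proj y, x)) = abs_proj (m *v y)) \<and>
        (\<exists>v. \<forall>y. snd ((\<alpha> \<circ> prod.swap) (y, x)) = v) \<or>
      (\<exists>m :: complex^2^2. \<forall>y. y \<noteq> 0 \<longrightarrow> m *v y \<noteq> 0 \<and>
          snd ((\<alpha> \<circ> prod.swap) (abs_proj y, x)) = abs_proj (m *v y)) \<and>
        (\<exists>v. \<forall>y. fst ((\<alpha> \<circ> prod.swap) (y, x)) = v)"
      using horizontal_line[of "\<alpha> \<circ> prod.swap" "prod.swap \<circ> \<beta>" x] reg by simp
    then show ?thesis unfolding V1_def V2_def by auto
  qed
  obtain a a' :: "2 proj" where aa: "a \<noteq> a'" by (rule two_proj_points)
  \<comment> \<open>Lines of different rulings meet, so two disjoint horizontal lines with images in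
    different rulings would contradict injectivity.\<close>
  have mixed: False if h: "H1 y0" "H2 y1" for y0 y1
  proof -
    obtain m v where 1: "\<And>x. x \<noteq> 0 \<Longrightarrow> m *v x \<noteq> 0 \<and> fst (\<alpha> (abs_proj x, y0)) = abs_proj (m *v x)"
      "\<And>x. snd (\<alpha> (x, y0)) = v" using h(1) unfolding H1_def by blast
    obtain n w where 2: "\<And>x. x \<noteq> 0 \<Longrightarrow> n *v x \<noteq> 0 \<and> snd (\<alpha> (abs_proj x, y1)) = abs_proj (n *v x)"
      "\<And>x. fst (\<alpha> (x, y1)) = w" using h(2) unfolding H2_def by blast
    show False
    proof (cases "y0 = y1")
      case True
      then have "\<alpha> (a, y0) = \<alpha> (a', y0)" using 1(2) 2(2) by (simp add: prod_eq_iff)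
      then show False using inj aa by blast
    next
      case False
      obtain x where x: "x \<noteq> 0" "w = abs_proj (m *v x)" using nonsingular_proj_surj 1(1) by metis
      obtain x' where x': "x' \<noteq> 0" "v = abs_proj (n *v x')" using nonsingular_proj_surj 2(1) by metis
      have "\<alpha> (abs_proj x, y0) = \<alpha> (abs_proj x', y1)"
        using 1 2 x x' by (simp add: prod_eq_iff)
      then show False using inj False by blast
    qed
  qed
  consider "\<And>y. H1 y" | "\<And>y. H2 y" using H mixed by metis
  then show ?thesis
  proof cases
    case 1
    then have s: "snd (\<alpha> (x, y)) = snd (\<alpha> (x', y))" for x x' y unfolding H1_def by metis
    \<comment> \<open>Otherwise the second coordinate would be constant along the horizontal lines
      and along one vertical line, hence everywhere, against surjectivity.\<close>
    have V1: "V1 x" for x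
    proof (rule ccontr)
      assume "\<not> V1 x"
      then obtain v where "\<And>y. snd (\<alpha> (x, y)) = v" using V unfolding V2_def by blast
      then have "snd (\<alpha> p) = v" for p using s by (metis prod.collapse)
      from this[of "\<beta> (a, a)"] this[of "\<beta> (a, a')"] show False using inv(2) aa by simp
    qed
    then have f: "fst (\<alpha> (x, y)) = fst (\<alpha> (x, y'))" for x y y' unfolding V1_def by metis
    obtain m where m: "\<And>x. x \<noteq> 0 \<Longrightarrow> m *v x \<noteq> 0 \<and> fst (\<alpha> (abs_proj x, a)) = abs_proj (m *v x)"
      using 1[of a] unfolding H1_def by blast
    obtain n where n: "\<And>y. y \<noteq> 0 \<Longrightarrow> n *v y \<noteq> 0 \<and> snd (\<alpha> (a, abs_proj y)) = abs_proj (n *v y)"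
      using V1[of a] unfolding V1_def by blast
    show ?thesis
    proof (rule that[of m n])
      have "\<alpha> (abs_proj x, abs_proj y) = (abs_proj (m *v x), abs_proj (n *v y))" if "x \<noteq> 0" "y \<noteq> 0" for x y
        using m[OF that(1)] n[OF that(2)] f[of "abs_proj x" "abs_proj y" a] s[of "abs_proj x" "abs_proj y" a]
        by (simp add: prod_eq_iff)
      then show "(\<forall>x y. x \<noteq> 0 \<and> y \<noteq> 0 \<longrightarrow> \<alpha> (abs_proj x, abs_proj y) = (abs_proj (m *v x), abs_proj (n *v y))) \<or>
     (\<forall>x y. x \<noteq> 0 \<and> y \<noteq> 0 \<longrightarrow> \<alpha> (abs_proj x, abs_proj y) = (abs_proj (n *v y), abs_proj (m *v x)))" by blast
    qed (use m n in auto)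
  next
    case 2
    then have f: "fst (\<alpha> (x, y)) = fst (\<alpha> (x', y))" for x x' y unfolding H2_def by metis
    have V2: "V2 x" for x
    proof (rule ccontr)
      assume "\<not> V2 x"
      then obtain v where "\<And>y. fst (\<alpha> (x, y)) = v" using V unfolding V1_def by blast
      then have "fst (\<alpha> p) = v" for p using f by (metis prod.collapse)
      from this[of "\<beta> (a, a)"] this[of "\<beta> (a', a)"] show False using inv(2) aa by simp
    qed
    then have s: "snd (\<alpha> (x, y)) = snd (\<alpha> (x, y'))" for x y y' unfolding V2_def by metis
    obtain m where m: "\<And>x. x \<noteq> 0 \<Longrightarrow> m *v x \<noteq> 0 \<and> snd (\<alpha> (abs_proj x, a)) = abs_proj (m *v x)"
      using 2[of a] unfolding H2_def by blast
    obtain n where n: "\<And>y. y \<noteq> 0 \<Longrightarrow> n *v y \<noteq> 0 \<and> fst (\<alpha> (a, abs_proj y)) = abs_proj (n *v y)"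
      using V2[of a] unfolding V2_def by blast
    show ?thesis
    proof (rule that[of m n])
      have "\<alpha> (abs_proj x, abs_proj y) = (abs_proj (n *v y), abs_proj (m *v x))" if "x \<noteq> 0" "y \<noteq> 0" for x y
        using m[OF that(1)] n[OF that(2)] s[of "abs_proj x" "abs_proj y" a] f[of "abs_proj x" "abs_proj y" a]
        by (simp add: prod_eq_iff)
      then show "(\<forall>x y. x \<noteq> 0 \<and> y \<noteq> 0 \<longrightarrow> \<alpha> (abs_proj x, abs_proj y) = (abs_proj (m *v x), abs_proj (n *v y))) \<or>
     (\<forall>x y. x \<noteq> 0 \<and> y \<noteq> 0 \<longrightarrow> \<alpha> (abs_proj x, abs_proj y) = (abs_proj (n *v y), abs_proj (m *v x)))" by blast
    qed (use m n in auto)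
  qed
qed

section \<open>Automorphisms of projective space\<close>

text \<open>The matrix determinant lemma for \<open>I + v l^T\<close>. With \<open>T\<close> the
  identity whose column \<open>k\<close> is replaced by \<open>v\<close>, one has
  \<open>U ** T = T ** E\<close>, where \<open>E\<close> changes the identity only in row
  \<open>k\<close>; both \<open>T\<close> and \<open>E\<close> have determinants given by Cramer's
  rule.\<close>

lemma det_rank_one_update:
  fixes v l :: "complex^'n"
  shows "det (\<chi> i j. (if i = j then 1 else 0) + v $ i * l $ j) = 1 + (\<Sum>i\<in>UNIV. l $ i * v $ i)"
proof (cases "v = 0")
  case True
  then have "(\<chi> i j. (if i = j then 1 else 0) + v $ i * l $ j) = mat 1" by (simp add: mat_def vec_eq_iff)
  then show ?thesis using True by (simp only: det_I) simp
next
  case False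
  then obtain k where k: "v $ k \<noteq> 0" by (metis vec_eq_iff zero_index)
  define T :: "complex^'n^'n" where "T = (\<chi> i j. if j = k then v $ i else mat 1 $ i $ j)"
  have dT: "det T = v $ k"
    using cramer_lemma[of k "mat 1" v] unfolding T_def by (simp only: matrix_vector_mul_lid det_I mult_1_right)
  define r where "r = transpose T *v l"
  define U :: "complex^'n^'n" where "U = (\<chi> i j. (if i = j then 1 else 0) + v $ i * l $ j)"
  define E :: "complex^'n^'n" where "E = (\<chi> i j. (if i = j then 1 else 0) + (if i = k then r $ j else 0))"
  have "det (transpose E) = 1 + r $ k"
  proof -
    have "transpose E = (\<chi> i j. if j = k then (mat 1 *v (axis k 1 + r)) $ i else mat 1 $ i $ j)"
      unfolding matrix_vector_mul_lid E_def by (auto simp: vec_eq_iff transpose_def mat_def axis_def)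
    then have "det (transpose E) = (axis k 1 + r) $ k"
      using cramer_lemma[of k "mat 1" "axis k 1 + r"] by (simp only: det_I mult_1_right)
    then show ?thesis by (simp add: axis_def)
  qed
  then have dE: "det E = 1 + r $ k" by simp
  have Te: "T $ i $ k = v $ i" for i by (simp add: T_def)
  have "(U ** T) $ i $ j = (T ** E) $ i $ j" for i j
  proof -
    have "(U ** T) $ i $ j = (\<Sum>a\<in>UNIV. (if i = a then T $ a $ j else 0)) + (\<Sum>a\<in>UNIV. v $ i * l $ a * T $ a $ j)"
      by (simp add: U_def matrix_matrix_mult_def distrib_right sum.distrib if_distrib[of "\<lambda>x. x * _"] cong: if_cong)
    also have "(\<Sum>a\<in>UNIV. v $ i * l $ a * T $ a $ j) = v $ i * r $ j"
      by (simp add: r_def matrix_vector_mult_def transpose_def sum_distrib_left mult_ac)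
    finally have 1: "(U ** T) $ i $ j = T $ i $ j + v $ i * r $ j" by simp
    have "(T ** E) $ i $ j = (\<Sum>a\<in>UNIV. (if a = j then T $ i $ a else 0)) + (\<Sum>a\<in>UNIV. (if a = k then T $ i $ a * r $ j else 0))"
      by (simp add: E_def matrix_matrix_mult_def distrib_left sum.distrib if_distrib[of "\<lambda>x. _ * x"] cong: if_cong)
    then have "(T ** E) $ i $ j = T $ i $ j + v $ i * r $ j" by (simp add: Te)
    then show ?thesis using 1 by simp
  qed
  then have "U ** T = T ** E" by (simp add: vec_eq_iff)
  then have "det (U ** T) = det (T ** E)" by (simp only:)
  then have "v $ k * det U = v $ k * (1 + r $ k)" unfolding det_mul dT dE by (simp only: mult.commute)
  then have "det U = 1 + r $ k" using mult_left_cancel[OF k, of "det U" "1 + r $ k"] by blast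
  moreover have "r $ k = (\<Sum>i\<in>UNIV. l $ i * v $ i)"
    by (simp add: r_def matrix_vector_mult_def transpose_def Te mult.commute)
  ultimately show ?thesis unfolding U_def by simp
qed

lemma det_scale:
  fixes A :: "complex^'n^'n"
  shows "det (\<chi> i j. c * A $ i $ j) = c ^ CARD('n) * det A"
proof -
  have "(\<chi> i j. c * A $ i $ j) = (\<chi> i. c *s A $ i)" by (simp add: vec_eq_iff)
  then show ?thesis using det_rows_mul[of "\<lambda>_. c" "\<lambda>i. A $ i"] by (simp add: vec_lambda_eta)
qed

lemma det_polyring:
  assumes "\<And>i j. (\<lambda>v. A v $ i $ j) \<in> polyring G"
  shows "(\<lambda>v. det (A v :: complex^'n^'n)) \<in> polyring G"
  unfolding det_def by (intro polyring_intros assms)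

section \<open>Jacobian matrices of homogeneous polynomial maps\<close>

definition jacobi :: "(complex^'n \<Rightarrow> complex^'m) \<Rightarrow> (complex^'n \<Rightarrow> complex^'n^'m) \<Rightarrow> bool" where
  "jacobi F J \<longleftrightarrow> (\<forall>i j. (\<lambda>v. J v $ i $ j) \<in> polyring coords) \<and>
     (\<forall>v w i. ((\<lambda>u. F (v + u *s w) $ i) has_field_derivative (J v *v w) $ i) (at 0))"

lemma jacobi_exists:
  fixes F :: "complex^'n \<Rightarrow> complex^'m"
  assumes "\<And>i. (\<lambda>v. F v $ i) \<in> polyring coords"
  obtains J where "jacobi F J"
proof -
  define good where "good i c \<longleftrightarrow> (\<forall>j. c j \<in> polyring coords) \<and>
      (\<forall>v w. ((\<lambda>u. F (v + u *s w) $ i) has_field_derivative (\<Sum>j\<in>UNIV. c j v * w $ j)) (at 0))" for i c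
  have "\<exists>c. good i c" for i
  proof -
    let ?x = "\<lambda>j (v :: complex^'n). v $ j"
    have fin: "finite (coords :: (complex^'n \<Rightarrow> complex) set)" unfolding coords_def by simp
    have bl: "bounded_linear g" if "g \<in> coords" for g :: "complex^'n \<Rightarrow> complex"
      using that unfolding coords_def by (auto intro: bounded_linear_vec_nth)
    obtain c where c: "\<And>g. c g \<in> polyring coords"
      "\<And>v. ((\<lambda>v. F v $ i) has_derivative (\<lambda>w. \<Sum>g\<in>coords. c g v * g w)) (at v)"
      using polyring_has_derivative[OF assms fin bl] by blast
    have inj: "inj ?x"
    proof (rule injI)
      fix j k assume "?x j = ?x k"
      then have "axis j (1::complex) $ j = axis j 1 $ k" by metis
      then show "j = k" by (simp add: axis_def split: if_splits)
    qed
    have sum: "(\<Sum>g\<in>coords. c g v * g w) = (\<Sum>j\<in>UNIV. c (?x j) v * w $ j)" for v w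
      unfolding coords_def by (subst sum.reindex[OF inj]) simp
    have "((\<lambda>u. F (v + u *s w) $ i) has_field_derivative (\<Sum>j\<in>UNIV. c (?x j) v * w $ j)) (at 0)" for v w
    proof -
      have lin: "bounded_linear (\<lambda>u. u *s w)"
        unfolding linear_conv_bounded_linear[symmetric]
        by (rule linearI) (simp_all add: vec_eq_iff algebra_simps)
      have h1: "((\<lambda>u. v + u *s w) has_derivative (\<lambda>u. u *s w)) (at 0)"
        using has_derivative_add[OF has_derivative_const bounded_linear.has_derivative[OF lin has_derivative_ident]] by simp
      have h2: "((\<lambda>v. F v $ i) has_derivative (\<lambda>w. \<Sum>g\<in>coords. c g v * g w)) (at (v + 0 *s w))"
        using c(2)[of v] by simp
      have "((\<lambda>u. F (v + u *s w) $ i) has_derivative (\<lambda>u. \<Sum>g\<in>coords. c g v * g (u *s w))) (at 0)"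
        using has_derivative_compose[OF h1 h2] by simp
      then show ?thesis unfolding has_field_derivative_def sum
        by (rule has_derivative_eq_rhs) (simp add: fun_eq_iff sum_distrib_left mult_ac)
    qed
    then have "good i (\<lambda>j. c (?x j))" using c(1) by (simp add: good_def)
    then show ?thesis by blast
  qed
  then obtain c where c: "\<And>i. good i (c i)" by metis
  have "jacobi F (\<lambda>v. \<chi> i j. c i j v)"
    unfolding jacobi_def using c[unfolded good_def] by (simp add: matrix_vector_mult_def)
  then show ?thesis using that by blast
qed

text \<open>Euler's identity, and homogeneity of degree \<open>d - 1\<close> of the Jacobian matrix.
  The direction is scaled together with the point, so that the exponent is \<open>d\<close>.\<close>

lemma jacobi_homogeneous:
  assumes "jacobi F J" "\<And>c v. F (c *s v) = c ^ d *s F v"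
  shows "J v *v v = of_nat d *s F v" "J (c *s v) *v (c *s w) = c ^ d *s (J v *v w)"
proof -
  have D: "((\<lambda>u. F (v + u *s w) $ i) has_field_derivative (J v *v w) $ i) (at 0)" for v w i
    using assms(1) unfolding jacobi_def by blast
  have "(J v *v v) $ i = of_nat d * F v $ i" for i
  proof -
    have e: "F (v + u *s v) $ i = (1 + u) ^ d * F v $ i" for u
    proof -
      have "v + u *s v = (1 + u) *s v" by (simp add: vec_eq_iff algebra_simps)
      then have "F (v + u *s v) = (1 + u) ^ d *s F v" by (simp only: assms(2))
      then show ?thesis by simp
    qed
    have "((\<lambda>u. (1 + u) ^ d * F v $ i) has_field_derivative of_nat d * F v $ i) (at 0)"
      by (auto intro!: derivative_eq_intros)
    then show ?thesis using DERIV_unique[OF D[of v v i, unfolded e]] by blast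
  qed
  then show "J v *v v = of_nat d *s F v" by (simp add: vec_eq_iff)
  have "(J (c *s v) *v (c *s w)) $ i = c ^ d * (J v *v w) $ i" for i
  proof -
    have e: "F (c *s v + u *s (c *s w)) $ i = c ^ d * F (v + u *s w) $ i" for u
    proof -
      have "c *s v + u *s (c *s w) = c *s (v + u *s w)" by (simp add: vec_eq_iff algebra_simps)
      then have "F (c *s v + u *s (c *s w)) = c ^ d *s F (v + u *s w)" by (simp only: assms(2))
      then show ?thesis by simp
    qed
    show ?thesis
      by (rule DERIV_unique[OF D[of "c *s v" "c *s w" i, unfolded e]]) (rule DERIV_cmult[OF D])
  qed
  then show "J (c *s v) *v (c *s w) = c ^ d *s (J v *v w)" by (simp add: vec_eq_iff)
qed

text \<open>A representation of degree 0 is constant, whereas \<open>p\<close> and \<open>q\<close>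
  are two distinct points.\<close>

lemma vrep_degree_pos:
  fixes g :: "'n::finite proj \<Rightarrow> 'm::finite proj" and p q :: "complex^'n"
  assumes "vrep UNIV g d F" "F v \<noteq> 0" "\<And>x y. g x = g y \<Longrightarrow> x = y"
    and "p \<noteq> 0" "\<And>k. q \<noteq> k *s p"
  shows "d > 0"
proof (rule ccontr)
  assume "\<not> d > 0"
  then have c: "F (k *s x) = F x" for k x using assms(1) unfolding vrep_def by simp
  have "F x = F 0" for x using c[of 0 x] by simp
  then have "g (abs_proj x) = abs_proj (F 0)" if "x \<noteq> 0" for x
    using assms(1,2) that unfolding vrep_def by (metis UNIV_I)
  moreover have "q \<noteq> 0" using assms(5)[of 0] by (metis vector_smult_lzero)
  ultimately have "abs_proj p = abs_proj q" using assms(3,4) by metis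
  then show False using abs_proj_eq_iff[OF \<open>q \<noteq> 0\<close> assms(4)] assms(5) by metis
qed

lemma vrep_pos_zero: "vrep V g d F \<Longrightarrow> d > 0 \<Longrightarrow> F 0 = 0"
  using vrep_at_zero[of V g d F] unfolding vrep_def
  by (metis vector_smult_lzero zero_power)

lemma vrep_value:
  assumes "vrep V g d F" "v \<noteq> 0" "abs_proj v \<in> V" "F v \<noteq> 0"
  shows "g (abs_proj v) = abs_proj (F v)"
  using assms unfolding vrep_def by blast

text \<open>If \<open>J v\<close> kills \<open>w\<close>, then \<open>K (E (v + u *s w))\<close> is
  stationary at \<open>u = 0\<close>. It is proportional to \<open>v + u *s w\<close>, so
  \<open>w\<close> is a multiple of \<open>v\<close>, and Euler's identity leaves only the multiple
  0 because \<open>E v\<close> is nonzero and the degree is positive.\<close>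

lemma jacobi_det_nonzero:
  fixes g h :: "'n::finite proj \<Rightarrow> 'n proj" and p q :: "complex^'n"
  assumes h: "vreg UNIV h" "\<And>p. h (g p) = p" "\<And>p. g (h p) = p"
    and E: "vrep UNIV g e E" "jacobi E J" "E v \<noteq> 0" "v \<noteq> 0"
    and ind: "p \<noteq> 0" "\<And>k. q \<noteq> k *s p"
  shows "det (J v) \<noteq> 0"
proof -
  have e: "e > 0" by (rule vrep_degree_pos[OF E(1) E(3) _ ind]) (metis h(2))
  obtain k K where K: "vrep UNIV h k K" "K (E v) \<noteq> 0" using h(1) E(3) unfolding vreg_def by blast
  have k: "k > 0" by (rule vrep_degree_pos[OF K _ ind]) (metis h(3))
  have cross: "K (E x) $ i * x $ j = K (E x) $ j * x $ i" for x i j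
  proof (cases "x = 0 \<or> E x = 0 \<or> K (E x) = 0")
    case True then show ?thesis using vrep_pos_zero[OF E(1) e] vrep_pos_zero[OF K(1) k] by auto
  next
    case False
    then have "abs_proj (K (E x)) = abs_proj x"
      using vrep_value[OF E(1)] vrep_value[OF K(1)] h(2) by (metis UNIV_I)
    then show ?thesis using abs_proj_eq_cross False by blast
  qed
  have "w = 0" if w: "J v *v w = 0" for w
  proof -
    have dE: "((\<lambda>u. E (v + u *s w) $ i) has_field_derivative 0) (at 0)" for i
      using E(2)[unfolded jacobi_def, THEN conjunct2, rule_format, of v w i] w by simp
    have dK: "((\<lambda>u. K (E (v + u *s w)) $ i) has_field_derivative 0) (at 0)" for i
    proof -
      have "(\<lambda>v. K v $ i) \<in> polyring coords" using K unfolding vrep_def by blast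
      then have "\<exists>D. ((\<lambda>u. K (E (v + u *s w)) $ i) has_field_derivative D) (at 0) \<and>
           ((\<lambda>u. K (E v) $ i) has_field_derivative D) (at (0::complex))"
        by (rule polyring_same_jet[where x = "\<lambda>u. E (v + u *s w)" and y = "\<lambda>_. E v", THEN conjunct2])
          (use dE in \<open>auto simp: coords_def intro!: exI[of _ 0]\<close>)
      then obtain D where "((\<lambda>u. K (E (v + u *s w)) $ i) has_field_derivative D) (at 0)"
           "((\<lambda>u. K (E v) $ i) has_field_derivative D) (at (0::complex))" by blast
      moreover from this(2) have "D = 0" by (rule DERIV_unique) (rule DERIV_const)
      ultimately show ?thesis by simp
    qed
    have "K (E v) $ i * w $ j = K (E v) $ j * w $ i" for i j
    proof -
      have "((\<lambda>u. K (E (v + u *s w)) $ i * (v + u *s w) $ j - K (E (v + u *s w)) $ j * (v + u *s w) $ i)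
          has_field_derivative (K (E v) $ i * w $ j - K (E v) $ j * w $ i)) (at 0)"
        by (auto intro!: derivative_eq_intros dK)
      moreover have "K (E (v + u *s w)) $ i * (v + u *s w) $ j - K (E (v + u *s w)) $ j * (v + u *s w) $ i = 0" for u
        using cross[of "v + u *s w" i j] by (simp only: right_minus_eq)
      ultimately have "((\<lambda>u. 0) has_field_derivative (K (E v) $ i * w $ j - K (E v) $ j * w $ i)) (at (0::complex))"
        by (simp only:)
      then show ?thesis using DERIV_unique[OF _ DERIV_const] by fastforce
    qed
    then obtain c where c: "w = c *s K (E v)" using cross_imp_scale[OF K(2)] by metis
    obtain c' where c': "v = c' *s K (E v)" using cross_imp_scale[OF K(2)] cross by metis
    have "c' \<noteq> 0" using c' E(4) by auto
    then have w': "w = (c / c') *s v" unfolding c by (subst c') (simp add: vec_eq_iff)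
    have "E (c *s v) = c ^ e *s E v" for c v using E(1) unfolding vrep_def by blast
    then have "J v *v v = of_nat e *s E v" using jacobi_homogeneous(1)[OF E(2)] by blast
    then have "(c / c') *s (of_nat e *s E v) = 0"
      using w unfolding w' by (simp add: vector_scalar_commute)
    then have "c / c' = 0" using e E(3) by (simp add: scale_vec_zero_iff)
    then show "w = 0" using w' by simp
  qed
  then have "\<exists>B. B ** J v = mat 1" using matrix_left_invertible_ker by blast
  then obtain B where "B ** J v = mat 1" by blast
  then have "det B * det (J v) = 1" by (metis det_mul det_I)
  then show ?thesis by auto
qed


text \<open>Formally \<open>F = h E\<close> with \<open>h = F_k / E_k\<close>, so
  \<open>dF = h dE + E dh\<close>. Since \<open>E = L v / e\<close> by Euler's identity, the
  Jacobian matrix is \<open>h L (I + v dh / (e h))\<close>. The determinant of the last factor is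
  \<open>1 + dh(v) / (e h)\<close>, and \<open>dh(v) = (f - e) h\<close> makes it
  \<open>f / e\<close>.\<close>

lemma jacobi_det_ratio:
  fixes F E :: "complex^'n \<Rightarrow> complex^'n"
  assumes F: "vrep UNIV g f F" "f > 0" "jacobi F J" and E: "vrep UNIV g e E" "e > 0" "jacobi E L"
    and nz: "E v $ k \<noteq> 0" "F v $ k \<noteq> 0"
  shows "of_nat e * (E v $ k ^ CARD('n) * det (J v)) = of_nat f * (F v $ k ^ CARD('n) * det (L v))"
proof -
  let ?a = "E v $ k" and ?b = "F v $ k"
  have cross: "E x $ k * F x $ i = F x $ k * E x $ i" for x i
  proof (cases "x = 0")
    case True then show ?thesis using vrep_pos_zero[OF F(1,2)] by simp
  next
    case False then show ?thesis using vrep_cross[OF F(1) E(1) False, of i k] by (simp add: mult.commute)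
  qed
  have eF: "F v $ i = ?b / ?a * E v $ i" for i using cross[of v i] nz by (simp add: field_simps)
  have scF: "\<And>c v. F (c *s v) = c ^ f *s F v" and scE: "\<And>c v. E (c *s v) = c ^ e *s E v"
    using F(1) E(1) unfolding vrep_def by blast+
  have JF: "J v *v v = of_nat f *s F v" and LE: "L v *v v = of_nat e *s E v"
    using jacobi_homogeneous(1)[OF F(3) scF] jacobi_homogeneous(1)[OF E(3) scE] by auto
  have prod: "(L v *v w) $ k * F v $ i + ?a * (J v *v w) $ i = (J v *v w) $ k * E v $ i + ?b * (L v *v w) $ i" for w i
  proof -
    have dF: "((\<lambda>u. F (v + u *s w) $ i) has_field_derivative (J v *v w) $ i) (at 0)" for i
      using F(3) unfolding jacobi_def by blast
    have dE: "((\<lambda>u. E (v + u *s w) $ i) has_field_derivative (L v *v w) $ i) (at 0)" for i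
      using E(3) unfolding jacobi_def by blast
    have "((\<lambda>u. E (v + u *s w) $ k * F (v + u *s w) $ i) has_field_derivative
        (L v *v w) $ k * F v $ i + ?a * (J v *v w) $ i) (at 0)"
      using DERIV_mult[OF dE[of k] dF[of i]] by (simp add: add.commute mult.commute)
    moreover have "((\<lambda>u. F (v + u *s w) $ k * E (v + u *s w) $ i) has_field_derivative
        (J v *v w) $ k * E v $ i + ?b * (L v *v w) $ i) (at 0)"
      using DERIV_mult[OF dF[of k] dE[of i]] by (simp add: add.commute mult.commute)
    ultimately show ?thesis unfolding cross by (rule DERIV_unique)
  qed
  \<comment> \<open>The row vector \<open>dh / (e h)\<close> for
    \<open>h = F_k / E_k\<close>.\<close>
  define l where "l = (\<chi> j. (J v $ k $ j - ?b / ?a * L v $ k $ j) / (of_nat e * ?b))"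
  define U :: "complex^'n^'n" where "U = (\<chi> i j. (if i = j then 1 else 0) + v $ i * l $ j)"
  have ent: "?a * J v $ i $ j = ?b * (L v ** U) $ i $ j" for i j
  proof -
    have col: "(A *v axis j 1) $ i = A $ i $ j" for A :: "complex^'n^'n" and i
      by (simp add: matrix_vector_mult_def axis_def if_distrib[of "\<lambda>x. _ * x"] cong: if_cong)
    have "(L v ** U) $ i $ j = (\<Sum>a\<in>UNIV. (if a = j then L v $ i $ a else 0)) + (\<Sum>a\<in>UNIV. L v $ i $ a * v $ a * l $ j)"
      by (simp add: U_def matrix_matrix_mult_def distrib_left sum.distrib mult.assoc if_distrib[of "\<lambda>x. _ * x"] cong: if_cong)
    also have "\<dots> = L v $ i $ j + (L v *v v) $ i * l $ j"
      by (simp add: matrix_vector_mult_def sum_distrib_right)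
    also have "\<dots> = L v $ i $ j + of_nat e * E v $ i * l $ j" by (simp add: LE)
    finally have X: "(L v ** U) $ i $ j = L v $ i $ j + of_nat e * E v $ i * l $ j" .
    have "?b * (of_nat e * E v $ i * l $ j) = E v $ i * (J v $ k $ j - ?b / ?a * L v $ k $ j)"
      using nz E(2) by (simp add: l_def field_simps)
    then have "?b * (L v ** U) $ i $ j = ?b * L v $ i $ j + E v $ i * (J v $ k $ j - ?b / ?a * L v $ k $ j)"
      unfolding X distrib_left by (simp only:)
    moreover have "?a * J v $ i $ j = ?b * L v $ i $ j + E v $ i * (J v $ k $ j - ?b / ?a * L v $ k $ j)"
      using prod[of "axis j 1" i] unfolding col eF[of i] by (simp add: algebra_simps)
    ultimately show ?thesis by simp
  qed
  have "?a ^ CARD('n) * det (J v) = det (\<chi> i j. ?a * J v $ i $ j)" by (simp add: det_scale)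
  also have "\<dots> = ?b ^ CARD('n) * (det (L v) * det U)"
    unfolding ent det_scale det_mul ..
  also have "det U = 1 + (\<Sum>j\<in>UNIV. l $ j * v $ j)" unfolding U_def by (rule det_rank_one_update)
  also have "(\<Sum>j\<in>UNIV. l $ j * v $ j) =
      (\<Sum>j\<in>UNIV. (J v $ k $ j * v $ j - ?b / ?a * (L v $ k $ j * v $ j)) / (of_nat e * ?b))"
    by (intro sum.cong refl) (simp add: l_def left_diff_distrib)
  also have "\<dots> = ((J v *v v) $ k - ?b / ?a * (L v *v v) $ k) / (of_nat e * ?b)"
    unfolding sum_divide_distrib[symmetric] sum_subtractf sum_distrib_left[symmetric]
    by (simp only: matrix_vector_mult_def vec_lambda_beta)
  also have "\<dots> = of_nat f / of_nat e - 1"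
    using nz E(2) by (simp add: JF LE field_simps)
  finally show ?thesis using E(2) by (simp add: field_simps)
qed

section \<open>Restriction of an automorphism of projective space to a line\<close>

lemma polyring_on_line:
  assumes "f \<in> polyring coords"
  obtains P where "\<And>t. f (q + t *s p) = poly P t"
proof -
  have "(\<lambda>t. f (q + t *s p)) \<in> polyring {\<lambda>t. t}"
    using assms
    by (rule polyring_compose) (auto simp: coords_def intro!: polyring_intros intro: polyring.gen)
  then show ?thesis using polyring_poly that by metis
qed

text \<open>With \<open>n = CARD('n)\<close>, the Jacobian determinant of a representation of degree
  \<open>f\<close> that is nonzero at infinity has degree \<open>n (f - 1)\<close> on the line, and
  all its zeros come from the common factor, which contributes \<open>n * degree \<phi>\<close>. The
  reduced map therefore has degree 1.\<close>

lemma aut_projective_line: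
  fixes g h :: "'n::finite proj \<Rightarrow> 'n proj"
  assumes g: "vreg UNIV g" and h: "vreg UNIV h" "\<And>p. h (g p) = p" "\<And>p. g (h p) = p"
    and ind: "p \<noteq> 0" "\<And>k. q \<noteq> k *s p"
  obtains u w where "\<And>\<sigma> \<tau>. (\<sigma>, \<tau>) \<noteq> (0, 0) \<Longrightarrow>
     \<sigma> *s u + \<tau> *s w \<noteq> 0 \<and> g (abs_proj (\<sigma> *s q + \<tau> *s p)) = abs_proj (\<sigma> *s u + \<tau> *s w)"
proof -
  have inj: "g x = g y \<Longrightarrow> x = y" for x y by (metis h(2))
  have nzx: "q + t *s p \<noteq> 0" for t using independent_line ind by blast
  obtain f F where F: "vrep UNIV g f F" "F p \<noteq> 0" using g ind(1) unfolding vreg_def by blast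
  have f: "f > 0" by (rule vrep_degree_pos[OF F inj ind])
  have scF: "F (c *s v) = c ^ f *s F v" for c v using F(1) unfolding vrep_def by blast
  have pF: "(\<lambda>v. F v $ i) \<in> polyring coords" for i using F(1) unfolding vrep_def by blast
  obtain J where J: "jacobi F J" using jacobi_exists[OF pF] .
  have pJ: "(\<lambda>v. det (J v)) \<in> polyring coords"
    by (rule det_polyring) (use J in \<open>simp add: jacobi_def\<close>)
  obtain D where D: "\<And>t. det (J (q + t *s p)) = poly D t" using polyring_on_line[OF pJ, of q p] by blast
  obtain D' where D': "\<And>t. det (J (p + t *s q)) = poly D' t" using polyring_on_line[OF pJ, of p q] by blast
  have "\<exists>P. \<forall>t. F (q + t *s p) $ i = poly P t" for i using polyring_on_line[OF pF, of q p i] by metis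
  then obtain P where P: "\<And>i t. F (q + t *s p) $ i = poly (P i) t" by metis
  have "\<exists>P. \<forall>t. F (p + t *s q) $ i = poly P t" for i using polyring_on_line[OF pF, of p q i] by metis
  then obtain P' where P': "\<And>i t. F (p + t *s q) $ i = poly (P' i) t" by metis
  have line: "q + t *s p = t *s (p + (1 / t) *s q)" if "t \<noteq> 0" for t
    using that by (simp add: vec_eq_iff field_simps)
  have revP: "poly (P i) t = t ^ f * poly (P' i) (1 / t)" if "t \<noteq> 0" for i t
    unfolding P[symmetric] P'[symmetric] line[OF that] scF by simp
  have lead: "degree (P i) \<le> f" "coeff (P i) f = F p $ i" for i
    using poly_reversal[OF revP] P'[of 0 i] by simp_all
  \<comment> \<open>The entries of \<open>J\<close> are homogeneous of degree \<open>f - 1\<close>;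
    one extra factor \<open>t\<close> for each row raises this to \<open>f\<close>.\<close>
  have "poly (monom 1 CARD('n) * D) t = t ^ (f * CARD('n)) * poly D' (1 / t)" if t: "t \<noteq> 0" for t
  proof -
    let ?x = "p + (1 / t) *s q"
    have "t * J (t *s ?x) $ i $ j = t ^ f * J ?x $ i $ j" for i j
    proof -
      have col: "(A *v (c *s axis j 1)) $ i = c * A $ i $ j" for A :: "complex^'n^'n" and i c
        by (simp add: matrix_vector_mult_def axis_def if_distrib[of "\<lambda>x. _ * x"] mult.commute cong: if_cong)
      have col1: "(A *v axis j 1) $ i = A $ i $ j" for A :: "complex^'n^'n" and i
        using col[of A 1 i] by simp
      show ?thesis
        using arg_cong[OF jacobi_homogeneous(2)[OF J scF, of t ?x "axis j 1"], of "\<lambda>v. v $ i"]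
        by (simp only: col col1 vector_smult_component)
    qed
    then have "(\<chi> i j. t * J (t *s ?x) $ i $ j) = (\<chi> i j. t ^ f * J ?x $ i $ j)" by simp
    then have "t ^ CARD('n) * det (J (t *s ?x)) = (t ^ f) ^ CARD('n) * det (J ?x)"
      by (metis det_scale)
    then show ?thesis
      unfolding line[OF t, symmetric] D D' by (simp add: poly_monom power_mult)
  qed
  note rev = poly_reversal[OF this]
  have "det (J p) \<noteq> 0" by (rule jacobi_det_nonzero[OF h F(1) J F(2) ind(1) ind])
  then have c: "coeff (monom 1 CARD('n) * D) (f * CARD('n)) \<noteq> 0" using rev(2) D'[of 0] by simp
  then have "degree (monom 1 CARD('n) * D) = f * CARD('n)"
    using rev(1) le_degree[OF c] by simp
  moreover have "D \<noteq> 0" using c by auto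
  ultimately have dD: "degree D + CARD('n) = f * CARD('n)"
    by (simp add: degree_mult_eq monom_eq_0_iff degree_monom_eq)
  obtain k0 where k0: "F p $ k0 \<noteq> 0" using F(2) by (metis vec_eq_iff zero_index)
  then have "P k0 \<noteq> 0" using lead(2)[of k0] by auto
  then obtain \<phi> R where \<phi>: "\<phi> \<noteq> 0" "\<And>i. P i = \<phi> * R i" "\<And>t. \<exists>i. poly (R i) t \<noteq> 0"
    using remove_common_factor[of P] by blast
  have local: "\<exists>e E Q. vrep UNIV g e E \<and> E (q + t *s p) \<noteq> 0 \<and> (\<forall>i t. E (q + t *s p) $ i = poly (Q i) t) \<and>
      (\<forall>i j. R i * Q j = R j * Q i)" for t
  proof -
    obtain e E where E: "vrep UNIV g e E" "E (q + t *s p) \<noteq> 0" using g nzx unfolding vreg_def by blast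
    have "(\<lambda>v. E v $ i) \<in> polyring coords" for i using E(1) unfolding vrep_def by blast
    then have "\<exists>P. \<forall>t. E (q + t *s p) $ i = poly P t" for i using polyring_on_line by metis
    then obtain Q where Q: "\<And>i t. E (q + t *s p) $ i = poly (Q i) t" by metis
    have "R i * Q j = R j * Q i" for i j
    proof -
      have "P i * Q j = P j * Q i"
        by (rule poly_eqI_infinite) (simp add: P[symmetric] Q[symmetric] vrep_cross[OF F(1) E(1) nzx UNIV_I, of _ i j])
      then have "\<phi> * (R i * Q j) = \<phi> * (R j * Q i)" unfolding \<phi>(2) by (simp only: mult.assoc)
      then show ?thesis using \<phi>(1) by simp
    qed
    then show ?thesis using E Q by blast
  qed
  have val: "g (abs_proj (q + t *s p)) = abs_proj (\<chi> i. poly (R i) t)" for t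
  proof -
    obtain e E Q where E: "vrep UNIV g e E" "E (q + t *s p) \<noteq> 0" "\<And>i t. E (q + t *s p) $ i = poly (Q i) t"
      "\<And>i j. R i * Q j = R j * Q i" using local by metis
    have "poly (R i) t * poly (Q j) t = poly (R j) t * poly (Q i) t" for i j using E(4) by (metis poly_mult)
    moreover have "(\<chi> i. poly (R i) t) \<noteq> 0" using \<phi>(3)[of t] by (auto simp: vec_eq_iff)
    ultimately have "abs_proj (\<chi> i. poly (R i) t) = abs_proj (E (q + t *s p))"
      using E(2,3) by (intro abs_proj_eqI_cross) auto
    then show ?thesis using vrep_value[OF E(1) nzx UNIV_I E(2)] by simp
  qed
  \<comment> \<open>At each \<open>t\<close> a representation that is nonzero there has a
    nonvanishing determinant, and the ratio formula compares it with \<open>D\<close>.\<close>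
  have "degree D = degree (\<phi> ^ CARD('n))"
  proof (rule degree_eq_of_local_equiv(2))
    show "\<phi> ^ CARD('n) \<noteq> 0" using \<phi> by simp
    fix t
    obtain e E Q where E: "vrep UNIV g e E" "E (q + t *s p) \<noteq> 0" "\<And>i t. E (q + t *s p) $ i = poly (Q i) t"
      "\<And>i j. R i * Q j = R j * Q i" using local by metis
    have e: "e > 0" by (rule vrep_degree_pos[OF E(1,2) inj ind])
    have pE: "(\<lambda>v. E v $ i) \<in> polyring coords" for i using E(1) unfolding vrep_def by blast
    obtain L where L: "jacobi E L" using jacobi_exists[OF pE] .
    have "(\<lambda>v. det (L v)) \<in> polyring coords"
      by (rule det_polyring) (use L in \<open>simp add: jacobi_def\<close>)
    then obtain N where N: "\<And>t. det (L (q + t *s p)) = poly N t" using polyring_on_line by blast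
    obtain k where k: "poly (Q k) t \<noteq> 0" using E(2,3) by (metis vec_eq_iff zero_index)
    have Rk: "poly (R k) t \<noteq> 0"
    proof
      assume "poly (R k) t = 0"
      moreover have "poly (R k) t * poly (Q j) t = poly (R j) t * poly (Q k) t" for j using E(4) by (metis poly_mult)
      ultimately show False using k \<phi>(3)[of t] by auto
    qed
    have nzpoly: "Q k \<noteq> 0" "P k \<noteq> 0" using k Rk \<phi> by auto
    let ?n = "CARD('n)"
    \<comment> \<open>The ratio formula holds only where the coordinates \<open>P k\<close> and
      \<open>Q k\<close> are nonzero. The extra factor makes both sides vanish elsewhere and is
      cancelled afterwards.\<close>
    have "(P k * Q k) * (smult (of_nat e) (Q k ^ ?n * D)) = (P k * Q k) * (smult (of_nat f) (P k ^ ?n * N))"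
    proof (rule poly_eqI_infinite)
      fix s
      show "poly ((P k * Q k) * (smult (of_nat e) (Q k ^ ?n * D))) s = poly ((P k * Q k) * (smult (of_nat f) (P k ^ ?n * N))) s"
      proof (cases "poly (P k) s = 0 \<or> poly (Q k) s = 0")
        case False
        then show ?thesis
          using jacobi_det_ratio[OF F(1) f J E(1) e L, of "q + s *s p" k] by (simp add: P E(3) D N)
      qed auto
    qed
    moreover have "P k * Q k \<noteq> 0" using nzpoly by simp
    ultimately have "smult (of_nat e) (Q k ^ ?n * D) = smult (of_nat f) (P k ^ ?n * N)"
      using mult_left_cancel by blast
    then have "D * smult (of_nat e) (Q k ^ ?n) = \<phi> ^ ?n * smult (of_nat f) (R k ^ ?n * N)"
      unfolding \<phi>(2) by (simp add: power_mult_distrib mult_ac)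
    moreover have "poly N t \<noteq> 0"
      unfolding N[symmetric] by (rule jacobi_det_nonzero[OF h E(1) L E(2) nzx ind])
    ultimately show "\<exists>u v. poly u t \<noteq> 0 \<and> poly v t \<noteq> 0 \<and> D * u = \<phi> ^ ?n * v"
      using k Rk e f
      by (intro exI[of _ "smult (of_nat e) (Q k ^ ?n)"] exI[of _ "smult (of_nat f) (R k ^ ?n * N)"]) simp
  qed
  then have "degree \<phi> * CARD('n) + CARD('n) = f * CARD('n)"
    using dD \<phi>(1) by (simp add: degree_power_eq mult.commute)
  then have "(degree \<phi> + 1) * CARD('n) = f * CARD('n)" by simp
  then have d1: "degree \<phi> + 1 = f" by (metis mult_cancel2 zero_less_card_finite not_less_zero)
  have k0': "coeff ((\<chi> i. P i) $ k0) f \<noteq> 0" using k0 lead by simp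
  have degs: "degree (R i) \<le> 1" "coeff (P i) f = lead_coeff \<phi> * coeff (R i) 1" for i
    using degree_of_reduced(2,3)[OF \<phi>(1) _ _ k0', of R i] \<phi>(2) lead(1) d1 by auto
  define u where "u = (\<chi> i. coeff (R i) 0)"
  define w where "w = (\<chi> i. coeff (R i) 1)"
  have R: "(\<chi> i. poly (R i) t) = u + t *s w" for t
  proof -
    have "poly (R i) t = coeff (R i) 0 + t * coeff (R i) 1" for i
    proof -
      have "R i = [:coeff (R i) 0, coeff (R i) 1:]"
      proof (rule poly_eqI)
        fix n show "coeff (R i) n = coeff [:coeff (R i) 0, coeff (R i) 1:] n"
          using degs(1)[of i] coeff_eq_0[of "R i" n] by (auto simp: coeff_pCons split: nat.split)
      qed
      then have "poly (R i) t = poly [:coeff (R i) 0, coeff (R i) 1:] t" by simp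
      then show ?thesis by simp
    qed
    then show ?thesis by (simp add: u_def w_def vec_eq_iff)
  qed
  have Fp: "F p = lead_coeff \<phi> *s w" using degs(2) lead(2) by (simp add: w_def vec_eq_iff)
  then have w0: "w \<noteq> 0" using F(2) by (metis vector_smult_rzero)
  have gp: "g (abs_proj p) = abs_proj w"
    using vrep_value[OF F(1) ind(1) UNIV_I F(2)] abs_proj_scale[OF _ w0, of "lead_coeff \<phi>"] \<phi>(1) Fp by simp
  have uw0: "u + t *s w \<noteq> 0" for t
    using \<phi>(3)[of t] unfolding R[symmetric] by (auto simp: vec_eq_iff)
  show ?thesis
  proof (rule that)
    fix \<sigma> \<tau> :: complex assume st: "(\<sigma>, \<tau>) \<noteq> (0, 0)"
    show "\<sigma> *s u + \<tau> *s w \<noteq> 0 \<and> g (abs_proj (\<sigma> *s q + \<tau> *s p)) = abs_proj (\<sigma> *s u + \<tau> *s w)"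
    proof (cases "\<sigma> = 0")
      case True
      then have "\<tau> \<noteq> 0" using st by simp
      then show ?thesis using True abs_proj_scale[OF _ w0] abs_proj_scale[OF _ ind(1)] gp w0 by (simp add: scale_vec_zero_iff)
    next
      case False
      have e: "\<sigma> *s a + \<tau> *s b = \<sigma> *s (a + (\<tau> / \<sigma>) *s b)" for a b :: "complex^'n"
        using False by (simp add: vec_eq_iff field_simps)
      show ?thesis
        unfolding e scale_vec_zero_iff abs_proj_scale[OF False uw0] abs_proj_scale[OF False nzx] val R
        using uw0 False by blast
    qed
  qed
qed


section \<open>Maps that are linear on every line are linear\<close>

lemma independent_representatives:
  fixes u t :: "complex^'n"
  assumes "u \<noteq> 0" "t \<noteq> 0" "abs_proj t \<noteq> abs_proj u"
  shows "a *s t + b *s u = 0 \<Longrightarrow> a = 0 \<and> b = 0"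
proof -
  assume z: "a *s t + b *s u = 0"
  have "a = 0"
  proof (rule ccontr)
    assume a: "a \<noteq> 0"
    have "t $ i = - (b / a) * u $ i" for i
    proof -
      have "a * t $ i + b * u $ i = 0" using arg_cong[OF z, of "\<lambda>v. v $ i"] by simp
      then show ?thesis using a by (simp add: field_simps add_eq_0_iff2)
    qed
    then have "t = (- (b / a)) *s u" by (simp add: vec_eq_iff)
    then show False using assms abs_proj_eq_iff by blast
  qed
  then show "a = 0 \<and> b = 0" using z assms(1) by (simp add: scale_vec_zero_iff)
qed

text \<open>The lift \<open>T\<close> of \<open>g\<close> is normalised by \<open>T e = u0\<close> on every plane containing \<open>e\<close>; additivity follows by comparing
  the lines through \<open>v, w\<close> and through \<open>v + e, w\<close>.\<close>

lemma collineation_linear: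
  fixes g :: "'n::finite proj \<Rightarrow> 'n proj"
  assumes inj: "\<And>x y. g x = g y \<Longrightarrow> x = y"
    and line: "\<And>p q. p \<noteq> 0 \<Longrightarrow> (\<And>k. q \<noteq> k *s p) \<Longrightarrow> \<exists>u w. \<forall>\<sigma> \<tau>. (\<sigma>, \<tau>) \<noteq> (0, 0) \<longrightarrow>
       \<sigma> *s u + \<tau> *s w \<noteq> 0 \<and> g (abs_proj (\<sigma> *s q + \<tau> *s p)) = abs_proj (\<sigma> *s u + \<tau> *s w)"
  obtains M :: "complex^'n^'n" where "\<And>v. v \<noteq> 0 \<Longrightarrow> M *v v \<noteq> 0 \<and> g (abs_proj v) = abs_proj (M *v v)"
proof -
  define e :: "complex^'n" where "e = 1"
  have e0: "e \<noteq> 0" by (simp add: e_def)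
  obtain u0 where u0: "u0 \<noteq> 0" "g (abs_proj e) = abs_proj u0" by (rule proj_cases)
  define ind where "ind v \<longleftrightarrow> (\<forall>k. v \<noteq> k *s e)" for v :: "complex^'n"
  define lift where "lift v t \<longleftrightarrow> (\<forall>\<sigma> \<tau>. (\<sigma>, \<tau>) \<noteq> (0, 0) \<longrightarrow> \<sigma> *s t + \<tau> *s u0 \<noteq> 0 \<and>
      g (abs_proj (\<sigma> *s v + \<tau> *s e)) = abs_proj (\<sigma> *s t + \<tau> *s u0))" for v t
  have ind_nz: "v \<noteq> 0" if "ind v" for v using that unfolding ind_def by (metis vector_smult_lzero)
  have pair: "\<exists>a b. a \<noteq> 0 \<and> b \<noteq> 0 \<and> (\<forall>\<sigma> \<tau>. (\<sigma>, \<tau>) \<noteq> (0, 0) \<longrightarrow> \<sigma> *s (a *s Q) + \<tau> *s (b *s P) \<noteq> 0 \<and>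
       g (abs_proj (\<sigma> *s q + \<tau> *s p)) = abs_proj (\<sigma> *s (a *s Q) + \<tau> *s (b *s P)))"
    if pq: "p \<noteq> 0" "\<And>k. q \<noteq> k *s p" and PQ: "P \<noteq> 0" "g (abs_proj p) = abs_proj P" "Q \<noteq> 0" "g (abs_proj q) = abs_proj Q" for p q P Q
  proof -
    obtain u w where uw: "\<And>\<sigma> \<tau>. (\<sigma>, \<tau>) \<noteq> (0, 0) \<Longrightarrow>
       \<sigma> *s u + \<tau> *s w \<noteq> 0 \<and> g (abs_proj (\<sigma> *s q + \<tau> *s p)) = abs_proj (\<sigma> *s u + \<tau> *s w)"
      using line[OF pq] by metis
    have "u \<noteq> 0" "abs_proj u = abs_proj Q" using uw[of 1 0] PQ by auto
    then obtain a where a: "u = a *s Q" "a \<noteq> 0" using abs_proj_eq_iff PQ(3) by (metis vector_smult_lzero)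
    have "w \<noteq> 0" "abs_proj w = abs_proj P" using uw[of 0 1] PQ by auto
    then obtain b where b: "w = b *s P" "b \<noteq> 0" using abs_proj_eq_iff PQ(1) by (metis vector_smult_lzero)
    show ?thesis using uw a b by blast
  qed
  have lift_exists: "\<exists>t. lift v t" if v: "ind v" for v
  proof -
    obtain Q where Q: "Q \<noteq> 0" "g (abs_proj v) = abs_proj Q" by (rule proj_cases)
    obtain a b where ab: "a \<noteq> 0" "b \<noteq> 0" "\<And>\<sigma> \<tau>. (\<sigma>, \<tau>) \<noteq> (0, 0) \<Longrightarrow> \<sigma> *s (a *s Q) + \<tau> *s (b *s u0) \<noteq> 0 \<and>
       g (abs_proj (\<sigma> *s v + \<tau> *s e)) = abs_proj (\<sigma> *s (a *s Q) + \<tau> *s (b *s u0))"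
      using pair[OF e0 v[unfolded ind_def, rule_format] u0 Q] by blast
    have s: "\<sigma> *s (a *s Q) + \<tau> *s (b *s u0) = b *s (\<sigma> *s ((a / b) *s Q) + \<tau> *s u0)" for \<sigma> \<tau>
      using ab(2) by (simp add: vec_eq_iff field_simps)
    have "lift v ((a / b) *s Q)"
      unfolding lift_def
    proof (intro allI impI)
      fix \<sigma> \<tau> :: complex assume st: "(\<sigma>, \<tau>) \<noteq> (0, 0)"
      from ab(3)[OF st] show "\<sigma> *s ((a / b) *s Q) + \<tau> *s u0 \<noteq> 0 \<and>
        g (abs_proj (\<sigma> *s v + \<tau> *s e)) = abs_proj (\<sigma> *s ((a / b) *s Q) + \<tau> *s u0)"
        unfolding s using abs_proj_scale[OF ab(2)] by (metis vector_smult_rzero)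
    qed
    then show ?thesis by blast
  qed
  have lift_nz: "t \<noteq> 0" "g (abs_proj v) = abs_proj t" "abs_proj t \<noteq> abs_proj u0" if "lift v t" "ind v" for v t
  proof -
    show "t \<noteq> 0" "g (abs_proj v) = abs_proj t" using that(1)[unfolded lift_def, rule_format, of 1 0] by auto
    then show "abs_proj t \<noteq> abs_proj u0"
      using inj[of "abs_proj v" "abs_proj e"] u0 abs_proj_eq_iff[OF ind_nz[OF that(2)] e0] that(2)
      unfolding ind_def by metis
  qed
  have lift_unique: "t = t'" if "lift v t" "lift v t'" "ind v" for v t t'
  proof -
    note 1 = lift_nz[OF that(1,3)] and 2 = lift_nz[OF that(2,3)]
    obtain a where a: "t' = a *s t" using 1 2 abs_proj_eq_iff by metis
    have "t + u0 \<noteq> 0" "t' + u0 \<noteq> 0" "abs_proj (t' + u0) = abs_proj (t + u0)"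
      using that(1,2)[unfolded lift_def, rule_format, of 1 1] by auto
    then obtain b where "t' + u0 = b *s (t + u0)" using abs_proj_eq_iff by metis
    then have "(a - b) *s t + (1 - b) *s u0 = 0" using a by (simp add: vec_eq_iff algebra_simps)
    from independent_representatives[OF u0(1) 1(1) 1(3) this] have "a = 1" by simp
    then show ?thesis using a by simp
  qed
  define T where "T v = (if ind v then (SOME t. lift v t) else (THE k. v = k *s e) *s u0)" for v
  have Tl: "lift v (T v)" if "ind v" for v
    using someI_ex[OF lift_exists[OF that]] that unfolding T_def by simp
  have T_eq: "T v = t" if "lift v t" "ind v" for v t using lift_unique[OF Tl] that by blast
  have Te: "T (k *s e) = k *s u0" for k
  proof -
    have "(THE k'. k *s e = k' *s e) = k" by (rule the_equality) (auto simp: e_def vec_eq_iff)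
    then show ?thesis unfolding T_def ind_def by auto
  qed
  have Taff: "T (c *s v + d *s e) = c *s T v + d *s u0" for c d v
  proof (cases "ind v")
    case False
    then obtain k where k: "v = k *s e" unfolding ind_def by blast
    have "c *s v + d *s e = (c * k + d) *s e" by (simp add: k vec_eq_iff algebra_simps)
    then have "T (c *s v + d *s e) = (c * k + d) *s u0" by (simp only: Te)
    then show ?thesis unfolding k Te by (simp add: vec_eq_iff algebra_simps)
  next
    case True
    show ?thesis
    proof (cases "c = 0")
      case False
      have i: "ind (c *s v + d *s e)"
        unfolding ind_def
      proof (intro allI notI)
        fix k assume "c *s v + d *s e = k *s e"
        then have "v = ((k - d) / c) *s e" using False by (simp add: vec_eq_iff field_simps)
        then show False using True unfolding ind_def by blast
      qed
      have "lift (c *s v + d *s e) (c *s T v + d *s u0)"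
        unfolding lift_def
      proof (intro allI impI)
        fix \<sigma> \<tau> :: complex assume st: "(\<sigma>, \<tau>) \<noteq> (0, 0)"
        have r: "\<sigma> *s (c *s a + d *s b) + \<tau> *s b = (\<sigma> * c) *s a + (\<sigma> * d + \<tau>) *s b" for a b :: "complex^'n"
          by (simp add: vec_eq_iff algebra_simps)
        have "(\<sigma> * c, \<sigma> * d + \<tau>) \<noteq> (0, 0)" using st False by auto
        then show "\<sigma> *s (c *s T v + d *s u0) + \<tau> *s u0 \<noteq> 0 \<and>
          g (abs_proj (\<sigma> *s (c *s v + d *s e) + \<tau> *s e)) = abs_proj (\<sigma> *s (c *s T v + d *s u0) + \<tau> *s u0)"
          using Tl[OF True] unfolding r lift_def by blast
      qed
      then show ?thesis using T_eq i by blast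
    next
      case c: True
      then show ?thesis using Te[of d] by simp
    qed
  qed
  have T_val: "T v \<noteq> 0 \<and> g (abs_proj v) = abs_proj (T v)" if v: "v \<noteq> 0" for v
  proof (cases "ind v")
    case True then show ?thesis using lift_nz[OF Tl] by blast
  next
    case False
    then obtain k where k: "v = k *s e" unfolding ind_def by blast
    then have k0: "k \<noteq> 0" using v by auto
    show ?thesis
      unfolding k Te abs_proj_scale[OF k0 e0] abs_proj_scale[OF k0 u0(1)] scale_vec_zero_iff using u0 k0 by simp
  qed
  \<comment> \<open>Only the coefficient of \<open>T v\<close> comes out as 1, because it is
    \<open>v\<close> that is shifted by \<open>e\<close>; exchanging \<open>v\<close> and
    \<open>w\<close> gives the other coefficient.\<close>
  have half: "\<exists>b. T (v + w) = T v + b *s T w" if v: "ind v" and w: "\<And>c d. w \<noteq> c *s v + d *s e" for v w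
  proof -
    have iw: "ind w" unfolding ind_def using w[of 0] by auto
    have ivw: "ind (v + w)"
      unfolding ind_def
    proof (intro allI notI)
      fix k assume "v + w = k *s e"
      then have "w = (-1) *s v + k *s e" by (simp add: vec_eq_iff algebra_simps)
      then show False using w by blast
    qed
    have nz: "v \<noteq> 0" "w \<noteq> 0" "v + w \<noteq> 0" using v iw ivw ind_nz by auto
    \<comment> \<open>A relation involving \<open>T w\<close> would express it as the value of
      \<open>T\<close> at a point of the plane spanned by \<open>v\<close> and \<open>e\<close>,
      which injectivity of \<open>g\<close> forbids.\<close>
    have T_ind: "a = 0 \<and> b = 0 \<and> c = 0" if z: "a *s T v + b *s T w + c *s u0 = 0" for a b c
    proof -
      have "b = 0"
      proof (rule ccontr)
        assume b: "b \<noteq> 0"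
        let ?x = "(- a / b) *s v + (- c / b) *s e"
        have "T ?x = T w"
        proof -
          have "T w $ i = (- a / b) * T v $ i + (- c / b) * u0 $ i" for i
          proof -
            have "a * T v $ i + b * T w $ i + c * u0 $ i = 0" using arg_cong[OF z, of "\<lambda>v. v $ i"] by simp
            then have q: "b * T w $ i = - (a * T v $ i) - c * u0 $ i" by algebra
            have "T w $ i = (- (a * T v $ i) - c * u0 $ i) / b" unfolding q[symmetric] using b by simp
            then show ?thesis by (simp add: diff_divide_distrib)
          qed
          then show ?thesis unfolding Taff by (simp add: vec_eq_iff)
        qed
        moreover have x0: "?x \<noteq> 0"
        proof
          assume "?x = 0"
          then have "T w = T 0" using calculation by metis
          then show False using T_val[OF nz(2)] Te[of 0] by simp
        qed
        ultimately have "abs_proj w = abs_proj ?x" using T_val[OF nz(2)] T_val[OF x0] inj by metis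
        then obtain k where "w = k *s ?x" using abs_proj_eq_iff[OF nz(2) x0] by blast
        then have "w = (k * (- a / b)) *s v + (k * (- c / b)) *s e" by (simp add: vec_eq_iff algebra_simps)
        then show False using w by blast
      qed
      then have "a *s T v + c *s u0 = 0" using z by simp
      then show ?thesis using independent_representatives[OF u0(1) lift_nz(1)[OF Tl[OF v] v] lift_nz(3)[OF Tl[OF v] v]] \<open>b = 0\<close> by blast
    qed
    have wv: "w \<noteq> k *s v" for k using w[of k 0] by simp
    have wve: "w \<noteq> k *s (v + e)" for k using w[of k k] by (simp add: vector_add_ldistrib)
    have ve0: "v + e \<noteq> 0"
    proof
      assume "v + e = 0"
      then have "v = (-1) *s e" by (simp add: eq_neg_iff_add_eq_0)
      then show False using v unfolding ind_def by blast
    qed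
    have Tve: "T (v + e) = T v + u0" using Taff[of 1 v 1] by simp
    have Tvwe: "T (v + w + e) = T (v + w) + u0" using Taff[of 1 "v + w" 1] by simp
    have vwe0: "v + w + e \<noteq> 0"
    proof
      assume "v + w + e = 0"
      then have "v + w = (-1) *s e" by (simp add: eq_neg_iff_add_eq_0)
      then show False using ivw unfolding ind_def by blast
    qed
    obtain a b where ab: "\<And>\<sigma> \<tau>. (\<sigma>, \<tau>) \<noteq> (0, 0) \<Longrightarrow> \<sigma> *s (a *s T w) + \<tau> *s (b *s T v) \<noteq> 0 \<and>
       g (abs_proj (\<sigma> *s w + \<tau> *s v)) = abs_proj (\<sigma> *s (a *s T w) + \<tau> *s (b *s T v))"
      using pair[of v w "T v" "T w"] nz wv T_val by blast
    have "a *s T w + b *s T v \<noteq> 0" "abs_proj (T (v + w)) = abs_proj (a *s T w + b *s T v)"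
      using ab[of 1 1] T_val[OF nz(3)] by (auto simp: add.commute)
    then obtain k where k: "T (v + w) = k *s (a *s T w + b *s T v)"
      using abs_proj_eq_iff T_val[OF nz(3)] by metis
    obtain a' b' where ab': "\<And>\<sigma> \<tau>. (\<sigma>, \<tau>) \<noteq> (0, 0) \<Longrightarrow> \<sigma> *s (a' *s T w) + \<tau> *s (b' *s T (v + e)) \<noteq> 0 \<and>
       g (abs_proj (\<sigma> *s w + \<tau> *s (v + e))) = abs_proj (\<sigma> *s (a' *s T w) + \<tau> *s (b' *s T (v + e)))"
      using pair[of "v + e" w "T (v + e)" "T w"] nz ve0 wve T_val by blast
    have "a' *s T w + b' *s T (v + e) \<noteq> 0" "abs_proj (T (v + w + e)) = abs_proj (a' *s T w + b' *s T (v + e))"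
      using ab'[of 1 1] T_val[OF vwe0] by (auto simp: ac_simps)
    then obtain k' where k': "T (v + w + e) = k' *s (a' *s T w + b' *s T (v + e))"
      using abs_proj_eq_iff T_val[OF vwe0] by metis
    have "(k * b - k' * b') *s T v + (k * a - k' * a') *s T w + (1 - k' * b') *s u0 = 0"
      using k k' unfolding Tvwe Tve by (simp add: vec_eq_iff algebra_simps)
    from T_ind[OF this] have "k * b = 1" by simp
    then have "T (v + w) = T v + (k * a) *s T w" using k by (simp add: vec_eq_iff algebra_simps)
    then show ?thesis by blast
  qed
  have add: "T (v + w) = T v + T w" for v w
  proof (cases "ind v \<and> (\<forall>c d. w \<noteq> c *s v + d *s e)")
    case True
    have iw: "ind w" unfolding ind_def using True by (metis vector_smult_lzero add_0)
    have vw: "v \<noteq> c *s w + d *s e" for c d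
    proof
      assume h: "v = c *s w + d *s e"
      show False
      proof (cases "c = 0")
        case True then show False using h \<open>ind v \<and> _\<close> unfolding ind_def by simp
      next
        case False
        then have "w = (1 / c) *s v + (- d / c) *s e" unfolding h by (simp add: vec_eq_iff field_simps)
        then show False using True by blast
      qed
    qed
    obtain b where b: "T (v + w) = T v + b *s T w" using half True by blast
    obtain b' where b': "T (w + v) = T w + b' *s T v" using half[OF iw vw] by blast
    have nz: "v \<noteq> 0" "w \<noteq> 0" using iw True ind_nz by auto
    have "abs_proj v \<noteq> abs_proj w" using abs_proj_eq_iff[OF nz] vw[of _ 0] by auto
    then have d: "abs_proj (T v) \<noteq> abs_proj (T w)" using T_val nz inj by metis
    have "(1 - b') *s T v + (b - 1) *s T w = 0"
      using b b' by (simp add: add.commute vec_eq_iff algebra_simps)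
    from independent_representatives[OF T_val[OF nz(2), THEN conjunct1] T_val[OF nz(1), THEN conjunct1] d this]
    have "b = 1" by simp
    then show ?thesis using b by simp
  next
    case False
    then consider k where "v = k *s e" | c d where "w = c *s v + d *s e" unfolding ind_def by blast
    then show ?thesis
    proof cases
      case 1
      then show ?thesis using Taff[of 1 w k] Te[of k] by (simp add: add.commute)
    next
      case 2
      have "v + w = (1 + c) *s v + d *s e" unfolding 2 by (simp add: vec_eq_iff algebra_simps)
      then have "T (v + w) = (1 + c) *s T v + d *s u0" by (simp only: Taff)
      moreover have "T w = c *s T v + d *s u0" unfolding 2 by (rule Taff)
      ultimately show ?thesis by (simp add: vec_eq_iff algebra_simps)
    qed
  qed
  have scale: "T (c *s v) = c *s T v" for c v using Taff[of c v 0] by simp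
  have "Vector_Spaces.linear (*s) (*s) T"
    by (simp add: Vector_Spaces.linear_iff vec.vector_space_axioms add scale)
  then have "matrix T *v v = T v" for v by (rule matrix_works)
  then show ?thesis using that[of "matrix T"] T_val by simp
qed

lemma aut_projective_space:
  fixes g h :: "'n::finite proj \<Rightarrow> 'n proj"
  assumes "vreg UNIV g" "vreg UNIV h" "\<And>p. h (g p) = p" "\<And>p. g (h p) = p"
  obtains M :: "complex^'n^'n" where "\<And>v. v \<noteq> 0 \<Longrightarrow> M *v v \<noteq> 0 \<and> g (abs_proj v) = abs_proj (M *v v)"
proof (rule collineation_linear[of g])
  show "g x = g y \<Longrightarrow> x = y" for x y by (metis assms(3))
  fix p q :: "complex^'n" assume pq: "p \<noteq> 0" "\<And>k. q \<noteq> k *s p"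
  show "\<exists>u w. \<forall>\<sigma> \<tau>. (\<sigma>, \<tau>) \<noteq> (0, 0) \<longrightarrow>
       \<sigma> *s u + \<tau> *s w \<noteq> 0 \<and> g (abs_proj (\<sigma> *s q + \<tau> *s p)) = abs_proj (\<sigma> *s u + \<tau> *s w)"
    by (rule aut_projective_line[OF assms pq]) blast
qed (use that in blast)

section \<open>The Segre-Veronese map of bidegree (2,2)\<close>

text \<open>The exponent of the second variable in the \<open>i\<close>-th monomial. In the type
  \<open>3\<close> the numeral 3 equals 0, so it cannot be read off from the index itself.\<close>

definition wt :: "3 \<Rightarrow> nat" where
  "wt i = (if i = 1 then 0 else if i = 2 then 1 else 2)"

definition mono2 :: "complex^2 \<Rightarrow> 3 \<Rightarrow> complex" where
  "mono2 x i = x $ 1 ^ (2 - wt i) * x $ 2 ^ wt i"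

definition segre :: "complex^2 \<Rightarrow> complex^2 \<Rightarrow> complex^(3 \<times> 3)" where
  "segre x y = (\<chi> I. mono2 x (fst I) * mono2 y (snd I))"

lemma mono2_simps: "mono2 x 1 = (x $ 1)\<^sup>2" "mono2 x 2 = x $ 1 * x $ 2" "mono2 x 3 = (x $ 2)\<^sup>2"
  by (simp_all add: mono2_def wt_def)

lemma sum_33: "(\<Sum>I\<in>UNIV. f I) = (\<Sum>i\<in>UNIV. \<Sum>j\<in>UNIV. f (i :: 'a::finite, j :: 'b::finite))"
  by (simp add: sum.cartesian_product)

text \<open>The Kronecker product.\<close>

definition tens :: "complex^3^3 \<Rightarrow> complex^3^3 \<Rightarrow> complex^(3 \<times> 3)^(3 \<times> 3)" where
  "tens A B = (\<chi> I K. A $ fst I $ fst K * B $ snd I $ snd K)"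

lemma tens_mult: "tens A B ** tens C D = tens (A ** C) (B ** D)"
  by (simp add: tens_def matrix_matrix_mult_def vec_eq_iff sum_33 sum_product mult_ac)

lemma tens_one: "tens (mat 1) (mat 1) = mat 1"
  by (auto simp: tens_def mat_def vec_eq_iff)

lemma tens_apply: "(tens A B *v z) $ (i, j) = (\<Sum>k\<in>UNIV. \<Sum>l\<in>UNIV. A $ i $ k * B $ j $ l * z $ (k, l))"
  by (simp add: tens_def matrix_vector_mult_def sum_33)

text \<open>The second symmetric power in the basis x1^2, x1 x2, x2^2. The factors 2 sit in the
  column of the mixed monomial.\<close>

definition sym2 :: "complex^2^2 \<Rightarrow> complex^3^3" where
  "sym2 A = (\<chi> i k. if i = 1 then (if k = 1 then (A$1$1)\<^sup>2 else if k = 2 then 2 * A$1$1 * A$1$2 else (A$1$2)\<^sup>2)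
     else if i = 2 then (if k = 1 then A$1$1 * A$2$1 else if k = 2 then A$1$1 * A$2$2 + A$1$2 * A$2$1 else A$1$2 * A$2$2)
     else (if k = 1 then (A$2$1)\<^sup>2 else if k = 2 then 2 * A$2$1 * A$2$2 else (A$2$2)\<^sup>2))"

lemma sym2_simps:
  "sym2 A $ 1 $ 1 = (A$1$1)\<^sup>2" "sym2 A $ 1 $ 2 = 2 * A$1$1 * A$1$2" "sym2 A $ 1 $ 3 = (A$1$2)\<^sup>2"
  "sym2 A $ 2 $ 1 = A$1$1 * A$2$1" "sym2 A $ 2 $ 2 = A$1$1 * A$2$2 + A$1$2 * A$2$1" "sym2 A $ 2 $ 3 = A$1$2 * A$2$2"
  "sym2 A $ 3 $ 1 = (A$2$1)\<^sup>2" "sym2 A $ 3 $ 2 = 2 * A$2$1 * A$2$2" "sym2 A $ 3 $ 3 = (A$2$2)\<^sup>2"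
  by (simp_all add: sym2_def)

lemma mono2_apply: "mono2 (A *v x) i = (\<Sum>k\<in>UNIV. sym2 A $ i $ k * mono2 x k)"
proof -
  have "\<forall>i. mono2 (A *v x) i = (\<Sum>k\<in>UNIV. sym2 A $ i $ k * mono2 x k)"
    unfolding forall_3 sum_3 sym2_simps mono2_simps
    by (simp add: matrix_vector_mult_def sum_2 power2_eq_square algebra_simps)
  then show ?thesis by blast
qed

lemma segre_apply: "segre (A *v x) (B *v y) = tens (sym2 A) (sym2 B) *v segre x y"
  by (simp add: vec_eq_iff segre_def tens_apply mono2_apply sum_product split_paired_all mult_ac)

lemma sym2_mult: "sym2 A ** sym2 B = sym2 (A ** B)"
  unfolding vec_eq_iff forall_3
  by (simp add: matrix_matrix_mult_def sum_3 sum_2 sym2_simps power2_eq_square algebra_simps)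

lemma sym2_one: "sym2 (mat 1) = mat 1"
  unfolding vec_eq_iff forall_3 by (simp add: sym2_simps mat_def)

lemma segre_scale: "segre (a *s x) (b *s y) = (a\<^sup>2 * b\<^sup>2) *s segre x y"
proof -
  have "\<forall>i. mono2 (a *s x) i = a\<^sup>2 * mono2 x i" for a x
    unfolding forall_3 mono2_simps by (simp add: power2_eq_square)
  then show ?thesis by (simp add: vec_eq_iff segre_def mult_ac)
qed

lemma mono2_nonzero: assumes "x \<noteq> 0" obtains i where "mono2 x i \<noteq> 0"
proof -
  have "x $ 1 \<noteq> 0 \<or> x $ 2 \<noteq> 0" using assms by (auto simp: vec_eq_iff forall_2)
  then show ?thesis using that[of 1] that[of 3] by (auto simp: mono2_simps)
qed

lemma segre_nonzero: assumes "x \<noteq> 0" "y \<noteq> 0" shows "segre x y \<noteq> 0"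
proof -
  obtain i j where "mono2 x i \<noteq> 0" "mono2 y j \<noteq> 0" using mono2_nonzero assms by metis
  then have "segre x y $ (i, j) \<noteq> 0" by (simp add: segre_def)
  then show ?thesis by (metis zero_index)
qed

definition swap33 :: "complex^(3 \<times> 3)^(3 \<times> 3)" where
  "swap33 = (\<chi> I K. if I = prod.swap K then 1 else 0)"

lemma swap33_apply: "(swap33 *v z) $ I = z $ prod.swap I"
proof -
  have "I = prod.swap K \<longleftrightarrow> K = prod.swap I" for K by (cases I; cases K) auto
  then have "(swap33 *v z) $ I = (\<Sum>K\<in>UNIV. (if K = prod.swap I then 1 else 0) * z $ K)"
    by (simp add: swap33_def matrix_vector_mult_def)
  also have "\<dots> = (\<Sum>K\<in>UNIV. if K = prod.swap I then z $ K else 0)" by (intro sum.cong) auto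
  finally have "(swap33 *v z) $ I = (\<Sum>K\<in>UNIV. if K = prod.swap I then z $ K else 0)" .
  then show ?thesis by simp
qed

lemma swap33_segre: "swap33 *v segre x y = segre y x"
  by (simp add: vec_eq_iff swap33_apply) (simp add: segre_def)

lemma matrix_eqI: "(\<And>x. A *v x = B *v x) \<Longrightarrow> A = (B :: complex^'n^'m)"
  by (simp add: matrix_eq)

lemma swap33_swap33: "swap33 ** swap33 = mat 1"
  by (rule matrix_eqI) (simp add: matrix_vector_mul_assoc[symmetric] vec_eq_iff swap33_apply)

section \<open>The invariant quadratic form\<close>

text \<open>The tensor square of the discriminant form on binary quadratic forms. Up to scalars it is the only quadratic form that
  is semi-invariant under both factors \<open>SL\<^sub>2\<close>, and it vanishes on the image of \<open>segre\<close>.\<close>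

definition qform :: "complex^(3 \<times> 3) \<Rightarrow> complex" where
  "qform z = z $ (1,1) * z $ (3,3) + z $ (1,3) * z $ (3,1) - 2 * z $ (1,2) * z $ (3,2) - 2 * z $ (2,1) * z $ (2,3)
     + 2 * (z $ (2,2))\<^sup>2"

lemma qform_segre: "qform (segre x y) = 0"
  by (simp add: qform_def segre_def mono2_simps power2_eq_square algebra_simps)

lemma qform_swap33: "qform (swap33 *v z) = qform z"
  by (simp add: qform_def swap33_apply mult_ac)

lemma qform_tens_left: "qform (tens (sym2 A) (mat 1) *v z) = (det A)\<^sup>2 * qform z"
proof -
  have e: "(tens (sym2 A) (mat 1) *v z) $ (i, j) = (\<Sum>k\<in>UNIV. sym2 A $ i $ k * z $ (k, j))" for i j
    unfolding tens_apply
    by (simp add: mat_def if_distrib[of "\<lambda>x. _ * x"] if_distrib[of "\<lambda>x. x * _"] cong: if_cong)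
  show ?thesis
    unfolding qform_def e sum_3 sym2_simps det_2 by algebra
qed

text \<open>\<open>swap33\<close> preserves \<open>qform\<close> and conjugates the action on the
  second factor into that on the first.\<close>

lemma qform_tens: "qform (tens (sym2 A) (sym2 B) *v z) = (det A * det B)\<^sup>2 * qform z"
proof -
  have "tens (mat 1) (sym2 B) = swap33 ** tens (sym2 B) (mat 1) ** swap33"
  proof (rule matrix_eqI)
    fix z
    have "(tens (mat 1) (sym2 B) *v z) $ (i, j) = (swap33 ** tens (sym2 B) (mat 1) ** swap33 *v z) $ (i, j)" for i j
      unfolding matrix_vector_mul_assoc[symmetric] swap33_apply swap_simp tens_apply
      by (subst sum.swap) (simp add: mult.commute swap33_apply)
    then show "tens (mat 1) (sym2 B) *v z = swap33 ** tens (sym2 B) (mat 1) ** swap33 *v z"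
      by (simp add: vec_eq_iff)
  qed
  then have "qform (tens (mat 1) (sym2 B) *v z) = (det B)\<^sup>2 * qform z" for z
    by (simp add: matrix_vector_mul_assoc[symmetric] qform_swap33 qform_tens_left)
  moreover have "tens (sym2 A) (sym2 B) = tens (sym2 A) (mat 1) ** tens (mat 1) (sym2 B)"
    by (simp add: tens_mult)
  ultimately show ?thesis
    by (simp add: matrix_vector_mul_assoc[symmetric] qform_tens_left power_mult_distrib)
qed

section \<open>A projective frame on the surface\<close>

text \<open>Inverses are carried as explicit partners because the matrices between the index types
  \<open>3 \<times> 3\<close> and \<open>9\<close> are square only in size, not in type.\<close>

definition inverse_pair :: "complex^'n^'m \<Rightarrow> complex^'m^'n \<Rightarrow> bool" where
  "inverse_pair N N' \<longleftrightarrow> N' ** N = mat 1 \<and> N ** N' = mat 1"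

lemma inverse_pair_sym: "inverse_pair N N' \<Longrightarrow> inverse_pair N' N"
  by (simp add: inverse_pair_def)

lemma inverse_pair_one: "inverse_pair (mat 1) (mat 1)"
  by (simp add: inverse_pair_def)

lemma inverse_pair_apply:
  assumes "inverse_pair N N'" shows "N' *v (N *v x) = x" "N *v (N' *v y) = y"
  using assms by (simp_all add: inverse_pair_def matrix_vector_mul_assoc)

lemma inverse_pair_nonzero: "inverse_pair N N' \<Longrightarrow> x \<noteq> 0 \<Longrightarrow> N *v x \<noteq> 0"
  using inverse_pair_apply(1)[of N N' x] by force

lemma inverse_pair_mult:
  assumes "inverse_pair N N'" "inverse_pair M M'" shows "inverse_pair (N ** M) (M' ** N')"
proof -
  have "M' ** N' ** (N ** M) = M' ** (N' ** N) ** M" "N ** M ** (M' ** N') = N ** (M ** M') ** N'"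
    by (simp_all only: matrix_mul_assoc)
  then show ?thesis using assms by (simp add: inverse_pair_def)
qed

lemma inverse_pair_swap33: "inverse_pair swap33 swap33"
  by (simp add: inverse_pair_def swap33_swap33)

lemma inverse_pair_tens:
  assumes "inverse_pair A A'" "inverse_pair B B'"
  shows "inverse_pair (tens (sym2 A) (sym2 B)) (tens (sym2 A') (sym2 B'))"
  using assms by (simp add: inverse_pair_def tens_mult sym2_mult sym2_one tens_one)

definition frame_pt :: "3 \<Rightarrow> complex^2" where
  "frame_pt i = (if i = 1 then vector [1, 0] else if i = 2 then vector [1, 1] else vector [0, 1])"

text \<open>The quadratic monomials at \<open>star_pt\<close> expand as (1, -1, 1) = 2 (1, 0, 0) -
  (1, 1, 1) + 2 (0, 0, 1) in those at the three frame points. No coefficient vanishes, so the points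
  are in general position.\<close>

definition frame_coeff :: "3 \<Rightarrow> complex" where
  "frame_coeff i = (if i = 2 then -1 else 2)"

definition star_pt :: "complex^2" where "star_pt = vector [1, -1]"

definition frame :: "complex^(3 \<times> 3)^(3 \<times> 3)" where
  "frame = (\<chi> I K. segre (frame_pt (fst K)) (frame_pt (snd K)) $ I)"

definition frame_vec :: "complex^(3 \<times> 3)" where
  "frame_vec = (\<chi> I. frame_coeff (fst I) * frame_coeff (snd I))"

definition frame_inv :: "complex^(3 \<times> 3)^(3 \<times> 3)" where
  "frame_inv = (let n = (\<chi> i k. if i = k then 1 else if k = 2 then -1 else 0) in tens n n)"

lemma frame_pt_nonzero: "frame_pt i \<noteq> 0" "star_pt \<noteq> 0"
  by (auto simp: frame_pt_def star_pt_def vec_eq_iff forall_2)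

lemma frame_vec_nonzero: "frame_vec $ I \<noteq> 0"
  by (simp add: frame_vec_def frame_coeff_def)

lemma matrix_axis: "(A :: complex^'n^'m) *v axis k 1 = (\<chi> i. A $ i $ k)"
  by (simp add: matrix_vector_mult_def axis_def vec_eq_iff if_distrib[of "\<lambda>x. _ * x"] cong: if_cong)

lemma frame_axis: "frame *v axis K 1 = segre (frame_pt (fst K)) (frame_pt (snd K))"
  unfolding matrix_axis by (simp add: frame_def vec_eq_iff)

lemma frame_inverse: "inverse_pair frame frame_inv"
proof -
  define m :: "complex^3^3" where "m = (\<chi> i k. mono2 (frame_pt k) i)"
  define n :: "complex^3^3" where "n = (\<chi> i k. if i = k then 1 else if k = 2 then -1 else 0)"
  have fm: "frame = tens m m" by (simp add: frame_def tens_def segre_def m_def)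
  have fn: "frame_inv = tens n n" by (simp only: frame_inv_def n_def Let_def)
  have mn: "m ** n = mat 1" "n ** m = mat 1"
    unfolding vec_eq_iff forall_3
    by (simp_all add: matrix_matrix_mult_def sum_3 m_def n_def mat_def mono2_simps frame_pt_def)
  show ?thesis unfolding inverse_pair_def fm fn tens_mult mn tens_one by simp
qed

lemma frame_star: "frame *v frame_vec = segre star_pt star_pt"
proof -
  have "mono2 star_pt i = (\<Sum>k\<in>UNIV. mono2 (frame_pt k) i * frame_coeff k)" for i
  proof -
    have "\<forall>i. mono2 star_pt i = (\<Sum>k\<in>UNIV. mono2 (frame_pt k) i * frame_coeff k)"
      unfolding forall_3 sum_3 by (simp add: mono2_simps star_pt_def frame_pt_def frame_coeff_def)
    then show ?thesis by blast
  qed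
  then show ?thesis
    by (simp add: vec_eq_iff frame_def frame_vec_def segre_def matrix_vector_mult_def sum_33 sum_product mult_ac)
qed

text \<open>The hypotheses make \<open>K\<close> diagonal in the basis \<open>frame\<close>, with an
  eigenvector all of whose coordinates are nonzero; so the diagonal is constant.\<close>

lemma frame_rigid:
  assumes "\<And>I. K *v (frame *v axis I 1) = k I *s (frame *v axis I 1)"
    and "K *v (frame *v frame_vec) = k' *s (frame *v frame_vec)"
  shows "K *v z = k' *s z"
proof -
  define D where "D = frame_inv ** K ** frame"
  have D: "D *v axis I 1 = k I *s axis I 1" for I
    unfolding D_def matrix_vector_mul_assoc[symmetric] assms(1)
    by (simp add: vector_scalar_commute inverse_pair_apply[OF frame_inverse])
  have ent: "D $ I $ J = (if I = J then k J else 0)" for I J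
    using arg_cong[OF D[of J], of "\<lambda>v. v $ I"] unfolding matrix_axis by (simp add: axis_def)
  have "D *v frame_vec = k' *s frame_vec"
    unfolding D_def matrix_vector_mul_assoc[symmetric] assms(2)
    by (simp add: vector_scalar_commute inverse_pair_apply[OF frame_inverse])
  then have "(D *v frame_vec) $ I = k' * frame_vec $ I" for I by simp
  then have "k I * frame_vec $ I = k' * frame_vec $ I" for I
    by (simp add: matrix_vector_mult_def ent if_distrib[of "\<lambda>x. x * _"] cong: if_cong)
  then have "k I = k'" for I using frame_vec_nonzero by simp
  then have Dz: "D *v w = k' *s w" for w
    by (simp add: vec_eq_iff matrix_vector_mult_def ent if_distrib[of "\<lambda>x. x * _"] cong: if_cong)
  have "K *v z = frame *v (D *v (frame_inv *v z))"
    unfolding D_def matrix_vector_mul_assoc[symmetric]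
    by (simp add: inverse_pair_apply[OF frame_inverse])
  then show ?thesis unfolding Dz by (simp add: vector_scalar_commute inverse_pair_apply[OF frame_inverse])
qed

text \<open>The nine grid points together with the image of \<open>(star_pt, star_pt)\<close> form a
  projective frame of P^8 lying on the surface. A projective linear map is therefore known from its
  restriction to the surface.\<close>

lemma segre_determines:
  assumes N: "inverse_pair N N'"
    and eq: "\<And>x y. x \<noteq> 0 \<Longrightarrow> y \<noteq> 0 \<Longrightarrow> \<exists>c. M *v segre x y = c *s (N *v segre x y)"
  obtains k where "\<And>z. M *v z = k *s (N *v z)"
proof -
  have ex: "\<exists>c. (N' ** M) *v segre x y = c *s segre x y" if h: "x \<noteq> 0" "y \<noteq> 0" for x y
  proof -
    obtain c where "M *v segre x y = c *s (N *v segre x y)" using eq[OF h] by blast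
    then have "(N' ** M) *v segre x y = c *s segre x y"
      by (simp add: matrix_vector_mul_assoc[symmetric] vector_scalar_commute inverse_pair_apply[OF N])
    then show ?thesis by blast
  qed
  have "\<exists>c. (N' ** M) *v (frame *v axis I 1) = c *s (frame *v axis I 1)" for I
    unfolding frame_axis by (rule ex) (rule frame_pt_nonzero)+
  then obtain c where "\<And>I. (N' ** M) *v (frame *v axis I 1) = c I *s (frame *v axis I 1)" by metis
  moreover obtain k where "(N' ** M) *v (frame *v frame_vec) = k *s (frame *v frame_vec)"
    unfolding frame_star using ex frame_pt_nonzero by blast
  ultimately have k: "(N' ** M) *v z = k *s z" for z by (rule frame_rigid)
  have "M *v z = N *v ((N' ** M) *v z)" for z
    by (simp add: matrix_vector_mul_assoc[symmetric] inverse_pair_apply[OF N])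
  then have "M *v z = k *s (N *v z)" for z unfolding k by (metis vector_scalar_commute)
  then show ?thesis by (rule that)
qed

section \<open>Linear forms and forms of bidegree (2,2)\<close>

text \<open>The coefficient of the exponent \<open>m\<close> is written as the sum of
  \<open>a k * m k\<close>, which picks out \<open>a k\<close> when \<open>m\<close> is the
  indicator of \<open>k\<close>; the indexing of exponents need not be inverted.\<close>

lemma form_linear: "form 1 (\<lambda>v::complex^'n. \<Sum>k\<in>UNIV. a k * v $ k)"
  unfolding form_def
proof (intro exI allI)
  fix v :: "complex^'n"
  let ?d = "\<lambda>k i. if i = k then 1 else (0::nat)"
  have inj: "inj ?d"
  proof (rule injI)
    fix k k' assume "?d k = ?d k'"
    then have "?d k k = ?d k' k" by metis
    then show "k = k'" by (simp split: if_splits)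
  qed
  have "{m :: 'n \<Rightarrow> nat. sum m UNIV = 1} = range ?d"
  proof
    show "{m :: 'n \<Rightarrow> nat. sum m UNIV = 1} \<subseteq> range ?d"
    proof
      fix m :: "'n \<Rightarrow> nat" assume "m \<in> {m. sum m UNIV = 1}"
      then have "sum m UNIV = 1" by simp
      then have "\<exists>k. m k = 1 \<and> (\<forall>i. k \<noteq> i \<longrightarrow> m i = 0)"
        using sum_eq_1_iff[of "UNIV :: 'n set" m] by simp
      then obtain k where "m k = 1" "\<And>i. k \<noteq> i \<Longrightarrow> m i = 0" by metis
      then have "m = ?d k" by (auto simp: fun_eq_iff)
      then show "m \<in> range ?d" by blast
    qed
  qed auto
  then have "(\<Sum>m | sum m UNIV = 1. (\<Sum>k\<in>UNIV. a k * of_nat (m k)) * (\<Prod>i\<in>UNIV. (v $ i) ^ m i)) =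
     (\<Sum>k\<in>UNIV. (\<Sum>k'\<in>UNIV. a k' * of_nat (?d k k')) * (\<Prod>i\<in>UNIV. (v $ i) ^ ?d k i))"
    by (simp only: sum.reindex[OF inj] comp_def)
  also have "\<dots> = (\<Sum>k\<in>UNIV. a k * v $ k)"
    by (intro sum.cong refl)
      (simp add: if_distrib[of of_nat] if_distrib[of "\<lambda>x. _ * x"] if_distrib[of "\<lambda>n. _ ^ n"] cong: if_cong)
  finally show "(\<Sum>k\<in>UNIV. a k * v $ k) =
      (\<Sum>m | sum m UNIV = 1. (\<Sum>k\<in>UNIV. a k * of_nat (m k)) * (\<Prod>i\<in>UNIV. (v $ i) ^ m i))" by simp
qed

lemma exponents_2:
  "{m :: 2 \<Rightarrow> nat. sum m UNIV = 2} = range (\<lambda>i l. if l = 1 then 2 - wt i else wt i)"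
  "inj (\<lambda>i (l::2). if l = 1 then 2 - wt i else wt i)"
  "(\<Prod>l\<in>UNIV. (x $ l) ^ (if l = 1 then 2 - wt i else wt i)) = mono2 x i"
proof -
  let ?d = "\<lambda>i (l::2). if l = 1 then 2 - wt i else wt i"
  show "{m :: 2 \<Rightarrow> nat. sum m UNIV = 2} = range ?d"
  proof
    show "{m :: 2 \<Rightarrow> nat. sum m UNIV = 2} \<subseteq> range ?d"
    proof
      fix m :: "2 \<Rightarrow> nat" assume "m \<in> {m. sum m UNIV = 2}"
      then have s: "m 1 + m 2 = 2" by (simp add: sum_2)
      then consider "m 2 = 0" | "m 2 = 1" | "m 2 = 2" by linarith
      then obtain i where "wt i = m 2" by cases (auto simp: wt_def intro: that[of 1] that[of 2] that[of 3])
      then have "m = ?d i" using s by (auto simp: fun_eq_iff forall_2)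
      then show "m \<in> range ?d" by blast
    qed
    show "range ?d \<subseteq> {m :: 2 \<Rightarrow> nat. sum m UNIV = 2}"
      by (auto simp: sum_2 wt_def)
  qed
  show "inj ?d"
  proof (rule injI)
    fix i j assume "?d i = ?d j"
    then have "?d i 2 = ?d j 2" by metis
    then show "i = j" using exhaust_3[of i] exhaust_3[of j] by (auto simp: wt_def)
  qed
  have "(\<Prod>l\<in>UNIV. f l) = f 1 * f 2" for f :: "2 \<Rightarrow> complex"
    unfolding UNIV_2 by simp
  then show "(\<Prod>l\<in>UNIV. (x $ l) ^ ?d i l) = mono2 x i" by (simp add: mono2_def)
qed

lemma biform22_iff: "biform 2 2 P \<longleftrightarrow> (\<exists>a. \<forall>x y. P x y = (\<Sum>I\<in>UNIV. a $ I * segre x y $ I))"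
proof -
  let ?d = "\<lambda>i (l::2). if l = 1 then 2 - wt i else wt i"
  have ex: "(\<Sum>m | sum m UNIV = 2. \<Sum>n | sum n UNIV = 2.
        c m n * (\<Prod>i\<in>UNIV. (x $ i) ^ m i) * (\<Prod>j\<in>UNIV. (y $ j) ^ n j)) =
      (\<Sum>i\<in>UNIV. \<Sum>j\<in>UNIV. c (?d i) (?d j) * mono2 x i * mono2 y j)" for c and x y :: "complex^2"
    by (simp only: exponents_2(1) sum.reindex[OF exponents_2(2)] comp_def exponents_2(3))
  show ?thesis
  proof
    assume "biform 2 2 P"
    then obtain c where "\<And>x y. P x y = (\<Sum>i\<in>UNIV. \<Sum>j\<in>UNIV. c (?d i) (?d j) * mono2 x i * mono2 y j)"
      unfolding biform_def ex by blast
    then have "P x y = (\<Sum>I\<in>UNIV. (\<chi> I. case I of (i, j) \<Rightarrow> c (?d i) (?d j)) $ I * segre x y $ I)" for x y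
      by (simp add: sum_33 segre_def mult.assoc)
    then show "\<exists>a. \<forall>x y. P x y = (\<Sum>I\<in>UNIV. a $ I * segre x y $ I)" by blast
  next
    assume "\<exists>a. \<forall>x y. P x y = (\<Sum>I\<in>UNIV. a $ I * segre x y $ I)"
    then obtain a where a: "\<And>x y. P x y = (\<Sum>I\<in>UNIV. a $ I * segre x y $ I)" by blast
    define c where "c m n = a $ (inv ?d m, inv ?d n)" for m n
    have "inv ?d (?d i) = i" for i by (rule inv_f_f[OF exponents_2(2)])
    then have "P x y = (\<Sum>i\<in>UNIV. \<Sum>j\<in>UNIV. c (?d i) (?d j) * mono2 x i * mono2 y j)" for x y
      unfolding a sum_33 by (simp add: c_def segre_def mult.assoc)
    then show "biform 2 2 P" unfolding biform_def ex by blast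
  qed
qed

text \<open>Evaluation at the nine grid points is the invertible matrix
  \<open>frame\<close>.\<close>

lemma segre_independent:
  assumes "\<And>x y. (\<Sum>I\<in>UNIV. a $ I * segre x y $ I) = (\<Sum>I\<in>UNIV. b $ I * segre x y $ I)"
  shows "a = b"
proof -
  have "a v* frame = b v* frame"
  proof (rule vec_eq_iff[THEN iffD2], rule allI)
    fix K
    show "(a v* frame) $ K = (b v* frame) $ K"
      using assms[of "frame_pt (fst K)" "frame_pt (snd K)"]
      by (simp add: vector_matrix_mult_def frame_def mult.commute)
  qed
  then have "a v* (frame ** frame_inv) = b v* (frame ** frame_inv)"
    by (simp add: vector_matrix_mul_assoc[symmetric])
  then show ?thesis using frame_inverse by (simp add: inverse_pair_def)
qed

text \<open>The entries of \<open>segre\<close> are the monomial basis, so any other basis arises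
  from it by an invertible change of basis.\<close>

lemma bidegree22_basis_iff:
  "bidegree22_basis F \<longleftrightarrow> (\<exists>N N'. inverse_pair N N' \<and> (\<forall>x y. F x y = N *v segre x y))"
proof
  assume F: "bidegree22_basis F"
  have "\<exists>a. \<forall>x y. F x y $ k = (\<Sum>I\<in>UNIV. a $ I * segre x y $ I)" for k
    using F unfolding bidegree22_basis_def biform22_iff by blast
  then obtain a where a: "\<And>k x y. F x y $ k = (\<Sum>I\<in>UNIV. a k $ I * segre x y $ I)" by metis
  define N where "N = (\<chi> k. a k)"
  have FN: "F x y = N *v segre x y" for x y
    by (simp add: vec_eq_iff a N_def matrix_vector_mult_def)
  have "biform 2 2 (\<lambda>x y. segre x y $ I)" for I
    unfolding biform22_iff by (rule exI[of _ "axis I 1"]) (simp add: axis_def if_distrib[of "\<lambda>x. x * _"] cong: if_cong)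
  then have "\<exists>c. \<forall>x y. segre x y $ I = (\<Sum>k\<in>UNIV. c $ k * F x y $ k)" for I
    using F unfolding bidegree22_basis_def by blast
  then obtain c where c: "\<And>I x y. segre x y $ I = (\<Sum>k\<in>UNIV. c I $ k * F x y $ k)" by metis
  define N' where "N' = (\<chi> I. c I)"
  have SN: "segre x y = N' *v F x y" for x y
    by (simp add: vec_eq_iff c[of x y] N'_def matrix_vector_mult_def)
  have "(N' ** N) $ I = mat 1 $ I" for I
  proof (rule segre_independent)
    fix x y
    have "((N' ** N) *v segre x y) $ I = segre x y $ I"
      using SN[of x y] FN[of x y] by (simp add: matrix_vector_mul_assoc[symmetric])
    also have "\<dots> = ((mat 1 :: complex^(3 \<times> 3)^(3 \<times> 3)) *v segre x y) $ I" by simp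
    finally show "(\<Sum>J\<in>UNIV. (N' ** N) $ I $ J * segre x y $ J) = (\<Sum>J\<in>UNIV. mat 1 $ I $ J * segre x y $ J)"
      by (simp add: matrix_vector_mult_def)
  qed
  then have 1: "N' ** N = mat 1" by (simp add: vec_eq_iff)
  \<comment> \<open>Row \<open>k\<close> of the product and the \<open>k\<close>-th unit row both
    expand the \<open>k\<close>-th entry of \<open>F\<close> in the entries of \<open>F\<close>;
    uniqueness of the expansion identifies them.\<close>
  have "(N ** N') $ k = mat 1 $ k" for k
  proof -
    have "biform 2 2 (\<lambda>x y. F x y $ k)" using F unfolding bidegree22_basis_def by blast
    then have "\<exists>!d :: complex^9. \<forall>x y. F x y $ k = (\<Sum>j\<in>UNIV. d $ j * F x y $ j)"
      using F unfolding bidegree22_basis_def by blast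
    moreover have "F x y $ k = (\<Sum>j\<in>UNIV. (N ** N') $ k $ j * F x y $ j)" for x y
    proof -
      have "F x y = (N ** N') *v F x y" using FN[of x y] SN[of x y] by (simp add: matrix_vector_mul_assoc[symmetric])
      then have "F x y $ k = ((N ** N') *v F x y) $ k" by simp
      then show ?thesis by (simp add: matrix_vector_mult_def)
    qed
    moreover have "F x y $ k = (\<Sum>j\<in>UNIV. mat 1 $ k $ j * F x y $ j)" for x y
      by (simp add: mat_def if_distrib[of "\<lambda>x. x * _"] cong: if_cong)
    ultimately show ?thesis by blast
  qed
  then have "N ** N' = mat 1" by (simp add: vec_eq_iff)
  then show "\<exists>N N'. inverse_pair N N' \<and> (\<forall>x y. F x y = N *v segre x y)"
    using 1 FN unfolding inverse_pair_def by blast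
next
  assume "\<exists>N N'. inverse_pair N N' \<and> (\<forall>x y. F x y = N *v segre x y)"
  then obtain N N' where N: "inverse_pair N N'" and F: "\<And>x y. F x y = N *v segre x y" by blast
  have "biform 2 2 (\<lambda>x y. F x y $ k)" for k
    unfolding biform22_iff F by (rule exI[of _ "N $ k"]) (simp add: matrix_vector_mult_def)
  moreover have "\<exists>!c. \<forall>x y. G x y = (\<Sum>k\<in>UNIV. c $ k * F x y $ k)" if bf: "biform 2 2 G" for G
  proof -
    obtain a where a: "\<And>x y. G x y = (\<Sum>I\<in>UNIV. a $ I * segre x y $ I)" using bf unfolding biform22_iff by blast
    have s: "(\<Sum>k\<in>UNIV. c $ k * F x y $ k) = (\<Sum>I\<in>UNIV. (c v* N) $ I * segre x y $ I)" for c x y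
    proof -
      have "(\<Sum>k\<in>UNIV. c $ k * F x y $ k) = (\<Sum>k\<in>UNIV. \<Sum>I\<in>UNIV. c $ k * N $ k $ I * segre x y $ I)"
        by (simp add: F matrix_vector_mult_def sum_distrib_left mult.assoc)
      also have "\<dots> = (\<Sum>I\<in>UNIV. \<Sum>k\<in>UNIV. c $ k * N $ k $ I * segre x y $ I)" by (rule sum.swap)
      finally show ?thesis by (simp add: vector_matrix_mult_def sum_distrib_left mult_ac)
    qed
    have "(a v* N') v* N = a" "(c v* N) v* N' = c" for c
      using N by (simp_all add: vector_matrix_mul_assoc inverse_pair_def)
    note inv = this
    show ?thesis
    proof (rule ex1I)
      show "\<forall>x y. G x y = (\<Sum>k\<in>UNIV. (a v* N') $ k * F x y $ k)" unfolding s inv a by simp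
      fix c assume c: "\<forall>x y. G x y = (\<Sum>k\<in>UNIV. c $ k * F x y $ k)"
      have "a = c v* N"
      proof (rule segre_independent)
        fix x y
        show "(\<Sum>I\<in>UNIV. a $ I * segre x y $ I) = (\<Sum>I\<in>UNIV. (c v* N) $ I * segre x y $ I)"
          using c a[of x y] s[of c x y] by simp
      qed
      then show "c = a v* N'" using inv by simp
    qed
  qed
  ultimately show "bidegree22_basis F" unfolding bidegree22_basis_def by blast
qed

section \<open>Projective linear maps\<close>

definition pmap :: "complex^'n^'m \<Rightarrow> 'n::finite proj \<Rightarrow> 'm::finite proj" where
  "pmap M p = abs_proj (M *v (SOME v. v \<noteq> 0 \<and> abs_proj v = p))"

lemma pmap_abs:
  assumes "v \<noteq> 0" "M *v v \<noteq> 0"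
  shows "pmap M (abs_proj v) = abs_proj (M *v v)"
proof -
  let ?w = "SOME w. w \<noteq> 0 \<and> abs_proj w = abs_proj v"
  have w: "?w \<noteq> 0 \<and> abs_proj ?w = abs_proj v" by (rule someI[of _ v]) (use assms in simp)
  then obtain c where c: "?w = c *s v" using abs_proj_eq_iff assms(1) by blast
  have "c \<noteq> 0" using w unfolding c by auto
  have "M *v ?w = c *s (M *v v)" unfolding c by (rule vector_scalar_commute)
  then show ?thesis unfolding pmap_def using abs_proj_scale[OF \<open>c \<noteq> 0\<close> assms(2)] by simp
qed

definition vcnj :: "complex^'n \<Rightarrow> complex^'n" where "vcnj v = (\<chi> i. cnj (v $ i))"

definition mcnj :: "complex^'n^'m \<Rightarrow> complex^'n^'m" where "mcnj M = (\<chi> i j. cnj (M $ i $ j))"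

lemma vcnj_simps [simp]: "vcnj (vcnj v) = v" "vcnj v = 0 \<longleftrightarrow> v = 0" "vcnj v $ i = cnj (v $ i)"
  by (auto simp: vcnj_def vec_eq_iff)

lemma vcnj_mult: "vcnj (M *v v) = mcnj M *v vcnj v"
  by (simp add: vcnj_def mcnj_def vec_eq_iff matrix_vector_mult_def)

lemma mcnj_mult: "mcnj (M ** N) = mcnj M ** mcnj N"
  by (simp add: mcnj_def vec_eq_iff matrix_matrix_mult_def)

lemma mcnj_one: "mcnj (mat 1) = mat 1"
  by (simp add: mcnj_def mat_def vec_eq_iff)

lemma inverse_pair_mcnj: "inverse_pair N N' \<Longrightarrow> inverse_pair (mcnj N) (mcnj N')"
  by (auto simp: inverse_pair_def mcnj_mult[symmetric] mcnj_one)

lemma cnj_proj_vcnj: "v \<noteq> 0 \<Longrightarrow> cnj_proj (abs_proj v) = abs_proj (vcnj v)"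
  by (simp add: cnj_proj_abs vcnj_def)

lemma vcnj_segre: "vcnj (segre x y) = segre (vcnj x) (vcnj y)"
  by (simp add: vec_eq_iff segre_def mono2_def)

text \<open>Reality is asked of points rather than of vectors, because the matrices to which this is
  applied may commute with conjugation only up to a scalar.\<close>

lemma aut_pmap:
  fixes M :: "complex^'n^'n"
  assumes M: "inverse_pair M M'"
    and V: "\<And>v. v \<noteq> 0 \<Longrightarrow> abs_proj v \<in> V \<longleftrightarrow> abs_proj (M *v v) \<in> V"
    and real: "\<And>v. v \<noteq> 0 \<Longrightarrow> abs_proj v \<in> V \<Longrightarrow> abs_proj (M *v vcnj v) = abs_proj (vcnj (M *v v))"
    and cV: "\<And>p. p \<in> V \<Longrightarrow> cnj_proj p \<in> V"
  shows "restrict (pmap M) V \<in> aut V"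
proof -
  note nz = inverse_pair_nonzero[OF M] inverse_pair_nonzero[OF inverse_pair_sym[OF M]]
  note ap = inverse_pair_apply[OF M]
  have val: "pmap M (abs_proj v) = abs_proj (M *v v)" "pmap M' (abs_proj v) = abs_proj (M' *v v)"
    if "v \<noteq> 0" for v using pmap_abs nz that by blast+
  have inv: "pmap M' (pmap M p) = p" "pmap M (pmap M' p) = p" for p
  proof -
    obtain v where v: "v \<noteq> 0" "p = abs_proj v" by (rule proj_cases)
    show "pmap M' (pmap M p) = p" "pmap M (pmap M' p) = p"
      using v nz val ap by simp_all
  qed
  have mem: "p \<in> V \<longleftrightarrow> pmap M p \<in> V" for p
  proof -
    obtain v where v: "v \<noteq> 0" "p = abs_proj v" by (rule proj_cases)
    then show ?thesis using V val by simp
  qed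
  have mem': "pmap M' p \<in> V" if "p \<in> V" for p using mem[of "pmap M' p"] inv that by simp
  have bij: "bij_betw (restrict (pmap M) V) V V"
    by (rule bij_betw_byWitness[where f' = "pmap M'"]) (use inv mem mem' in \<open>auto simp: image_subset_iff\<close>)
  have reg: "regular_on V f" if eq: "\<And>p. p \<in> V \<Longrightarrow> f p = pmap A p" and A: "inverse_pair A A'" for f and A A' :: "complex^'n^'n"
    unfolding regular_on_def
  proof (intro ballI exI conjI allI impI)
    fix p assume "p \<in> V"
    show "form 1 (\<lambda>x. (A *v x) $ i)" for i
      using form_linear[of "\<lambda>k. A $ i $ k"] by (simp add: matrix_vector_mult_def)
    show "rep_proj p \<noteq> 0" "abs_proj (rep_proj p) = p" "A *v rep_proj p \<noteq> 0"
    proof -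
      have "proportional (rep_proj p) (rep_proj p)" by (meson Quotient3_proj Quotient3_rep_reflp)
      then show "rep_proj p \<noteq> 0" unfolding proportional_def by blast
      then show "A *v rep_proj p \<noteq> 0" using inverse_pair_nonzero[OF A] by blast
      show "abs_proj (rep_proj p) = p" by (meson Quotient3_proj Quotient3_abs_rep)
    qed
    fix v assume "v \<noteq> 0 \<and> abs_proj v \<in> V \<and> A *v v \<noteq> 0"
    then show "f (abs_proj v) = abs_proj (A *v v)" using eq[of "abs_proj v"] pmap_abs[of v A] by simp
  qed
  have "inv_into V (restrict (pmap M) V) p = pmap M' p" if "p \<in> V" for p
  proof (rule inv_into_f_eq)
    show "inj_on (restrict (pmap M) V) V" using bij by (simp add: bij_betw_def)
    show m: "pmap M' p \<in> V" using mem[of "pmap M' p"] inv that by simp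
    show "restrict (pmap M) V (pmap M' p) = p" using m inv by simp
  qed
  then have "regular_on V (inv_into V (restrict (pmap M) V))" by (rule reg[OF _ inverse_pair_sym[OF M]])
  moreover have "regular_on V (restrict (pmap M) V)" by (rule reg[OF _ M]) simp
  moreover have "restrict (pmap M) V (cnj_proj p) = cnj_proj (restrict (pmap M) V p)" if p: "p \<in> V" for p
  proof -
    obtain v where v: "v \<noteq> 0" "p = abs_proj v" by (rule proj_cases)
    then show ?thesis using p cV[OF p] real[of v] val nz by (simp add: cnj_proj_vcnj)
  qed
  ultimately show ?thesis unfolding aut_def using bij by auto
qed

lemma aut_image: "f \<in> aut V \<Longrightarrow> p \<in> V \<Longrightarrow> f p \<in> V"
  unfolding aut_def bij_betw_def by blast

lemma aut_UNIV_linear: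
  assumes "g \<in> aut UNIV"
  obtains M :: "complex^'n^'n" where "\<And>v. v \<noteq> 0 \<Longrightarrow> M *v v \<noteq> 0 \<and> g (abs_proj v) = abs_proj (M *v v)"
proof -
  have b: "bij g" and r: "regular_on UNIV g" "regular_on UNIV (inv g)"
    using assms unfolding aut_def by auto
  have "vreg UNIV g" "vreg UNIV (inv g)" using r regular_on_imp_vreg by blast+
  moreover have "\<And>p. inv g (g p) = p" "\<And>p. g (inv g p) = p"
    using b by (simp_all add: bij_is_inj bij_is_surj surj_f_inv_f)
  ultimately show ?thesis using aut_projective_space that by blast
qed

section \<open>The compact-open topology\<close>

lemma open_proj_iff: "open U \<longleftrightarrow> open {v. v \<noteq> 0 \<and> abs_proj v \<in> (U :: 'n::finite proj set)}"
  by (rule open_proj_def)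

text \<open>The saturation of \<open>V\<close> is the union of its preimages under the nonzero
  scalings.\<close>

lemma open_abs_proj_image:
  fixes V :: "(complex^'n::finite) set"
  assumes "open V" "0 \<notin> V"
  shows "open (abs_proj ` V)"
proof -
  have "{v. v \<noteq> 0 \<and> abs_proj v \<in> abs_proj ` V} = (\<Union>c\<in>-{0}. (\<lambda>v. c *s v) -` V)"
  proof (intro set_eqI iffI)
    fix v :: "complex^'n" assume "v \<in> {v. v \<noteq> 0 \<and> abs_proj v \<in> abs_proj ` V}"
    then obtain w where w: "v \<noteq> 0" "w \<in> V" "abs_proj v = abs_proj w" by auto
    then have "w \<noteq> 0" using assms(2) by auto
    then obtain c where "w = c *s v" using w abs_proj_eq_iff by metis
    moreover have "c \<noteq> 0" using \<open>w \<noteq> 0\<close> calculation by auto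
    ultimately show "v \<in> (\<Union>c\<in>-{0}. (\<lambda>v. c *s v) -` V)" using w by blast
  next
    fix v :: "complex^'n" assume "v \<in> (\<Union>c\<in>-{0}. (\<lambda>v. c *s v) -` V)"
    then obtain c where c: "c \<noteq> 0" "c *s v \<in> V" by blast
    then have "v \<noteq> 0" using assms(2) by auto
    then have "abs_proj v = abs_proj (c *s v)" using abs_proj_scale c by metis
    then show "v \<in> {v. v \<noteq> 0 \<and> abs_proj v \<in> abs_proj ` V}" using c \<open>v \<noteq> 0\<close> by blast
  qed
  moreover have "open ((\<lambda>v. c *s v) -` V)" for c
  proof (rule open_vimage[OF assms(1)])
    show "continuous_on UNIV (\<lambda>v::complex^'n. c *s v)"
      unfolding vector_scalar_mult_def by (intro continuous_intros)
  qed
  ultimately show ?thesis unfolding open_proj_iff by auto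
qed

text \<open>The condition is open in the pair of matrix and vector, and by compactness of
  \<open>K\<close> finitely many product neighbourhoods suffice.\<close>

lemma tube:
  fixes M0 :: "complex^'n^'m" and K :: "'n::finite proj set" and U :: "'m::finite proj set"
  assumes K: "compact K" and U: "open U"
    and M0: "\<And>v. v \<noteq> 0 \<Longrightarrow> abs_proj v \<in> K \<Longrightarrow> M0 *v v \<noteq> 0 \<and> abs_proj (M0 *v v) \<in> U"
  obtains W where "open W" "M0 \<in> W"
    "\<And>M v. M \<in> W \<Longrightarrow> v \<noteq> 0 \<Longrightarrow> abs_proj v \<in> K \<Longrightarrow> M *v v \<noteq> 0 \<and> abs_proj (M *v v) \<in> U"
proof -
  define O' where "O' = {z :: (complex^'n^'m) \<times> (complex^'n). snd z \<noteq> 0 \<and> fst z *v snd z \<noteq> 0 \<and> abs_proj (fst z *v snd z) \<in> U}"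
  have cont: "continuous_on UNIV (\<lambda>z :: (complex^'n^'m) \<times> (complex^'n). fst z *v snd z)"
    unfolding matrix_vector_mult_def by (intro continuous_intros)
  have "open ((\<lambda>z :: (complex^'n^'m) \<times> (complex^'n). fst z *v snd z) -` {w. w \<noteq> 0 \<and> abs_proj w \<in> U})"
    using U cont unfolding open_proj_iff by (rule open_vimage)
  moreover have "open (snd -` (- {0}) :: ((complex^'n^'m) \<times> (complex^'n)) set)"
    by (intro open_vimage continuous_intros open_Compl)
  ultimately have "open (((\<lambda>z. fst z *v snd z) -` {w. w \<noteq> 0 \<and> abs_proj w \<in> U}) \<inter> (snd -` (- {0})) :: ((complex^'n^'m) \<times> (complex^'n)) set)"
    by (rule open_Int)
  moreover have "((\<lambda>z. fst z *v snd z) -` {w. w \<noteq> 0 \<and> abs_proj w \<in> U}) \<inter> (snd -` (- {0})) = O'"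
    unfolding O'_def by auto
  ultimately have O': "open O'" by simp
  have "\<exists>W V. open W \<and> open V \<and> M0 \<in> W \<and> p \<in> abs_proj ` V \<and> 0 \<notin> V \<and> W \<times> V \<subseteq> O'" if p: "p \<in> K" for p
  proof -
    obtain v where v: "v \<noteq> 0" "p = abs_proj v" by (rule proj_cases)
    then have mem: "(M0, v) \<in> O'" using M0 p unfolding O'_def by auto
    obtain W V where "open W" "open V" "(M0, v) \<in> W \<times> V" "W \<times> V \<subseteq> O'"
      by (rule open_prod_elim[OF O' mem])
    moreover from this have "0 \<notin> V" unfolding O'_def by auto
    ultimately show ?thesis using v by blast
  qed
  then obtain W V where WV: "\<And>p. p \<in> K \<Longrightarrow> open (W p) \<and> open (V p) \<and> M0 \<in> W p \<and> p \<in> abs_proj ` V p \<and> 0 \<notin> V p \<and> W p \<times> V p \<subseteq> O'"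
    by metis
  have "\<And>p. p \<in> K \<Longrightarrow> open (abs_proj ` V p)" using WV open_abs_proj_image by blast
  moreover have "K \<subseteq> (\<Union>p\<in>K. abs_proj ` V p)" using WV by blast
  ultimately obtain C where C: "C \<subseteq> K" "finite C" "K \<subseteq> (\<Union>p\<in>C. abs_proj ` V p)"
    using K by (metis compactE_image)
  show ?thesis
  proof (rule that[of "\<Inter>p\<in>C. W p"])
    show "open (\<Inter>p\<in>C. W p)" using C WV by (intro open_INT) auto
    show "M0 \<in> (\<Inter>p\<in>C. W p)" using C WV by auto
    fix M v assume M: "M \<in> (\<Inter>p\<in>C. W p)" and v: "v \<noteq> 0" "abs_proj v \<in> K"
    then obtain p w where p: "p \<in> C" "w \<in> V p" "abs_proj v = abs_proj w" using C(3) by blast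
    then have "(M, w) \<in> O'" using M WV C(1) by blast
    then have w: "w \<noteq> 0" "M *v w \<noteq> 0" "abs_proj (M *v w) \<in> U" unfolding O'_def by auto
    obtain c where c: "v = c *s w" using p(3) v(1) w(1) abs_proj_eq_iff by blast
    have "c \<noteq> 0" using v(1) c by auto
    have "M *v v = c *s (M *v w)" unfolding c by (rule vector_scalar_commute)
    then show "M *v v \<noteq> 0 \<and> abs_proj (M *v v) \<in> U"
      using w abs_proj_scale[OF \<open>c \<noteq> 0\<close> w(2)] \<open>c \<noteq> 0\<close> by (simp add: scale_vec_zero_iff)
  qed
qed

text \<open>The empty compact set makes \<open>aut V\<close> itself a subbasic set.\<close>

lemma topspace_aut_topology: "topspace (aut_topology V) = aut V"
proof -
  have "aut V \<in> {{f \<in> aut V. f ` K \<subseteq> U} | K U. compact K \<and> K \<subseteq> V \<and> open U}"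
    by (rule CollectI, rule exI[of _ "{}"], rule exI[of _ UNIV]) auto
  then show ?thesis unfolding aut_topology_def by auto
qed

lemma openin_aut_topology:
  "compact K \<Longrightarrow> K \<subseteq> V \<Longrightarrow> open U \<Longrightarrow> openin (aut_topology V) {f \<in> aut V. f ` K \<subseteq> U}"
  unfolding aut_topology_def by (rule topology_generated_by_Basis) blast

lemma continuous_map_aut_topology:
  assumes "\<And>x. x \<in> topspace T \<Longrightarrow> f x \<in> aut V"
    and "\<And>x K U. x \<in> topspace T \<Longrightarrow> compact K \<Longrightarrow> K \<subseteq> V \<Longrightarrow> open U \<Longrightarrow> f x ` K \<subseteq> U \<Longrightarrow>
       \<exists>W. openin T W \<and> x \<in> W \<and> (\<forall>y\<in>W. f y ` K \<subseteq> U)"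
  shows "continuous_map T (aut_topology V) f"
  unfolding aut_topology_def
proof (rule continuous_on_generated_topo)
  fix S assume "S \<in> {{f \<in> aut V. f ` K \<subseteq> U} | K U. compact K \<and> K \<subseteq> V \<and> open U}"
  then obtain K U where KU: "S = {f \<in> aut V. f ` K \<subseteq> U}" "compact K" "K \<subseteq> V" "open U" by blast
  show "openin T (f -` S \<inter> topspace T)"
  proof (subst openin_subopen, intro ballI)
    fix x assume x: "x \<in> f -` S \<inter> topspace T"
    then obtain W where W: "openin T W" "x \<in> W" "\<forall>y\<in>W. f y ` K \<subseteq> U"
      using assms(2)[of x K U] KU by auto
    then have "W \<subseteq> f -` S \<inter> topspace T"
      using assms(1) openin_subset[OF W(1)] unfolding KU(1) by auto
    then show "\<exists>W. openin T W \<and> x \<in> W \<and> W \<subseteq> f -` S \<inter> topspace T" using W by blast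
  qed
next
  have "aut V \<in> {{f \<in> aut V. f ` K \<subseteq> U} | K U. compact K \<and> K \<subseteq> V \<and> open U}"
    by (rule CollectI, rule exI[of _ "{}"], rule exI[of _ UNIV]) auto
  then show "f ` topspace T \<subseteq> \<Union>{{f \<in> aut V. f ` K \<subseteq> U} | K U. compact K \<and> K \<subseteq> V \<and> open U}"
    using assms(1) by blast
qed

text \<open>By \<open>tube\<close>, continuity of the matrices gives continuity for the compact-open
  topology, so the path is a connected set of automorphisms that contains the identity.\<close>

lemma pmap_path_in_component:
  fixes M :: "real \<Rightarrow> complex^'n^'n"
  assumes cont: "continuous_on {0..1} M" and M0: "M 0 = mat 1"
    and aut: "\<And>s. s \<in> {0..1} \<Longrightarrow> restrict (pmap (M s)) V \<in> aut V"
    and nz: "\<And>s v. s \<in> {0..1} \<Longrightarrow> v \<noteq> 0 \<Longrightarrow> M s *v v \<noteq> 0"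
  shows "restrict (pmap (M 1)) V \<in> aut_id_component V"
proof -
  let ?f = "\<lambda>s. restrict (pmap (M s)) V"
  have "continuous_map (top_of_set {0..1}) (aut_topology V) ?f"
  proof (rule continuous_map_aut_topology)
    fix s K U assume s: "s \<in> topspace (top_of_set {0..1::real})" and K: "compact K" "K \<subseteq> V" "open U" "?f s ` K \<subseteq> U"
    then have s': "s \<in> {0..1}" by simp
    have "M s *v v \<noteq> 0 \<and> abs_proj (M s *v v) \<in> U" if v: "v \<noteq> 0" "abs_proj v \<in> K" for v
    proof -
      have "?f s (abs_proj v) \<in> U" using K v by blast
      moreover have "abs_proj v \<in> V" using K v by blast
      ultimately show ?thesis using nz[OF s' v(1)] pmap_abs[OF v(1) nz[OF s' v(1)]] by simp
    qed
    then obtain W where W: "open W" "M s \<in> W"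
      "\<And>M v. M \<in> W \<Longrightarrow> v \<noteq> 0 \<Longrightarrow> abs_proj v \<in> K \<Longrightarrow> M *v v \<noteq> 0 \<and> abs_proj (M *v v) \<in> U"
      using tube[OF K(1,3)] by metis
    have "openin (top_of_set {0..1}) ({0..1} \<inter> M -` W)"
      using cont W(1) by (rule continuous_openin_preimage_gen)
    moreover have "\<forall>t\<in>{0..1} \<inter> M -` W. ?f t ` K \<subseteq> U"
    proof (intro ballI subsetI)
      fix t p assume t: "t \<in> {0..1} \<inter> M -` W" and "p \<in> ?f t ` K"
      then obtain q where q: "q \<in> K" "p = ?f t q" by blast
      obtain v where v: "v \<noteq> 0" "q = abs_proj v" by (rule proj_cases)
      then have w: "M t *v v \<noteq> 0" "abs_proj (M t *v v) \<in> U" using W(3) t q by blast+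
      have "q \<in> V" using q K(2) by blast
      then show "p \<in> U" unfolding q v(2) using w(2) pmap_abs[OF v(1) w(1)] v(2) by simp
    qed
    ultimately show "\<exists>W. openin (top_of_set {0..1}) W \<and> s \<in> W \<and> (\<forall>t\<in>W. ?f t ` K \<subseteq> U)"
      using s' W(2) by blast
  qed (use aut in simp)
  then have c: "connectedin (aut_topology V) (?f ` {0..1})"
    by (rule connectedin_continuous_map_image) (simp add: connectedin_subtopology)
  have "pmap (mat 1 :: complex^'n^'n) p = p" for p
    using proj_cases[of p] pmap_abs by (metis matrix_vector_mul_lid)
  then have "restrict id V = ?f 0" unfolding M0 by (auto simp: fun_eq_iff)
  then have "restrict id V \<in> ?f ` {0..1}" by (auto intro!: image_eqI[of _ _ 0])
  moreover have "?f 1 \<in> ?f ` {0..1}" by auto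
  ultimately show ?thesis
    unfolding aut_id_component_def using c unfolding connected_component_of_def by blast
qed

section \<open>Double Segre surfaces in coordinates\<close>

lemma rep_proj_simps: "rep_proj p \<noteq> 0" "abs_proj (rep_proj p) = p"
proof -
  have "proportional (rep_proj p) (rep_proj p)" by (meson Quotient3_proj Quotient3_rep_reflp)
  then show "rep_proj p \<noteq> 0" unfolding proportional_def by blast
  show "abs_proj (rep_proj p) = p" by (meson Quotient3_proj Quotient3_abs_rep)
qed

definition surf :: "complex^(3 \<times> 3)^'n \<Rightarrow> 'n::finite proj set" where
  "surf N = {abs_proj (N *v segre x y) | x y. x \<noteq> 0 \<and> y \<noteq> 0}"

definition param :: "complex^(3 \<times> 3)^'n \<Rightarrow> 2 proj \<times> 2 proj \<Rightarrow> 'n::finite proj" where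
  "param N p = abs_proj (N *v segre (rep_proj (fst p)) (rep_proj (snd p)))"

lemma param_abs:
  assumes N: "inverse_pair N N'" and xy: "x \<noteq> 0" "y \<noteq> 0"
  shows "param N (abs_proj x, abs_proj y) = abs_proj (N *v segre x y)"
proof -
  obtain a where a: "rep_proj (abs_proj x) = a *s x"
    using abs_proj_eq_iff[OF rep_proj_simps(1) xy(1)] rep_proj_simps(2) by metis
  obtain b where b: "rep_proj (abs_proj y) = b *s y"
    using abs_proj_eq_iff[OF rep_proj_simps(1) xy(2)] rep_proj_simps(2) by metis
  have "a \<noteq> 0" "b \<noteq> 0" using a b rep_proj_simps(1) by (metis vector_smult_lzero)+
  then have ab: "a\<^sup>2 * b\<^sup>2 \<noteq> 0" by simp
  have nz: "N *v segre x y \<noteq> 0" using inverse_pair_nonzero[OF N] segre_nonzero xy by blast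
  have "N *v segre (a *s x) (b *s y) = (a\<^sup>2 * b\<^sup>2) *s (N *v segre x y)"
    unfolding segre_scale by (rule vector_scalar_commute)
  then show ?thesis unfolding param_def fst_conv snd_conv a b using abs_proj_scale[OF ab nz] by simp
qed

lemma param_cases: obtains x y where "x \<noteq> 0" "y \<noteq> 0" "p = (abs_proj x, abs_proj y)"
  by (metis proj_cases prod.collapse)

lemma range_param: "inverse_pair N N' \<Longrightarrow> range (param N) = surf N"
proof (intro set_eqI iffI)
  fix q assume N: "inverse_pair N N'" and "q \<in> range (param N)"
  then obtain p where "q = param N p" by blast
  then show "q \<in> surf N" unfolding surf_def param_def using rep_proj_simps(1) by blast
next
  fix q assume N: "inverse_pair N N'" and "q \<in> surf N"
  then obtain x y where "x \<noteq> 0" "y \<noteq> 0" "q = abs_proj (N *v segre x y)" unfolding surf_def by blast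
  then have "q = param N (abs_proj x, abs_proj y)" using param_abs[OF N] by simp
  then show "q \<in> range (param N)" by blast
qed

text \<open>On \<open>segre x y\<close> the two entries selected by \<open>row_coord\<close> are proportional to \<open>x\<close>.\<close>

definition row_coord :: "bool \<Rightarrow> 3 \<Rightarrow> complex^(3 \<times> 3) \<Rightarrow> complex^2" where
  "row_coord t j z = (\<chi> l. z $ (if l = 1 then (if t then 1 else 2) else (if t then 2 else 3), j))"

lemma row_coord_segre: "row_coord t j (segre x y) = (mono2 y j * (if t then x $ 1 else x $ 2)) *s x"
  by (simp add: row_coord_def segre_def vec_eq_iff forall_2 mono2_simps power2_eq_square)

lemma row_coord_exists:
  assumes "x \<noteq> 0" "y \<noteq> 0"
  obtains t j c where "row_coord t j (segre x y) = c *s x" "c \<noteq> 0"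
proof -
  obtain j where j: "mono2 y j \<noteq> 0" using mono2_nonzero assms by blast
  have "x $ 1 \<noteq> 0 \<or> x $ 2 \<noteq> 0" using assms by (auto simp: vec_eq_iff forall_2)
  then show ?thesis using j that[OF row_coord_segre[of True j x y]] that[OF row_coord_segre[of False j x y]] by auto
qed

lemma row_coord_scale: "row_coord t j (c *s z) = c *s row_coord t j z"
  by (simp add: row_coord_def vec_eq_iff)

lemma segre_inj:
  assumes nz: "x \<noteq> 0" "y \<noteq> 0" "x' \<noteq> 0" "y' \<noteq> 0" and eq: "segre x y = c *s segre x' y'"
  shows "abs_proj x = abs_proj x'" "abs_proj y = abs_proj y'"
proof -
  have main: "abs_proj x = abs_proj x'"
    if "x \<noteq> 0" "y \<noteq> 0" "x' \<noteq> 0" "y' \<noteq> 0" "segre x y = c *s segre x' y'" for x y x' y'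
  proof -
    obtain t j k where k: "row_coord t j (segre x y) = k *s x" "k \<noteq> 0"
      using row_coord_exists[OF \<open>x \<noteq> 0\<close> \<open>y \<noteq> 0\<close>] .
    define d where "d = c * (mono2 y' j * (if t then x' $ 1 else x' $ 2))"
    have "k *s x = d *s x'"
      unfolding k(1)[symmetric] \<open>segre x y = _\<close> row_coord_scale row_coord_segre d_def by simp
    then have "x = (d / k) *s x'" using k(2) by (simp add: vec_eq_iff field_simps)
    then show ?thesis using abs_proj_eq_iff[OF \<open>x \<noteq> 0\<close> \<open>x' \<noteq> 0\<close>] by blast
  qed
  show "abs_proj x = abs_proj x'" using main nz eq by blast
  have "segre y x = c *s segre y' x'"
    using arg_cong[OF eq, of "\<lambda>z. swap33 *v z"] by (simp add: vector_scalar_commute swap33_segre)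
  then show "abs_proj y = abs_proj y'" using main nz by blast
qed

lemma inj_param:
  assumes N: "inverse_pair N N'" shows "inj (param N)"
proof (rule injI)
  fix p q assume eq: "param N p = param N q"
  obtain x y where p: "x \<noteq> 0" "y \<noteq> 0" "p = (abs_proj x, abs_proj y)" by (rule param_cases)
  obtain x' y' where q: "x' \<noteq> 0" "y' \<noteq> 0" "q = (abs_proj x', abs_proj y')" by (rule param_cases)
  have "abs_proj (N *v segre x y) = abs_proj (N *v segre x' y')"
    using eq unfolding p q param_abs[OF N p(1,2)] param_abs[OF N q(1,2)] .
  then obtain c where "N *v segre x y = c *s (N *v segre x' y')"
    using abs_proj_eq_iff inverse_pair_nonzero[OF N] segre_nonzero p q by metis
  then have "segre x y = c *s segre x' y'"
    by (metis inverse_pair_apply(1)[OF N] vector_scalar_commute)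
  then show "p = q" using segre_inj p q by metis
qed

lemma bij_param: "inverse_pair N N' \<Longrightarrow> bij_betw (param N) UNIV (surf N)"
  by (simp add: bij_betw_def inj_param range_param)

lemma form_matrix_row: "form 1 (\<lambda>v. (A *v v) $ i)"
  using form_linear[of "\<lambda>k. A $ i $ k"] by (simp add: matrix_vector_mult_def)

text \<open>The first factor is read off from two entries of the 3 by 3 array; which two are not
  both zero depends on the point, hence several linear local representations. The second factor is
  treated through \<open>swap33\<close>.\<close>

lemma regular_inverse_param:
  assumes N: "inverse_pair N N'"
  shows "regular_on (surf N) (fst \<circ> inv (param N))" "regular_on (surf N) (snd \<circ> inv (param N))"
proof -
  have inv: "inv (param N) (abs_proj (N *v segre x y)) = (abs_proj x, abs_proj y)" if "x \<noteq> 0" "y \<noteq> 0" for x y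
    using inv_f_f[OF inj_param[OF N]] param_abs[OF N that] by metis
  have val: "\<exists>x y c. x \<noteq> 0 \<and> y \<noteq> 0 \<and> c \<noteq> 0 \<and> N' *v v = c *s segre x y \<and> inv (param N) (abs_proj v) = (abs_proj x, abs_proj y)"
    if v: "v \<noteq> 0" "abs_proj v \<in> surf N" for v
  proof -
    obtain x y where xy: "x \<noteq> 0" "y \<noteq> 0" "abs_proj v = abs_proj (N *v segre x y)" using v unfolding surf_def by blast
    then obtain c where c: "v = c *s (N *v segre x y)"
      using abs_proj_eq_iff[OF v(1)] inverse_pair_nonzero[OF N] segre_nonzero by metis
    have "c \<noteq> 0" using c v(1) by auto
    moreover have "N' *v v = c *s segre x y"
      unfolding c by (simp add: vector_scalar_commute inverse_pair_apply[OF N])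
    ultimately show ?thesis using xy inv by metis
  qed
  have scaled: "abs_proj (k *s x) = abs_proj x" if "k *s x \<noteq> 0" for k and x :: "complex^2"
    using that abs_proj_scale[of k x] by (auto simp: scale_vec_zero_iff)
  have lin: "form 1 (\<lambda>v. row_coord t j (A *v v) $ i)" for t j i and A :: "complex^'a^(3\<times>3)"
    by (simp add: row_coord_def form_matrix_row del: One_nat_def)
  show "regular_on (surf N) (fst \<circ> inv (param N))"
    unfolding regular_on_def
  proof (intro ballI)
    fix p assume p: "p \<in> surf N"
    obtain v where v: "v \<noteq> 0" "p = abs_proj v" by (rule proj_cases)
    obtain x y c where xy: "x \<noteq> 0" "y \<noteq> 0" "c \<noteq> 0" "N' *v v = c *s segre x y" using val v p by metis
    obtain t j k where k: "row_coord t j (segre x y) = k *s x" "k \<noteq> 0" using row_coord_exists[OF xy(1,2)] .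
    have "row_coord t j (N' *v v) \<noteq> 0" unfolding xy(4) row_coord_scale k(1) using xy k by (simp add: scale_vec_zero_iff)
    moreover have "(fst \<circ> inv (param N)) (abs_proj w) = abs_proj (row_coord t j (N' *v w))"
      if w: "w \<noteq> 0" "abs_proj w \<in> surf N" "row_coord t j (N' *v w) \<noteq> 0" for w
    proof -
      obtain x y c where xy: "x \<noteq> 0" "y \<noteq> 0" "c \<noteq> 0" "N' *v w = c *s segre x y"
        "inv (param N) (abs_proj w) = (abs_proj x, abs_proj y)" using val w by metis
      have "row_coord t j (N' *v w) = (c * (mono2 y j * (if t then x $ 1 else x $ 2))) *s x"
        unfolding xy(4) row_coord_scale row_coord_segre by simp
      then show ?thesis using scaled w(3) xy(5) by (metis comp_apply fst_conv)
    qed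
    ultimately show "\<exists>d F. (\<forall>i. form d (\<lambda>x. F x $ i)) \<and> (\<exists>v. v \<noteq> 0 \<and> abs_proj v = p \<and> F v \<noteq> 0) \<and>
         (\<forall>v. v \<noteq> 0 \<and> abs_proj v \<in> surf N \<and> F v \<noteq> 0 \<longrightarrow> (fst \<circ> inv (param N)) (abs_proj v) = abs_proj (F v))"
      using v lin by (intro exI[of _ 1] exI[of _ "\<lambda>v. row_coord t j (N' *v v)"]) blast
  qed
  show "regular_on (surf N) (snd \<circ> inv (param N))"
    unfolding regular_on_def
  proof (intro ballI)
    fix p assume p: "p \<in> surf N"
    let ?r = "\<lambda>t j v. row_coord t j (swap33 ** N' *v v)"
    have sw: "swap33 ** N' *v w = c *s segre y x" if "N' *v w = c *s segre x y" for w c x y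
      unfolding matrix_vector_mul_assoc[symmetric] that by (simp add: vector_scalar_commute swap33_segre)
    obtain v where v: "v \<noteq> 0" "p = abs_proj v" by (rule proj_cases)
    obtain x y c where xy: "x \<noteq> 0" "y \<noteq> 0" "c \<noteq> 0" "N' *v v = c *s segre x y" using val v p by metis
    obtain t j k where k: "row_coord t j (segre y x) = k *s y" "k \<noteq> 0" using row_coord_exists[OF xy(2,1)] .
    have "?r t j v \<noteq> 0" unfolding sw[OF xy(4)] row_coord_scale k(1) using xy k by (simp add: scale_vec_zero_iff)
    moreover have "(snd \<circ> inv (param N)) (abs_proj w) = abs_proj (?r t j w)"
      if w: "w \<noteq> 0" "abs_proj w \<in> surf N" "?r t j w \<noteq> 0" for w
    proof -
      obtain x y c where xy: "x \<noteq> 0" "y \<noteq> 0" "c \<noteq> 0" "N' *v w = c *s segre x y"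
        "inv (param N) (abs_proj w) = (abs_proj x, abs_proj y)" using val w by metis
      have "?r t j w = (c * (mono2 x j * (if t then y $ 1 else y $ 2))) *s y"
        unfolding sw[OF xy(4)] row_coord_scale row_coord_segre by simp
      then show ?thesis using scaled w(3) xy(5) by (metis comp_apply snd_conv)
    qed
    ultimately show "\<exists>d F. (\<forall>i. form d (\<lambda>x. F x $ i)) \<and> (\<exists>v. v \<noteq> 0 \<and> abs_proj v = p \<and> F v \<noteq> 0) \<and>
         (\<forall>v. v \<noteq> 0 \<and> abs_proj v \<in> surf N \<and> F v \<noteq> 0 \<longrightarrow> (snd \<circ> inv (param N)) (abs_proj v) = abs_proj (F v))"
      using v lin by (intro exI[of _ 1] exI[of _ "?r t j"]) blast
  qed
qed

lemma regular_prod_param: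
  assumes N: "inverse_pair N N'" shows "regular_prod (param N)"
  unfolding regular_prod_def
proof
  fix p :: "2 proj \<times> 2 proj"
  obtain x y where p: "x \<noteq> 0" "y \<noteq> 0" "p = (abs_proj x, abs_proj y)" by (rule param_cases)
  have "biform 2 2 (\<lambda>x y. (N *v segre x y) $ k)" for k
    unfolding biform22_iff by (rule exI[of _ "N $ k"]) (simp add: matrix_vector_mult_def)
  moreover have "N *v segre x y \<noteq> 0" using inverse_pair_nonzero[OF N] segre_nonzero p by blast
  ultimately show "\<exists>d e F. (\<forall>i. biform d e (\<lambda>x y. F x y $ i)) \<and>
     (\<exists>v w. v \<noteq> 0 \<and> w \<noteq> 0 \<and> (abs_proj v, abs_proj w) = p \<and> F v w \<noteq> 0) \<and>
     (\<forall>v w. v \<noteq> 0 \<and> w \<noteq> 0 \<and> F v w \<noteq> 0 \<longrightarrow> param N (abs_proj v, abs_proj w) = abs_proj (F v w))"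
    using p param_abs[OF N] by (intro exI[of _ 2] exI[of _ "\<lambda>x y. N *v segre x y"]) blast
qed

lemma biregular_param: "inverse_pair N N' \<Longrightarrow> biregular_prod (param N) (surf N)"
  unfolding biregular_prod_def
  by (simp add: bij_param regular_prod_param regular_inverse_param)

section \<open>Real structures\<close>

text \<open>The index \<open>b\<close> of a real structure distinguishes the torus (\<open>False\<close>) from the sphere (\<open>True\<close>).\<close>

definition conj_structure :: "bool \<Rightarrow> 2 proj \<times> 2 proj \<Rightarrow> 2 proj \<times> 2 proj" where
  "conj_structure b = (if b then S2_structure else S1xS1_structure)"

text \<open>The structure of index \<open>b\<close> acts on the vectors \<open>segre x y\<close> as
  conjugation followed by \<open>twist b\<close>.\<close>

definition twist :: "bool \<Rightarrow> complex^(3 \<times> 3)^(3 \<times> 3)" where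
  "twist b = (if b then swap33 else mat 1)"

lemma inverse_pair_twist: "inverse_pair (twist b) (twist b)"
  by (simp add: twist_def inverse_pair_swap33 inverse_pair_one)

lemma qform_twist: "qform (twist b *v z) = qform z"
  by (simp add: twist_def qform_swap33)

text \<open>The matrix condition for \<open>param N\<close> to carry the structure of index
  \<open>b\<close> to coordinatewise conjugation. Points determine the matrix only up to the scalar
  \<open>k\<close>.\<close>

definition real_model :: "bool \<Rightarrow> complex^(3 \<times> 3)^'n \<Rightarrow> bool" where
  "real_model b N \<longleftrightarrow> (\<exists>k. k \<noteq> 0 \<and> (\<forall>z. mcnj N *v z = k *s (N *v (twist b *v z))))"

lemma conj_structure_abs:
  assumes "x \<noteq> 0" "y \<noteq> 0"
  shows "conj_structure b (abs_proj x, abs_proj y) =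
     (abs_proj (vcnj (if b then y else x)), abs_proj (vcnj (if b then x else y)))"
  using assms by (simp add: conj_structure_def S2_structure_def S1xS1_structure_def cnj_proj_vcnj)

lemma param_structure:
  assumes N: "inverse_pair N N'" and xy: "x \<noteq> 0" "y \<noteq> 0"
  shows "param N (conj_structure b (abs_proj x, abs_proj y)) = abs_proj (N *v (twist b *v vcnj (segre x y)))"
  using xy by (simp add: conj_structure_abs param_abs[OF N] twist_def swap33_segre vcnj_segre)

lemma biform_of_form:
  assumes "form d P" shows "biform d 0 (\<lambda>x y. P x)" "biform 0 d (\<lambda>x y. P y)"
proof -
  obtain c where c: "\<And>x. P x = (\<Sum>m | sum m UNIV = d. c m * (\<Prod>i\<in>UNIV. (x $ i) ^ m i))"
    using assms unfolding form_def by blast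
  have z: "{n :: 'z::finite \<Rightarrow> nat. sum n UNIV = 0} = {\<lambda>_. 0}" by (auto simp: fun_eq_iff)
  show "biform d 0 (\<lambda>x y. P x)"
    unfolding biform_def z c by (rule exI[of _ "\<lambda>m n. c m"]) simp
  show "biform 0 d (\<lambda>x y. P y)"
    unfolding biform_def z c by (rule exI[of _ "\<lambda>m n. c n"]) simp
qed

lemma form_coord: "form 1 (\<lambda>v. v $ i)"
  using form_matrix_row[of "mat 1" i] by simp

lemma regular_prod_projections:
  "regular_prod (fst :: 'a::finite proj \<times> 'b::finite proj \<Rightarrow> _)"
  "regular_prod (snd :: 'a::finite proj \<times> 'b::finite proj \<Rightarrow> _)"
proof -
  have ex: "\<exists>v w. v \<noteq> 0 \<and> w \<noteq> 0 \<and> (abs_proj v, abs_proj w) = p" for p :: "'a proj \<times> 'b proj"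
    by (metis proj_cases prod.collapse)
  show "regular_prod (fst :: 'a::finite proj \<times> 'b::finite proj \<Rightarrow> _)"
    unfolding regular_prod_def
  proof (intro allI)
    fix p :: "'a proj \<times> 'b proj"
    show "\<exists>d e F. (\<forall>i. biform d e (\<lambda>x y. F x y $ i)) \<and>
     (\<exists>v w. v \<noteq> 0 \<and> w \<noteq> 0 \<and> (abs_proj v, abs_proj w) = p \<and> F v w \<noteq> 0) \<and>
     (\<forall>v w. v \<noteq> 0 \<and> w \<noteq> 0 \<and> F v w \<noteq> 0 \<longrightarrow> fst (abs_proj v, abs_proj w) = abs_proj (F v w))"
      by (rule exI[of _ 1], rule exI[of _ 0], rule exI[of _ "\<lambda>x y. x"])
        (use biform_of_form(1)[OF form_coord] ex[of p] in \<open>simp del: One_nat_def, blast\<close>)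
  qed
  show "regular_prod (snd :: 'a::finite proj \<times> 'b::finite proj \<Rightarrow> _)"
    unfolding regular_prod_def
  proof (intro allI)
    fix p :: "'a proj \<times> 'b proj"
    show "\<exists>d e F. (\<forall>i. biform d e (\<lambda>x y. F x y $ i)) \<and>
     (\<exists>v w. v \<noteq> 0 \<and> w \<noteq> 0 \<and> (abs_proj v, abs_proj w) = p \<and> F v w \<noteq> 0) \<and>
     (\<forall>v w. v \<noteq> 0 \<and> w \<noteq> 0 \<and> F v w \<noteq> 0 \<longrightarrow> snd (abs_proj v, abs_proj w) = abs_proj (F v w))"
      by (rule exI[of _ 0], rule exI[of _ 1], rule exI[of _ "\<lambda>x y. y"])
        (use biform_of_form(2)[OF form_coord] ex[of p] in \<open>simp del: One_nat_def, blast\<close>)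
  qed
qed

lemma cnj_proj_cnj_proj: "cnj_proj (cnj_proj p) = p"
  using proj_cases[of p] by (metis cnj_proj_vcnj vcnj_simps(1,2))

lemma real_structure_conj_structure: "real_structure (conj_structure b)"
proof -
  have "conj_structure b (conj_structure b p) = p" for p
    by (simp add: conj_structure_def S2_structure_def S1xS1_structure_def cnj_proj_cnj_proj)
  moreover have "(\<lambda>p. cnj_proj (fst (conj_structure b p))) = (if b then snd else fst)"
    "(\<lambda>p. cnj_proj (snd (conj_structure b p))) = (if b then fst else snd)"
    by (auto simp: conj_structure_def S2_structure_def S1xS1_structure_def cnj_proj_cnj_proj fun_eq_iff)
  ultimately show ?thesis
    unfolding real_structure_def by (simp add: regular_prod_projections)
qed

lemma param_real:
  assumes N: "inverse_pair N N'" and r: "real_model b N"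
  shows "param N (conj_structure b p) = cnj_proj (param N p)"
proof -
  obtain x y where p: "x \<noteq> 0" "y \<noteq> 0" "p = (abs_proj x, abs_proj y)" by (rule param_cases)
  obtain k where k: "k \<noteq> 0" "\<And>z. mcnj N *v z = k *s (N *v (twist b *v z))" using r unfolding real_model_def by blast
  have nz: "N *v segre x y \<noteq> 0" using inverse_pair_nonzero[OF N] segre_nonzero p by blast
  have nz': "N *v (twist b *v vcnj (segre x y)) \<noteq> 0"
    using inverse_pair_nonzero[OF N] inverse_pair_nonzero[OF inverse_pair_twist] segre_nonzero p by simp
  show ?thesis
    unfolding p(3) param_structure[OF N p(1,2)] param_abs[OF N p(1,2)] cnj_proj_vcnj[OF nz] vcnj_mult k(2)
    using abs_proj_scale[OF k(1) nz'] by simp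
qed

lemma double_segre_surf:
  fixes N :: "complex^(3 \<times> 3)^9"
  assumes N: "inverse_pair N N'" and r: "real_model b N"
  shows "double_segre_surface (surf N)" "real_isomorphic_prod (conj_structure b) (surf N)"
proof -
  show "double_segre_surface (surf N)"
    unfolding double_segre_surface_def
  proof (intro exI conjI)
    show "real_structure (conj_structure b)" by (rule real_structure_conj_structure)
    show "biregular_prod (param N) (surf N)" by (rule biregular_param[OF N])
    show "\<forall>p. param N (conj_structure b p) = cnj_proj (param N p)" using param_real[OF N r] by blast
    show "bidegree22_basis (\<lambda>x y. N *v segre x y)" unfolding bidegree22_basis_iff using N by blast
    show "\<forall>x y. x \<noteq> 0 \<and> y \<noteq> 0 \<longrightarrow> param N (abs_proj x, abs_proj y) = abs_proj (N *v segre x y)"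
      using param_abs[OF N] by blast
  qed
  show "real_isomorphic_prod (conj_structure b) (surf N)"
    unfolding real_isomorphic_prod_def using biregular_param[OF N] param_real[OF N r] by blast
qed

section \<open>Automorphisms of a double Segre surface are linear\<close>

lemma nonsingular_2_inverse_pair:
  assumes "\<And>x. x \<noteq> 0 \<Longrightarrow> (m :: complex^'n^'n) *v x \<noteq> 0"
  obtains m' where "inverse_pair m m'"
  using nonsingular_inverse[OF assms] unfolding inverse_pair_def by metis

lemma inverse_pair_det: "inverse_pair (m :: complex^'n^'n) m' \<Longrightarrow> det m \<noteq> 0"
  unfolding inverse_pair_def by (metis det_I det_mul mult_zero_right zero_neq_one)

text \<open>Both kinds of automorphisms of the product are linear in the coordinates of
  \<open>segre\<close>; those exchanging the rulings bring in \<open>swap33\<close>.\<close>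

lemma aut_product_segre:
  fixes \<alpha> \<beta> :: "2 proj \<times> 2 proj \<Rightarrow> 2 proj \<times> 2 proj"
  assumes reg: "preg (fst \<circ> \<alpha>)" "preg (snd \<circ> \<alpha>)" "preg (fst \<circ> \<beta>)" "preg (snd \<circ> \<beta>)"
    and inv: "\<And>p. \<beta> (\<alpha> p) = p" "\<And>p. \<alpha> (\<beta> p) = p"
  obtains R R' c where "inverse_pair R R'" "c \<noteq> 0" "\<And>z. qform (R *v z) = c * qform z"
    "\<And>x y. x \<noteq> 0 \<Longrightarrow> y \<noteq> 0 \<Longrightarrow> \<exists>x' y'. x' \<noteq> 0 \<and> y' \<noteq> 0 \<and>
       \<alpha> (abs_proj x, abs_proj y) = (abs_proj x', abs_proj y') \<and> R *v segre x y = segre x' y'"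
proof (rule aut_product_of_lines[OF reg inv])
  fix m n :: "complex^2^2"
  assume nz: "\<And>x. x \<noteq> 0 \<Longrightarrow> m *v x \<noteq> 0" "\<And>x. x \<noteq> 0 \<Longrightarrow> n *v x \<noteq> 0"
    and cases: "(\<forall>x y. x \<noteq> 0 \<and> y \<noteq> 0 \<longrightarrow> \<alpha> (abs_proj x, abs_proj y) = (abs_proj (m *v x), abs_proj (n *v y))) \<or>
     (\<forall>x y. x \<noteq> 0 \<and> y \<noteq> 0 \<longrightarrow> \<alpha> (abs_proj x, abs_proj y) = (abs_proj (n *v y), abs_proj (m *v x)))"
  obtain m' where m': "inverse_pair m m'" using nonsingular_2_inverse_pair nz(1) by metis
  obtain n' where n': "inverse_pair n n'" using nonsingular_2_inverse_pair nz(2) by metis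
  have d: "(det m * det n)\<^sup>2 \<noteq> 0" "(det n * det m)\<^sup>2 \<noteq> 0"
    using inverse_pair_det[OF m'] inverse_pair_det[OF n'] by simp_all
  from cases show ?thesis
  proof
    assume c: "\<forall>x y. x \<noteq> 0 \<and> y \<noteq> 0 \<longrightarrow> \<alpha> (abs_proj x, abs_proj y) = (abs_proj (m *v x), abs_proj (n *v y))"
    show ?thesis
    proof (rule that[OF inverse_pair_tens[OF m' n'] d(1) qform_tens])
      fix x y :: "complex^2" assume "x \<noteq> 0" "y \<noteq> 0"
      then show "\<exists>x' y'. x' \<noteq> 0 \<and> y' \<noteq> 0 \<and> \<alpha> (abs_proj x, abs_proj y) = (abs_proj x', abs_proj y') \<and>
          tens (sym2 m) (sym2 n) *v segre x y = segre x' y'"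
        using c nz segre_apply by metis
    qed
  next
    assume c: "\<forall>x y. x \<noteq> 0 \<and> y \<noteq> 0 \<longrightarrow> \<alpha> (abs_proj x, abs_proj y) = (abs_proj (n *v y), abs_proj (m *v x))"
    show ?thesis
    proof (rule that[OF inverse_pair_mult[OF inverse_pair_tens[OF n' m'] inverse_pair_swap33] d(2)])
      show "qform (tens (sym2 n) (sym2 m) ** swap33 *v z) = (det n * det m)\<^sup>2 * qform z" for z
        unfolding matrix_vector_mul_assoc[symmetric] qform_tens qform_swap33 ..
      fix x y :: "complex^2" assume "x \<noteq> 0" "y \<noteq> 0"
      then show "\<exists>x' y'. x' \<noteq> 0 \<and> y' \<noteq> 0 \<and> \<alpha> (abs_proj x, abs_proj y) = (abs_proj x', abs_proj y') \<and>
          tens (sym2 n) (sym2 m) ** swap33 *v segre x y = segre x' y'"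
        unfolding matrix_vector_mul_assoc[symmetric] swap33_segre
        using c nz segre_apply by metis
    qed
  qed
qed

text \<open>The comparison of \<open>f\<close> with \<open>param N\<close> is an automorphism of the
  product and hence acts linearly. Allowing any biregular \<open>f\<close> covers parametrisations
  adapted to another real structure as well as automorphisms of the surface composed with
  \<open>param N\<close>.\<close>

lemma surf_aut_linear:
  assumes N: "inverse_pair N N'"
    and f: "preg f" "range f = surf N" "inj f"
    and reg: "vreg (surf N) (fst \<circ> inv f)" "vreg (surf N) (snd \<circ> inv f)"
  obtains R R' c where "inverse_pair R R'" "c \<noteq> 0" "\<And>z. qform (R *v z) = c * qform z"
    "\<And>x y. x \<noteq> 0 \<Longrightarrow> y \<noteq> 0 \<Longrightarrow> f (abs_proj x, abs_proj y) = abs_proj (N *v (R *v segre x y))"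
proof -
  let ?\<nu> = "param N"
  have \<nu>: "preg ?\<nu>" "range ?\<nu> = surf N" "inj ?\<nu>"
    "vreg (surf N) (fst \<circ> inv ?\<nu>)" "vreg (surf N) (snd \<circ> inv ?\<nu>)"
    using regular_prod_imp_preg[OF regular_prod_param[OF N]] range_param[OF N] inj_param[OF N]
      regular_on_imp_vreg regular_inverse_param[OF N] by blast+
  have i: "inv f (f p) = p" "inv ?\<nu> (?\<nu> p) = p" for p using f(3) \<nu>(3) by simp_all
  have s: "f (inv f q) = q" "?\<nu> (inv ?\<nu> q) = q" if "q \<in> surf N" for q
    using that f(2) \<nu>(2) f_inv_into_f[of q f UNIV] f_inv_into_f[of q ?\<nu> UNIV] by auto
  have m: "f p \<in> surf N" "?\<nu> p \<in> surf N" for p using f(2) \<nu>(2) by blast+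
  have "preg (fst \<circ> (inv ?\<nu> \<circ> f))" "preg (snd \<circ> (inv ?\<nu> \<circ> f))"
    "preg (fst \<circ> (inv f \<circ> ?\<nu>))" "preg (snd \<circ> (inv f \<circ> ?\<nu>))"
    unfolding comp_assoc[symmetric]
    using preg_compose[OF f(1) m(1) \<nu>(4)] preg_compose[OF f(1) m(1) \<nu>(5)]
      preg_compose[OF \<nu>(1) m(2) reg(1)] preg_compose[OF \<nu>(1) m(2) reg(2)] by blast+
  moreover have "(inv f \<circ> ?\<nu>) ((inv ?\<nu> \<circ> f) p) = p" "(inv ?\<nu> \<circ> f) ((inv f \<circ> ?\<nu>) p) = p" for p
    using i s m by simp_all
  ultimately obtain R R' c where R: "inverse_pair R R'" "c \<noteq> 0" "\<And>z. qform (R *v z) = c * qform z"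
    "\<And>x y. x \<noteq> 0 \<Longrightarrow> y \<noteq> 0 \<Longrightarrow> \<exists>x' y'. x' \<noteq> 0 \<and> y' \<noteq> 0 \<and>
       (inv ?\<nu> \<circ> f) (abs_proj x, abs_proj y) = (abs_proj x', abs_proj y') \<and> R *v segre x y = segre x' y'"
    by (rule aut_product_segre) blast
  show ?thesis
  proof (rule that[OF R(1-3)])
    fix x y :: "complex^2" assume "x \<noteq> 0" "y \<noteq> 0"
    then obtain x' y' where xy: "x' \<noteq> 0" "y' \<noteq> 0" "inv ?\<nu> (f (abs_proj x, abs_proj y)) = (abs_proj x', abs_proj y')"
      "R *v segre x y = segre x' y'" using R(4) by force
    have "f (abs_proj x, abs_proj y) = ?\<nu> (abs_proj x', abs_proj y')" using xy(3) s(2) m(1) by metis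
    then show "f (abs_proj x, abs_proj y) = abs_proj (N *v (R *v segre x y))"
      using param_abs[OF N xy(1,2)] xy(4) by simp
  qed
qed

text \<open>Two parametrisations are given: \<open>\<nu>\<close> comes from a basis of forms but
  carries an unspecified real structure, while \<open>f\<close> carries the structure of index
  \<open>b\<close> but is merely biregular. As the comparison of the two is linear, \<open>f\<close>
  comes from a basis as well.\<close>

lemma double_segre_real_model:
  assumes X: "double_segre_surface X" "real_isomorphic_prod (conj_structure b) X"
  obtains N N' where "inverse_pair N N'" "X = surf N" "real_model b N"
proof -
  obtain \<nu> F where \<nu>: "biregular_prod \<nu> X" "bidegree22_basis F"
    "\<And>x y. x \<noteq> 0 \<Longrightarrow> y \<noteq> 0 \<Longrightarrow> \<nu> (abs_proj x, abs_proj y) = abs_proj (F x y)"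
    using X(1) unfolding double_segre_surface_def by blast
  obtain N N' where N: "inverse_pair N N'" "\<And>x y. F x y = N *v segre x y"
    using \<nu>(2) unfolding bidegree22_basis_iff by blast
  have "\<nu> = param N"
  proof
    fix p :: "2 proj \<times> 2 proj"
    obtain x y where "x \<noteq> 0" "y \<noteq> 0" "p = (abs_proj x, abs_proj y)" by (rule param_cases)
    then show "\<nu> p = param N p" using \<nu>(3) N param_abs by metis
  qed
  then have X': "X = surf N"
    using \<nu>(1) range_param[OF N(1)] unfolding biregular_prod_def bij_betw_def by simp
  obtain f where f: "biregular_prod f X" "\<And>p. f (conj_structure b p) = cnj_proj (f p)"
    using X(2) unfolding real_isomorphic_prod_def by blast
  then have "preg f" "range f = surf N" "inj f" "vreg (surf N) (fst \<circ> inv f)" "vreg (surf N) (snd \<circ> inv f)"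
    unfolding biregular_prod_def bij_betw_def X'
    using regular_prod_imp_preg regular_on_imp_vreg by blast+
  then obtain R R' c where R: "inverse_pair R R'" "c \<noteq> 0" "\<And>z. qform (R *v z) = c * qform z"
    "\<And>x y. x \<noteq> 0 \<Longrightarrow> y \<noteq> 0 \<Longrightarrow> f (abs_proj x, abs_proj y) = abs_proj (N *v (R *v segre x y))"
    by (rule surf_aut_linear[OF N(1)]) blast
  let ?N = "N ** R"
  have NR: "inverse_pair ?N (R' ** N')" by (rule inverse_pair_mult[OF N(1) R(1)])
  have fN: "f = param ?N"
  proof
    fix p :: "2 proj \<times> 2 proj"
    obtain x y where "x \<noteq> 0" "y \<noteq> 0" "p = (abs_proj x, abs_proj y)" by (rule param_cases)
    then show "f p = param ?N p" using R(4) param_abs[OF NR] by (simp add: matrix_vector_mul_assoc)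
  qed
  have XN: "X = surf ?N"
    using f(1) range_param[OF NR] unfolding fN biregular_prod_def bij_betw_def by simp
  have NT: "inverse_pair (?N ** twist b) (twist b ** (R' ** N'))"
    by (rule inverse_pair_mult[OF NR inverse_pair_twist])
  \<comment> \<open>The reality of \<open>f\<close> is used at the conjugate arguments, so that
    conjugation brings back \<open>segre x y\<close>.\<close>
  have "\<exists>k. mcnj ?N *v segre x y = k *s ((?N ** twist b) *v segre x y)" if xy: "x \<noteq> 0" "y \<noteq> 0" for x y
  proof -
    let ?x = "vcnj x" and ?y = "vcnj y"
    have xy': "?x \<noteq> 0" "?y \<noteq> 0" using xy by simp_all
    have v: "vcnj (segre ?x ?y) = segre x y" by (simp add: vcnj_segre)
    have nz: "?N *v segre ?x ?y \<noteq> 0" using inverse_pair_nonzero[OF NR] segre_nonzero xy' by blast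
    have "cnj_proj (param ?N (abs_proj ?x, abs_proj ?y)) = param ?N (conj_structure b (abs_proj ?x, abs_proj ?y))"
      using f(2) unfolding fN by metis
    then have "abs_proj (mcnj ?N *v segre x y) = abs_proj ((?N ** twist b) *v segre x y)"
      unfolding param_abs[OF NR xy'] param_structure[OF NR xy'] cnj_proj_vcnj[OF nz] vcnj_mult v
      by (simp add: matrix_vector_mul_assoc)
    moreover have "mcnj ?N *v segre x y \<noteq> 0" "(?N ** twist b) *v segre x y \<noteq> 0"
      using inverse_pair_nonzero[OF inverse_pair_mcnj[OF NR]] inverse_pair_nonzero[OF NT] segre_nonzero xy by blast+
    ultimately show ?thesis using abs_proj_eq_iff by blast
  qed
  then obtain k where k: "\<And>z. mcnj ?N *v z = k *s ((?N ** twist b) *v z)"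
    using segre_determines[OF NT] by blast
  have "k \<noteq> 0"
  proof
    assume "k = 0"
    then have "mcnj ?N *v axis (1,1) 1 = 0" using k[of "axis (1,1) 1"] by simp
    then show False using inverse_pair_nonzero[OF inverse_pair_mcnj[OF NR], of "axis (1,1) 1"] by simp
  qed
  then have "real_model b ?N" unfolding real_model_def using k by (auto simp: matrix_vector_mul_assoc)
  then show ?thesis using that NR XN by blast
qed

lemma aut_surf_lift:
  assumes N: "inverse_pair N N'" and g: "g \<in> aut (surf N)"
  obtains R R' c where "inverse_pair R R'" "c \<noteq> 0" "\<And>z. qform (R *v z) = c * qform z"
    "\<And>x y. x \<noteq> 0 \<Longrightarrow> y \<noteq> 0 \<Longrightarrow> g (abs_proj (N *v segre x y)) = abs_proj (N *v (R *v segre x y))"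
proof -
  let ?X = "surf N" and ?\<nu> = "param N"
  have g': "bij_betw g ?X ?X" "regular_on ?X g" "regular_on ?X (inv_into ?X g)" using g unfolding aut_def by auto
  have r: "range ?\<nu> = ?X" by (rule range_param[OF N])
  have gX: "g ` ?X = ?X" "inj_on g ?X" using g'(1) by (auto simp: bij_betw_def)
  have p1: "preg (g \<circ> ?\<nu>)"
    using preg_compose[OF regular_prod_imp_preg[OF regular_prod_param[OF N]] _ regular_on_imp_vreg[OF g'(2)]] r by blast
  have p2: "range (g \<circ> ?\<nu>) = ?X" using r gX(1) by (metis image_comp)
  have p3: "inj (g \<circ> ?\<nu>)" using inj_param[OF N] gX(2) r by (simp add: comp_inj_on)
  have inv: "inv (g \<circ> ?\<nu>) q = (inv ?\<nu> \<circ> inv_into ?X g) q" if q: "q \<in> ?X" for q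
  proof (rule inv_f_eq[OF p3])
    have "inv_into ?X g q \<in> ?X" using q gX(1) by (metis inv_into_into)
    then show "(g \<circ> ?\<nu>) ((inv ?\<nu> \<circ> inv_into ?X g) q) = q"
      using q gX(1) r f_inv_into_f[of _ ?\<nu> UNIV] f_inv_into_f[of q g ?X] by simp
  qed
  have into: "inv_into ?X g q \<in> ?X" if "q \<in> ?X" for q using that gX(1) by (metis inv_into_into)
  \<comment> \<open>Outside the surface the two expressions for the inverse take unspecified values,
    and \<open>vreg\<close> does not see them.\<close>
  have cong: "vreg ?X h" if "vreg ?X h'" "\<And>q. q \<in> ?X \<Longrightarrow> h q = h' q" for h h' :: "_ \<Rightarrow> 2 proj"
    using that unfolding vreg_def vrep_def by simp
  have v: "vreg ?X (fst \<circ> inv ?\<nu> \<circ> inv_into ?X g)" "vreg ?X (snd \<circ> inv ?\<nu> \<circ> inv_into ?X g)"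
    using vreg_compose[OF regular_on_imp_vreg[OF g'(3)] into regular_on_imp_vreg[OF regular_inverse_param(1)[OF N]]]
      vreg_compose[OF regular_on_imp_vreg[OF g'(3)] into regular_on_imp_vreg[OF regular_inverse_param(2)[OF N]]] by blast+
  have "vreg ?X (fst \<circ> inv (g \<circ> ?\<nu>))" by (rule cong[OF v(1)]) (simp add: inv)
  moreover have "vreg ?X (snd \<circ> inv (g \<circ> ?\<nu>))" by (rule cong[OF v(2)]) (simp add: inv)
  ultimately obtain R R' c where R: "inverse_pair R R'" "c \<noteq> 0" "\<And>z. qform (R *v z) = c * qform z"
    "\<And>x y. x \<noteq> 0 \<Longrightarrow> y \<noteq> 0 \<Longrightarrow> (g \<circ> ?\<nu>) (abs_proj x, abs_proj y) = abs_proj (N *v (R *v segre x y))"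
    by (rule surf_aut_linear[OF N p1 p2 p3]) blast
  show ?thesis
    by (rule that[OF R(1-3)]) (use R(4) param_abs[OF N] in simp)
qed

section \<open>Extension of automorphisms to the quadric\<close>

definition quad :: "complex^(3 \<times> 3)^'n \<Rightarrow> 'n::finite proj set" where
  "quad N = {abs_proj (N *v z) | z. z \<noteq> 0 \<and> qform z = 0}"

lemma qform_scale: "qform (c *s z) = c\<^sup>2 * qform z"
  by (simp add: qform_def power2_eq_square algebra_simps)

lemma qform_vcnj: "qform (vcnj z) = cnj (qform z)"
  by (simp add: qform_def)

lemma quad_mem:
  assumes N: "inverse_pair N N'" and v: "v \<noteq> 0"
  shows "abs_proj v \<in> quad N \<longleftrightarrow> qform (N' *v v) = 0"
proof
  assume "abs_proj v \<in> quad N"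
  then obtain z where z: "z \<noteq> 0" "qform z = 0" "abs_proj v = abs_proj (N *v z)" unfolding quad_def by blast
  then obtain c where "v = c *s (N *v z)" using abs_proj_eq_iff[OF v inverse_pair_nonzero[OF N]] by blast
  then have "N' *v v = c *s z" by (simp add: vector_scalar_commute inverse_pair_apply[OF N])
  then show "qform (N' *v v) = 0" using z by (simp add: qform_scale)
next
  assume "qform (N' *v v) = 0"
  moreover have "N' *v v \<noteq> 0" by (rule inverse_pair_nonzero[OF inverse_pair_sym[OF N] v])
  moreover have "abs_proj v = abs_proj (N *v (N' *v v))" by (simp add: inverse_pair_apply[OF N])
  ultimately show "abs_proj v \<in> quad N" unfolding quad_def by blast
qed

lemma surf_subset_quad: "surf N \<subseteq> quad N"
  unfolding surf_def quad_def using segre_nonzero qform_segre by blast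

lemma surf_mem:
  assumes N: "inverse_pair N N'" and v: "v \<noteq> 0" "abs_proj v \<in> surf N"
  obtains x y c where "x \<noteq> 0" "y \<noteq> 0" "c \<noteq> 0" "v = c *s (N *v segre x y)"
proof -
  obtain x y where xy: "x \<noteq> 0" "y \<noteq> 0" "abs_proj v = abs_proj (N *v segre x y)" using v(2) unfolding surf_def by blast
  then obtain c where c: "v = c *s (N *v segre x y)"
    using abs_proj_eq_iff[OF v(1) inverse_pair_nonzero[OF N segre_nonzero]] by blast
  moreover have "c \<noteq> 0" using c v(1) by auto
  ultimately show ?thesis using that xy by blast
qed

definition lifts :: "complex^(3 \<times> 3)^'n \<Rightarrow> ('n::finite proj \<Rightarrow> 'n proj) \<Rightarrow> complex^(3 \<times> 3)^(3 \<times> 3) \<Rightarrow> bool" where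
  "lifts N g R \<longleftrightarrow> (\<exists>R'. inverse_pair R R') \<and> (\<exists>c. c \<noteq> 0 \<and> (\<forall>z. qform (R *v z) = c * qform z)) \<and>
     (\<forall>x y. x \<noteq> 0 \<longrightarrow> y \<noteq> 0 \<longrightarrow> g (abs_proj (N *v segre x y)) = abs_proj (N *v (R *v segre x y)))"

lemma lifts_exists: "inverse_pair N N' \<Longrightarrow> g \<in> aut (surf N) \<Longrightarrow> \<exists>R. lifts N g R"
  unfolding lifts_def by (rule aut_surf_lift) blast+

lemma abs_proj_eq_of_scale:
  assumes "v \<noteq> 0" "v = k *s w" shows "abs_proj v = abs_proj w"
proof -
  have "k \<noteq> 0" "w \<noteq> 0" using assms by auto
  then show ?thesis using abs_proj_scale assms(2) by metis
qed

lemma lift_value: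
  assumes N: "inverse_pair N N'" and R: "lifts N g R" and w: "w \<noteq> 0" "abs_proj w \<in> surf N"
  shows "g (abs_proj w) = abs_proj (N ** R ** N' *v w)"
proof -
  obtain R' where R': "inverse_pair R R'" using R unfolding lifts_def by blast
  obtain x y c where xy: "x \<noteq> 0" "y \<noteq> 0" "c \<noteq> 0" "w = c *s (N *v segre x y)" by (rule surf_mem[OF N w])
  have nz: "N *v segre x y \<noteq> 0" "N *v (R *v segre x y) \<noteq> 0"
    using inverse_pair_nonzero[OF N] inverse_pair_nonzero[OF R'] segre_nonzero xy by blast+
  have "N ** R ** N' *v w = c *s (N *v (R *v segre x y))"
    unfolding matrix_vector_mul_assoc[symmetric] xy(4)
    by (simp add: vector_scalar_commute inverse_pair_apply[OF N])
  moreover have "g (abs_proj w) = abs_proj (N *v (R *v segre x y))"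
    using R xy abs_proj_scale[OF xy(3) nz(1)] unfolding lifts_def by simp
  ultimately show ?thesis using abs_proj_scale[OF xy(3) nz(2)] by simp
qed

lemma cnj_surf:
  assumes N: "inverse_pair N N'" and r: "real_model b N" and p: "p \<in> surf N"
  shows "cnj_proj p \<in> surf N"
  using p param_real[OF N r] unfolding range_param[OF N, symmetric] by (metis rangeE rangeI)

lemma conj_inverse_pair:
  "inverse_pair N N' \<Longrightarrow> inverse_pair R R' \<Longrightarrow> inverse_pair (N ** R ** N') (N ** (R' ** N'))"
  using inverse_pair_mult[OF inverse_pair_mult inverse_pair_sym] by blast

text \<open>The conjugate of the lifted matrix induces the same real map on the surface, so the two
  are proportional by \<open>segre_determines\<close>.\<close>

lemma lift_real:
  assumes N: "inverse_pair N N'" and r: "real_model b N" and g: "g \<in> aut (surf N)" and R: "lifts N g R"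
  shows "\<exists>k. k \<noteq> 0 \<and> (\<forall>v. mcnj (N ** R ** N') *v v = k *s (N ** R ** N' *v v))"
proof -
  let ?M = "N ** R ** N'"
  obtain R' where R': "inverse_pair R R'" using R unfolding lifts_def by blast
  note M = conj_inverse_pair[OF N R']
  note cN = inverse_pair_mcnj[OF N] and cM = inverse_pair_mcnj[OF M]
  note MN = inverse_pair_mult[OF M cN]
  have "\<exists>c. (mcnj ?M ** mcnj N) *v segre x y = c *s ((?M ** mcnj N) *v segre x y)" if xy: "x \<noteq> 0" "y \<noteq> 0" for x y
  proof -
    let ?w = "N *v segre (vcnj x) (vcnj y)"
    have w: "?w \<noteq> 0" "abs_proj ?w \<in> surf N" "vcnj ?w = mcnj N *v segre x y"
      using inverse_pair_nonzero[OF N segre_nonzero] xy by (auto simp: surf_def vcnj_mult vcnj_segre) (metis vcnj_simps(2))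
    have c: "abs_proj (vcnj ?w) \<in> surf N" using cnj_surf[OF N r w(2)] cnj_proj_vcnj[OF w(1)] by simp
    have Mw: "?M *v ?w \<noteq> 0" by (rule inverse_pair_nonzero[OF M w(1)])
    have "g (cnj_proj (abs_proj ?w)) = cnj_proj (g (abs_proj ?w))" using g w(2) unfolding aut_def by blast
    then have "abs_proj (?M *v vcnj ?w) = abs_proj (vcnj (?M *v ?w))"
      using lift_value[OF N R w(1,2)] lift_value[OF N R _ c] w(1) cnj_proj_vcnj[OF w(1)] cnj_proj_vcnj[OF Mw] by simp
    then have e: "abs_proj ((mcnj ?M ** mcnj N) *v segre x y) = abs_proj ((?M ** mcnj N) *v segre x y)"
      unfolding vcnj_mult[of ?M] w(3) by (simp add: matrix_vector_mul_assoc)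
    have "(mcnj ?M ** mcnj N) *v segre x y \<noteq> 0" "(?M ** mcnj N) *v segre x y \<noteq> 0"
      using inverse_pair_nonzero[OF inverse_pair_mult[OF cM cN]] inverse_pair_nonzero[OF MN] segre_nonzero xy by blast+
    then show ?thesis using e abs_proj_eq_iff by blast
  qed
  then obtain k where k: "\<And>z. (mcnj ?M ** mcnj N) *v z = k *s ((?M ** mcnj N) *v z)"
    using segre_determines[OF MN] by blast
  have kM: "mcnj ?M *v v = k *s (?M *v v)" for v
    using k[of "mcnj N' *v v"] by (simp add: matrix_vector_mul_assoc[symmetric] inverse_pair_apply[OF cN])
  have "k \<noteq> 0"
  proof
    assume "k = 0"
    then have "mcnj ?M *v 1 = 0" using kM[of 1] by simp
    then show False using inverse_pair_nonzero[OF cM, of 1] by simp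
  qed
  then show ?thesis using kM by blast
qed

text \<open>\<open>qform\<close> has real coefficients and is invariant under
  \<open>twist b\<close>, so its zero set is real for both structures.\<close>

lemma cnj_quad:
  assumes N: "inverse_pair N N'" and r: "real_model b N" and p: "p \<in> quad N"
  shows "cnj_proj p \<in> quad N"
proof -
  obtain z where z: "z \<noteq> 0" "qform z = 0" "p = abs_proj (N *v z)" using p unfolding quad_def by blast
  obtain k where k: "k \<noteq> 0" "\<And>z. mcnj N *v z = k *s (N *v (twist b *v z))" using r unfolding real_model_def by blast
  have nz: "N *v z \<noteq> 0" by (rule inverse_pair_nonzero[OF N z(1)])
  have t: "twist b *v vcnj z \<noteq> 0" using inverse_pair_nonzero[OF inverse_pair_twist] z(1) by simp
  have "cnj_proj p = abs_proj (N *v (twist b *v vcnj z))"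
    unfolding z(3) cnj_proj_vcnj[OF nz] vcnj_mult k(2) by (rule abs_proj_scale[OF k(1) inverse_pair_nonzero[OF N t]])
  moreover have "qform (twist b *v vcnj z) = 0" using z(2) by (simp add: qform_twist qform_vcnj)
  ultimately show ?thesis using t unfolding quad_def by blast
qed

lemma lift_aut_quad:
  assumes N: "inverse_pair N N'" and r: "real_model b N" and g: "g \<in> aut (surf N)" and R: "lifts N g R"
  shows "restrict (pmap (N ** R ** N')) (quad N) \<in> aut (quad N)"
proof -
  let ?M = "N ** R ** N'"
  obtain R' c where R': "inverse_pair R R'" "c \<noteq> 0" "\<And>z. qform (R *v z) = c * qform z"
    using R unfolding lifts_def by blast
  note M = conj_inverse_pair[OF N R'(1)]
  obtain k where k: "k \<noteq> 0" "\<And>v. mcnj ?M *v v = k *s (?M *v v)" using lift_real[OF N r g R] by blast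
  show ?thesis
  proof (rule aut_pmap[OF M])
    fix v :: "complex^'a" assume v: "v \<noteq> 0"
    have "?M *v v \<noteq> 0" by (rule inverse_pair_nonzero[OF M v])
    moreover have "N' *v (?M *v v) = R *v (N' *v v)"
      by (simp add: matrix_vector_mul_assoc[symmetric] inverse_pair_apply[OF N])
    ultimately show "abs_proj v \<in> quad N \<longleftrightarrow> abs_proj (?M *v v) \<in> quad N"
      using quad_mem[OF N] v R'(2,3) by simp
    show "abs_proj (?M *v vcnj v) = abs_proj (vcnj (?M *v v))"
      unfolding vcnj_mult k(2) using abs_proj_scale[OF k(1) inverse_pair_nonzero[OF M, of "vcnj v"]] v by simp
  qed (rule cnj_quad[OF N r])
qed

text \<open>Any two lifts differ by a scalar, which \<open>pmap\<close> does not see; so the choice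
  is harmless, as \<open>extend_eq\<close> records.\<close>

definition extend :: "complex^(3 \<times> 3)^'n \<Rightarrow> complex^'n^(3 \<times> 3) \<Rightarrow> ('n::finite proj \<Rightarrow> 'n proj) \<Rightarrow> 'n proj \<Rightarrow> 'n proj" where
  "extend N N' g = restrict (pmap (N ** (SOME R. lifts N g R) ** N')) (quad N)"

lemma pmap_cong_scale:
  fixes M M' :: "complex^'n::finite^'m::finite"
  assumes "\<And>v. v \<noteq> 0 \<Longrightarrow> M *v v \<noteq> 0" "\<And>v. M *v v = k *s (M' *v v)"
  shows "pmap M = pmap M'"
proof
  fix p :: "'n proj"
  obtain v where v: "v \<noteq> 0" "p = abs_proj v" by (rule proj_cases)
  have "M' *v v \<noteq> 0" using assms(1)[OF v(1)] assms(2)[of v] by auto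
  moreover have "abs_proj (M *v v) = abs_proj (M' *v v)"
    by (rule abs_proj_eq_of_scale[OF assms(1)[OF v(1)] assms(2)])
  ultimately show "pmap M p = pmap M' p"
    using pmap_abs[OF v(1), of M] pmap_abs[OF v(1), of M'] assms(1)[OF v(1)] v by simp
qed

lemma extend_eq:
  assumes N: "inverse_pair N N'" and R: "lifts N g R"
  shows "extend N N' g = restrict (pmap (N ** R ** N')) (quad N)"
proof -
  define S where "S = (SOME R. lifts N g R)"
  have S: "lifts N g S" unfolding S_def using R by (rule someI)
  obtain R' where R': "inverse_pair R R'" using R unfolding lifts_def by blast
  obtain S' where S': "inverse_pair S S'" using S unfolding lifts_def by blast
  note NR = inverse_pair_mult[OF N R'] and NS = inverse_pair_mult[OF N S']
  have "\<exists>c. (N ** S) *v segre x y = c *s ((N ** R) *v segre x y)" if "x \<noteq> 0" "y \<noteq> 0" for x y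
  proof -
    have "abs_proj ((N ** S) *v segre x y) = abs_proj ((N ** R) *v segre x y)"
      using R S that unfolding lifts_def by (simp add: matrix_vector_mul_assoc[symmetric])
    then show ?thesis using abs_proj_eq_iff inverse_pair_nonzero[OF NR] inverse_pair_nonzero[OF NS] segre_nonzero that by metis
  qed
  then obtain k where k: "\<And>z. (N ** S) *v z = k *s ((N ** R) *v z)" using segre_determines[OF NR] by blast
  have "pmap (N ** S ** N') = pmap (N ** R ** N')"
  proof (rule pmap_cong_scale)
    show "v \<noteq> 0 \<Longrightarrow> N ** S ** N' *v v \<noteq> 0" for v by (rule inverse_pair_nonzero[OF conj_inverse_pair[OF N S']])
    show "N ** S ** N' *v v = k *s (N ** R ** N' *v v)" for v
      using k[of "N' *v v"] by (simp add: matrix_vector_mul_assoc)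
  qed
  then show ?thesis unfolding extend_def S_def[symmetric] by simp
qed

text \<open>\<open>rebuild V u\<close> is, up to a scalar, the linear map sending the projective frame of the surface to the points with
  representatives \<open>V $ I\<close> and \<open>u\<close>. It is polynomial in these data by Cramer's rule.\<close>

definition rebuild :: "complex^(3 \<times> 3)^(3 \<times> 3) \<Rightarrow> complex^(3 \<times> 3) \<Rightarrow> complex^(3 \<times> 3)^(3 \<times> 3)" where
  "rebuild V u = (\<chi> a b. \<Sum>I\<in>UNIV. V $ I $ a * (det (\<chi> i J. if J = I then u $ i else V $ J $ i) / frame_vec $ I) * frame_inv $ I $ b)"

text \<open>The images of the frame are known only up to the scalars \<open>k I\<close> and
  \<open>k'\<close>. Cramer's rule expands \<open>u\<close> in the vectors \<open>V $ I\<close>;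
  dividing the resulting determinants by the known coefficients \<open>frame_vec $ I\<close> gives
  \<open>k I * det V / k'\<close>, so all scalars are recovered up to one common factor.\<close>

lemma rebuild_correct:
  assumes frm: "\<And>I. R *v (frame *v axis I 1) = k I *s V $ I" and nz: "\<And>I. k I \<noteq> 0"
    and star: "R *v (frame *v frame_vec) = k' *s u" and nz': "k' \<noteq> 0"
  shows "rebuild V u *v z = (det V / k') *s (R *v z)"
proof -
  define b where "b = (\<chi> J. k J * frame_vec $ J / k')"
  have RF: "(R ** frame) $ i $ J = k J * V $ J $ i" for i J
  proof -
    have "(R ** frame) *v axis J 1 = k J *s V $ J" using frm[of J] by (simp only: matrix_vector_mul_assoc)
    from arg_cong[OF this, of "\<lambda>v. v $ i"] show ?thesis unfolding matrix_axis by simp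
  qed
  have st: "(R ** frame) *v frame_vec = k' *s u" using star by (simp add: matrix_vector_mul_assoc)
  have "(\<Sum>J\<in>UNIV. k J * V $ J $ i * frame_vec $ J) = k' * u $ i" for i
  proof -
    have "(\<Sum>J\<in>UNIV. k J * V $ J $ i * frame_vec $ J) = ((R ** frame) *v frame_vec) $ i"
      by (simp add: matrix_vector_mult_def RF)
    then show ?thesis unfolding st by simp
  qed
  then have u: "(transpose V *v b) $ i = u $ i" for i
    using nz' by (simp add: b_def matrix_vector_mult_def transpose_def sum_divide_distrib[symmetric] mult_ac)
  have cr: "det (\<chi> i J. if J = I then u $ i else V $ J $ i) = b $ I * det V" for I
    using cramer_lemma[of I "transpose V" b] unfolding u det_transpose unfolding transpose_def vec_lambda_beta .
  have "rebuild V u = (\<chi> a c. det V / k' * (R ** frame ** frame_inv) $ a $ c)"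
  proof -
    have "V $ I $ a * (b $ I * det V / frame_vec $ I) = det V / k' * (R ** frame) $ a $ I" for I a
      using nz' frame_vec_nonzero[of I] by (simp add: RF b_def field_simps)
    then have "(\<Sum>I\<in>UNIV. V $ I $ a * (b $ I * det V / frame_vec $ I) * frame_inv $ I $ c) =
        det V / k' * (R ** frame ** frame_inv) $ a $ c" for a c
      by (simp add: matrix_matrix_mult_def[of "R ** frame"] sum_distrib_left mult.assoc)
    then show ?thesis unfolding rebuild_def cr by simp
  qed
  moreover have "R ** frame ** frame_inv = R"
    using frame_inverse by (simp add: inverse_pair_def matrix_mul_assoc[symmetric])
  ultimately have e: "rebuild V u = (\<chi> a c. det V / k' * R $ a $ c)" by (simp only:)
  show ?thesis
    unfolding e vec_eq_iff matrix_vector_mult_def by (simp add: sum_distrib_left mult.assoc)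
qed

lemma continuous_on_det:
  assumes "\<And>i j. continuous_on S (\<lambda>x. A x $ i $ j)"
  shows "continuous_on S (\<lambda>x. det (A x :: complex^'n^'n))"
  unfolding det_def by (intro continuous_intros assms)

lemma continuous_on_rebuild:
  "continuous_on UNIV (\<lambda>z. N ** rebuild (fst z) (snd z) ** N')"
proof -
  have "continuous_on UNIV (\<lambda>z :: (complex^(3 \<times> 3)^(3 \<times> 3)) \<times> (complex^(3 \<times> 3)).
      det (\<chi> i J. if J = I then snd z $ i else fst z $ J $ i))" for I
  proof (rule continuous_on_det)
    fix i J
    show "continuous_on UNIV (\<lambda>z :: (complex^(3 \<times> 3)^(3 \<times> 3)) \<times> (complex^(3 \<times> 3)).
        (\<chi> i J. if J = I then snd z $ i else fst z $ J $ i) $ i $ J)"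
      by (cases "J = I") (auto intro!: continuous_intros)
  qed
  note [continuous_intros] = this
  show ?thesis
    unfolding matrix_matrix_mult_def rebuild_def by (intro continuous_intros) (auto simp: frame_vec_nonzero)
qed

text \<open>An automorphism close to \<open>g0\<close> at the ten frame points has image points with
  representatives close to those of \<open>g0\<close>. Since \<open>rebuild\<close> is continuous,
  the matrix built from them is close to a multiple of the lift of \<open>g0\<close>, and
  \<open>tube\<close> transfers this to the compact set \<open>K\<close> in the quadric.\<close>

lemma continuous_map_extend:
  fixes N :: "complex^(3 \<times> 3)^'n::finite"
  assumes N: "inverse_pair N N'" and r: "real_model b N"
  shows "continuous_map (aut_topology (surf N)) (aut_topology (quad N)) (extend N N')"
proof (rule continuous_map_aut_topology)
  fix g assume "g \<in> topspace (aut_topology (surf N))"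
  then have g: "g \<in> aut (surf N)" by (simp add: topspace_aut_topology)
  then obtain R where R: "lifts N g R" using lifts_exists[OF N] by blast
  then show "extend N N' g \<in> aut (quad N)" using extend_eq[OF N R] lift_aut_quad[OF N r g R] by simp
next
  fix g0 K U
  assume "g0 \<in> topspace (aut_topology (surf N))" and K: "compact K" "K \<subseteq> quad N" "open U" "extend N N' g0 ` K \<subseteq> U"
  then have g0: "g0 \<in> aut (surf N)" by (simp add: topspace_aut_topology)
  obtain R0 where R0: "lifts N g0 R0" using lifts_exists[OF N g0] by blast
  obtain R0' where R0': "inverse_pair R0 R0'" using R0 unfolding lifts_def by blast
  define V0 where "V0 = (\<chi> I. R0 *v (frame *v axis I 1))"
  define u0 where "u0 = R0 *v (frame *v frame_vec)"
  have "V0 $ I = (R0 ** frame) *v axis I 1" for I by (simp add: V0_def matrix_vector_mul_assoc)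
  then have "transpose (R0 ** frame) = V0" unfolding matrix_axis by (simp add: vec_eq_iff transpose_def)
  then have "det V0 = det (R0 ** frame)" by (metis det_transpose)
  then have dV0: "det V0 \<noteq> 0"
    using inverse_pair_det[OF inverse_pair_mult[OF R0' frame_inverse]] by simp
  have reb0: "rebuild V0 u0 *v z = det V0 *s (R0 *v z)" for z
    using rebuild_correct[of R0 "\<lambda>_. 1" V0 1 u0 z] by (simp add: V0_def u0_def)
  have ext: "extend N N' g (abs_proj v) = abs_proj (N ** R ** N' *v v)" if h: "lifts N g R" "v \<noteq> 0" "abs_proj v \<in> K" for g R v
  proof -
    obtain R' where R': "inverse_pair R R'" using h(1) unfolding lifts_def by blast
    show ?thesis
      using extend_eq[OF N h(1)] K(2) h(2,3) pmap_abs[OF h(2) inverse_pair_nonzero[OF conj_inverse_pair[OF N R'] h(2)]] by auto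
  qed
  have pt: "N ** rebuild V0 u0 ** N' *v v \<noteq> 0 \<and> abs_proj (N ** rebuild V0 u0 ** N' *v v) \<in> U"
    if v: "v \<noteq> 0" "abs_proj v \<in> K" for v
  proof -
    have e: "N ** rebuild V0 u0 ** N' *v v = det V0 *s (N ** R0 ** N' *v v)"
      by (simp add: matrix_vector_mul_assoc[symmetric] reb0 vector_scalar_commute)
    have nz: "N ** R0 ** N' *v v \<noteq> 0" by (rule inverse_pair_nonzero[OF conj_inverse_pair[OF N R0'] v(1)])
    have "extend N N' g0 (abs_proj v) \<in> U" using K(4) v by blast
    then show ?thesis
      unfolding e abs_proj_scale[OF dV0 nz] scale_vec_zero_iff using ext[OF R0 v] nz dV0 by simp
  qed
  have "\<exists>W. open W \<and> N ** rebuild V0 u0 ** N' \<in> W \<and>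
      (\<forall>M v. M \<in> W \<longrightarrow> v \<noteq> 0 \<longrightarrow> abs_proj v \<in> K \<longrightarrow> M *v v \<noteq> 0 \<and> abs_proj (M *v v) \<in> U)"
    by (rule tube[OF K(1,3) pt]) (assumption | blast)+
  then obtain W where W: "open W" "N ** rebuild V0 u0 ** N' \<in> W"
      "\<And>M v. M \<in> W \<Longrightarrow> v \<noteq> 0 \<Longrightarrow> abs_proj v \<in> K \<Longrightarrow> M *v v \<noteq> 0 \<and> abs_proj (M *v v) \<in> U"
    by blast
  have "open ((\<lambda>z. N ** rebuild (fst z) (snd z) ** N') -` W)"
    by (rule open_vimage[OF W(1) continuous_on_rebuild])
  moreover have "(V0, u0) \<in> (\<lambda>z. N ** rebuild (fst z) (snd z) ** N') -` W" using W(2) by simp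
  ultimately obtain A B where AB: "open A" "open B" "(V0, u0) \<in> A \<times> B"
    "A \<times> B \<subseteq> (\<lambda>z. N ** rebuild (fst z) (snd z) ** N') -` W" by (rule open_prod_elim)
  have "V0 \<in> A" using AB(3) by simp
  from bspec[OF iffD1[OF open_vec_def AB(1)] this]
  obtain C where C0: "\<forall>I. open (C I) \<and> V0 $ I \<in> C I" "\<forall>V. (\<forall>I. V $ I \<in> C I) \<longrightarrow> V \<in> A"
    by (elim exE conjE)
  have C: "\<And>I. open (C I)" "\<And>I. V0 $ I \<in> C I" "\<And>V. (\<And>I. V $ I \<in> C I) \<Longrightarrow> V \<in> A"
    using C0(1) C0(2)[rule_format] by auto
  \<comment> \<open>The points of projective space with a representative in \<open>D\<close>,
    measured in the coordinates of the model; open sets of vectors thus become conditions on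
    points.\<close>
  define nb where "nb D = abs_proj ` {v. v \<noteq> 0 \<and> N' *v v \<in> D}" for D :: "(complex^(3 \<times> 3)) set"
  have open_nb: "open (nb D)" if D: "open D" for D
    unfolding nb_def
  proof (rule open_abs_proj_image)
    have "continuous_on UNIV (\<lambda>v. N' *v v)" unfolding matrix_vector_mult_def by (intro continuous_intros)
    then have "open ((\<lambda>v. N' *v v) -` D)" using D by (intro open_vimage)
    then have "open ((\<lambda>v. N' *v v) -` D \<inter> - {0})" by (intro open_Int open_Compl) auto
    moreover have "(\<lambda>v. N' *v v) -` D \<inter> - {0} = {v. v \<noteq> 0 \<and> N' *v v \<in> D}" by auto
    ultimately show "open {v. v \<noteq> 0 \<and> N' *v v \<in> D}" by simp
  qed auto
  have nbI: "abs_proj (N *v z) \<in> nb D" if "z \<in> D" "z \<noteq> 0" for z D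
    unfolding nb_def using that inverse_pair_nonzero[OF N] by (auto simp: inverse_pair_apply[OF N] intro!: imageI)
  have nbE: "\<exists>k v. k \<noteq> 0 \<and> v \<in> D \<and> z = k *s v" if h: "abs_proj (N *v z) \<in> nb D" "z \<noteq> 0" for z D
  proof -
    obtain v where v: "v \<noteq> 0" "N' *v v \<in> D" "abs_proj (N *v z) = abs_proj v" using h unfolding nb_def by auto
    then obtain k where k: "N *v z = k *s v" using abs_proj_eq_iff inverse_pair_nonzero[OF N h(2)] by blast
    have "z = k *s (N' *v v)" using arg_cong[OF k, of "\<lambda>w. N' *v w"] by (simp add: inverse_pair_apply[OF N] vector_scalar_commute)
    moreover have "k \<noteq> 0" using calculation h(2) by auto
    ultimately show ?thesis using v(2) by blast
  qed
  have fnz: "segre (frame_pt i) (frame_pt j) \<noteq> 0" "segre star_pt star_pt \<noteq> 0" for i j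
    using segre_nonzero frame_pt_nonzero by blast+
  define P where "P I = abs_proj (N *v segre (frame_pt (fst I)) (frame_pt (snd I)))" for I
  define p where "p = abs_proj (N *v segre star_pt star_pt)"
  have Pp: "P I \<in> surf N" "p \<in> surf N" for I
    unfolding P_def p_def surf_def using frame_pt_nonzero by blast+
  have gP: "g (P I) = abs_proj (N *v (R *v (frame *v axis I 1)))" "g p = abs_proj (N *v (R *v (frame *v frame_vec)))"
    if "lifts N g R" for g R I
    using that frame_pt_nonzero unfolding lifts_def P_def p_def frame_axis frame_star by blast+
  \<comment> \<open>Subbasic neighbourhoods for the ten singletons: this is all that is used of the
    topology on the automorphisms of the surface.\<close>
  define T where "T = (\<Inter>I\<in>UNIV. {g \<in> aut (surf N). g ` {P I} \<subseteq> nb (C I)}) \<inter> {g \<in> aut (surf N). g ` {p} \<subseteq> nb B}"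
  have "openin (aut_topology (surf N)) T"
    unfolding T_def
  proof (intro openin_Int openin_INT2)
    show "openin (aut_topology (surf N)) {g \<in> aut (surf N). g ` {P I} \<subseteq> nb (C I)}" for I
      by (rule openin_aut_topology) (use Pp open_nb C in auto)
    show "openin (aut_topology (surf N)) {g \<in> aut (surf N). g ` {p} \<subseteq> nb B}"
      by (rule openin_aut_topology) (use Pp open_nb AB in auto)
  qed auto
  moreover have "g0 \<in> T"
  proof -
    have n: "R0 *v (frame *v axis I 1) \<noteq> 0" "R0 *v (frame *v frame_vec) \<noteq> 0" for I
      unfolding frame_axis frame_star using inverse_pair_nonzero[OF R0'] fnz by blast+
    have "V0 $ I = R0 *v (frame *v axis I 1)" for I by (simp add: V0_def)
    then have "g0 (P I) \<in> nb (C I)" for I unfolding gP(1)[OF R0] using nbI C(2) n(1) by metis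
    moreover have "g0 p \<in> nb B" unfolding gP(2)[OF R0] using nbI AB(3) n(2) unfolding u0_def by blast
    ultimately show ?thesis unfolding T_def using g0 by auto
  qed
  moreover have "extend N N' g ` K \<subseteq> U" if gT: "g \<in> T" for g
  proof
    fix q assume "q \<in> extend N N' g ` K"
    then obtain v where v: "v \<noteq> 0" "abs_proj v \<in> K" "q = extend N N' g (abs_proj v)" by (metis imageE proj_cases)
    have g: "g \<in> aut (surf N)" "\<And>I. g (P I) \<in> nb (C I)" "g p \<in> nb B" using gT unfolding T_def by auto
    obtain R where R: "lifts N g R" using lifts_exists[OF N g(1)] by blast
    obtain R' where R': "inverse_pair R R'" using R unfolding lifts_def by blast
    have n: "R *v (frame *v axis I 1) \<noteq> 0" "R *v (frame *v frame_vec) \<noteq> 0" for I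
      unfolding frame_axis frame_star using inverse_pair_nonzero[OF R'] fnz by blast+
    have "\<exists>k v. k \<noteq> 0 \<and> v \<in> C I \<and> R *v (frame *v axis I 1) = k *s v" for I
      by (rule nbE) (use g(2)[of I] gP(1)[OF R] n(1) in simp_all)
    then obtain k w where k: "\<And>I. k I \<noteq> 0" "\<And>I. w I \<in> C I" "\<And>I. R *v (frame *v axis I 1) = k I *s w I" by metis
    have "\<exists>k v. k \<noteq> 0 \<and> v \<in> B \<and> R *v (frame *v frame_vec) = k *s v"
      by (rule nbE) (use g(3) gP(2)[OF R] n(2) in simp_all)
    then obtain k' u where k': "k' \<noteq> 0" "u \<in> B" "R *v (frame *v frame_vec) = k' *s u" by blast
    define V where "V = (\<chi> I. w I)"
    have "V \<in> A" by (rule C(3)) (simp add: V_def k(2))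
    then have mem: "N ** rebuild V u ** N' \<in> W" using AB(4) k'(2) by auto
    have reb: "rebuild V u *v z = (det V / k') *s (R *v z)" for z
      by (rule rebuild_correct[where k = k, OF _ _ k'(3,1)]) (simp_all add: V_def k(1,3))
    have e: "N ** rebuild V u ** N' *v v = (det V / k') *s (N ** R ** N' *v v)"
      by (simp add: matrix_vector_mul_assoc[symmetric] reb vector_scalar_commute)
    \<comment> \<open>Membership in \<open>W\<close> makes the vector nonzero, which also rules out
      \<open>det V = 0\<close> in the scalar of \<open>e\<close>.\<close>
    have W': "N ** rebuild V u ** N' *v v \<noteq> 0" "abs_proj (N ** rebuild V u ** N' *v v) \<in> U"
      using W(3)[OF mem v(1,2)] by blast+
    show "q \<in> U" unfolding v(3) ext[OF R v(1,2)] using W'(2) abs_proj_eq_of_scale[OF W'(1) e] by simp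
  qed
  ultimately show "\<exists>W. openin (aut_topology (surf N)) W \<and> g0 \<in> W \<and> (\<forall>g\<in>W. extend N N' g ` K \<subseteq> U)" by blast
qed

text \<open>A linear \<open>g\<close> and the extension of its restriction to the surface agree on
  the surface, hence everywhere. So the continuous map \<open>extend N N'\<close> takes a connected
  set joining the identity to the restriction of \<open>g\<close> to one that does the same on the
  quadric.\<close>

lemma aut_component_extends:
  fixes N :: "complex^(3 \<times> 3)^'n::finite"
  assumes N: "inverse_pair N N'" and r: "real_model b N"
  shows "aut_id_component_ambient (surf N) \<subseteq> aut_id_component_ambient (quad N)"
proof
  fix g assume "g \<in> aut_id_component_ambient (surf N)"
  then have g: "g \<in> aut UNIV" and c: "connected_component_of (aut_topology (surf N)) (restrict id (surf N)) (restrict g (surf N))"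
    unfolding aut_id_component_ambient_def aut_id_component_def by auto
  let ?i = "restrict id (surf N)" and ?g = "restrict g (surf N)"
  obtain T where T: "connectedin (aut_topology (surf N)) T" "?i \<in> T" "?g \<in> T"
    using c unfolding connected_component_of_def by blast
  have gX: "?g \<in> aut (surf N)" using c connected_component_in_topspace topspace_aut_topology by metis
  have in_surf: "abs_proj (N *v segre x y) \<in> surf N" if "x \<noteq> 0" "y \<noteq> 0" for x y
    using that unfolding surf_def by blast
  have "lifts N ?i (mat 1)"
    unfolding lifts_def
  proof (intro conjI)
    show "\<exists>R'. inverse_pair (mat 1) R'" using inverse_pair_one by blast
    show "\<exists>c. c \<noteq> 0 \<and> (\<forall>z. qform (mat 1 *v z) = c * qform z)" by (rule exI[of _ 1]) simp
  qed (use in_surf in simp)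
  then have "extend N N' ?i = restrict (pmap (N ** mat 1 ** N')) (quad N)" by (rule extend_eq[OF N])
  also have "N ** mat 1 ** N' = mat 1" using N by (simp add: inverse_pair_def)
  also have "pmap (mat 1 :: complex^'n^'n) = id"
    using pmap_abs proj_cases by (metis (no_types, opaque_lifting) eq_id_iff matrix_vector_mul_lid)
  finally have ei: "extend N N' ?i = restrict id (quad N)" .
  obtain R where R: "lifts N ?g R" using lifts_exists[OF N gX] by blast
  obtain R' where R': "inverse_pair R R'" using R unfolding lifts_def by blast
  note NR = inverse_pair_mult[OF N R']
  obtain M where M: "\<And>v. v \<noteq> 0 \<Longrightarrow> M *v v \<noteq> 0 \<and> g (abs_proj v) = abs_proj (M *v v)"
    using aut_UNIV_linear[OF g] by blast
  have "\<exists>k. (M ** N) *v segre x y = k *s ((N ** R) *v segre x y)" if xy: "x \<noteq> 0" "y \<noteq> 0" for x y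
  proof -
    have nz: "N *v segre x y \<noteq> 0" by (rule inverse_pair_nonzero[OF N segre_nonzero[OF xy]])
    have "?g (abs_proj (N *v segre x y)) = abs_proj (N *v (R *v segre x y))"
      using R xy unfolding lifts_def by blast
    then have "g (abs_proj (N *v segre x y)) = abs_proj (N *v (R *v segre x y))"
      using in_surf[OF xy] by simp
    then have "abs_proj ((M ** N) *v segre x y) = abs_proj ((N ** R) *v segre x y)"
      using M[OF nz] by (simp add: matrix_vector_mul_assoc)
    moreover have "(M ** N) *v segre x y \<noteq> 0" using M[OF nz] by (simp add: matrix_vector_mul_assoc)
    moreover have "(N ** R) *v segre x y \<noteq> 0" by (rule inverse_pair_nonzero[OF NR segre_nonzero[OF xy]])
    ultimately show ?thesis using abs_proj_eq_iff by blast
  qed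
  then obtain k where k: "\<And>z. (M ** N) *v z = k *s ((N ** R) *v z)" using segre_determines[OF NR] by blast
  have "pmap M = pmap (N ** R ** N')"
  proof (rule pmap_cong_scale)
    show "M *v v = k *s (N ** R ** N' *v v)" for v
      using k[of "N' *v v"] by (simp add: matrix_vector_mul_assoc[symmetric] inverse_pair_apply[OF N])
  qed (use M in blast)
  moreover have "pmap M = g"
  proof
    fix p :: "'n proj"
    obtain v where v: "v \<noteq> 0" "p = abs_proj v" by (rule proj_cases)
    then show "pmap M p = g p" using M[OF v(1)] pmap_abs[OF v(1), of M] by simp
  qed
  ultimately have eg: "extend N N' ?g = restrict g (quad N)" using extend_eq[OF N R] by simp
  have "connectedin (aut_topology (quad N)) (extend N N' ` T)"
    by (rule connectedin_continuous_map_image[OF continuous_map_extend[OF N r] T(1)])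
  moreover have "restrict id (quad N) \<in> extend N N' ` T" "restrict g (quad N) \<in> extend N N' ` T"
    using T(2,3) ei eg by force+
  ultimately have "restrict g (quad N) \<in> aut_id_component (quad N)"
    unfolding aut_id_component_def connected_component_of_def by blast
  then show "g \<in> aut_id_component_ambient (quad N)" unfolding aut_id_component_ambient_def using g by blast
qed

section \<open>Quadratic forms\<close>

definition bil :: "complex^'m^'n \<Rightarrow> complex^'n \<Rightarrow> complex^'m \<Rightarrow> complex" where
  "bil a z w = (\<Sum>i\<in>UNIV. \<Sum>j\<in>UNIV. a $ i $ j * z $ i * w $ j)"

lemma bil_add: "bil a (x + y) z = bil a x z + bil a y z" "bil a z (x + y) = bil a z x + bil a z y"
  by (simp_all add: bil_def algebra_simps sum.distrib)

lemma bil_scale: "bil a (c *s x) z = c * bil a x z" "bil a z (c *s x) = c * bil a z x"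
  by (simp_all add: bil_def sum_distrib_left mult_ac)

lemma bil_vec: "bil a z w = (\<Sum>i\<in>UNIV. z $ i * (a *v w) $ i)"
  by (simp add: bil_def matrix_vector_mult_def sum_distrib_left mult_ac)

lemma bil_axis: "bil a (axis i 1) (axis j 1) = a $ i $ j"
  by (simp add: bil_vec matrix_axis) (simp add: axis_def if_distrib[of "\<lambda>x. x * _"] cong: if_cong)

lemma bil_sym: "transpose a = a \<Longrightarrow> bil a z w = bil a w z"
proof -
  assume "transpose a = a"
  then have "a $ j $ i = a $ i $ j" for i j by (metis transpose_def vec_lambda_beta)
  then show ?thesis unfolding bil_def by (subst sum.swap) (simp add: mult_ac)
qed

lemma bil_adjoint: "bil a (M *v z) w = bil (transpose M ** a) z w"
proof -
  have tr: "(transpose M *v x) $ j = (\<Sum>i\<in>UNIV. M $ i $ j * x $ i)" for x j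
    by (simp add: matrix_vector_mult_def transpose_def)
  have "bil a (M *v z) w = (\<Sum>i\<in>UNIV. \<Sum>j\<in>UNIV. M $ i $ j * z $ j * (a *v w) $ i)"
    by (simp add: bil_vec matrix_vector_mult_def[of M] sum_distrib_right)
  also have "\<dots> = (\<Sum>j\<in>UNIV. \<Sum>i\<in>UNIV. M $ i $ j * z $ j * (a *v w) $ i)" by (rule sum.swap)
  also have "\<dots> = bil (transpose M ** a) z w"
    unfolding bil_vec matrix_vector_mul_assoc[symmetric] tr
    by (simp add: sum_distrib_left mult_ac)
  finally show ?thesis .
qed

lemma bil_pullback: "bil a (M *v z) (M *v w) = bil (transpose M ** a ** M) z w"
proof -
  have "bil a (M *v z) (M *v w) = bil (transpose M ** a) z (M *v w)" by (rule bil_adjoint)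
  then show ?thesis by (simp add: bil_vec matrix_vector_mul_assoc)
qed

lemma transpose_pullback: "transpose a = a \<Longrightarrow> transpose (transpose M ** a ** M) = transpose M ** a ** (M :: complex^'n^'m)"
  by (simp add: matrix_transpose_mul matrix_mul_assoc)

lemma quadratic_two:
  assumes "transpose a = a"
  shows "bil a (x *s axis j 1 + y *s axis k 1) (x *s axis j 1 + y *s axis k 1) =
     x\<^sup>2 * a $ j $ j + 2 * x * y * a $ j $ k + y\<^sup>2 * a $ k $ k"
proof -
  have "a $ k $ j = a $ j $ k" using assms by (metis transpose_def vec_lambda_beta)
  then show ?thesis
    by (simp add: bil_add bil_scale bil_axis power2_eq_square algebra_simps)
qed

lemma quadratic_zero:
  assumes "transpose a = a" "\<And>z. bil a z z = 0"
  shows "a $ j $ k = 0"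
  using assms(2)[of "1 *s axis j 1 + 1 *s axis k 1"] assms(2)[of "1 *s axis j 1 + 0 *s axis k 1"]
    assms(2)[of "0 *s axis j 1 + 1 *s axis k 1"]
  unfolding quadratic_two[OF assms(1)] by simp

text \<open>The isotropic vectors supported on two coordinates already determine a diagonal form up to a scalar.\<close>

lemma zero_set_diagonal:
  fixes a :: "complex^'n^'n"
  assumes a: "transpose a = a" and d: "\<And>k. d k \<noteq> 0"
    and zero: "\<And>u. (\<Sum>k\<in>UNIV. d k * (u $ k)\<^sup>2) = 0 \<Longrightarrow> bil a u u = 0"
  shows "\<exists>c. \<forall>u. bil a u u = c * (\<Sum>k\<in>UNIV. d k * (u $ k)\<^sup>2)"
proof -
  \<comment> \<open>With \<open>s\<^sup>2 = -1\<close>, the vector with entries \<open>r j\<close>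
    and \<open>s * r k\<close> at \<open>j\<close> and \<open>k\<close> is isotropic for the
    diagonal form; the two choices of \<open>s\<close> separate the mixed coefficient from the
    diagonal ones.\<close>
  define r where "r k = csqrt (1 / d k)" for k
  have r: "(r k)\<^sup>2 = 1 / d k" "r k \<noteq> 0" for k using d[of k] by (simp_all add: r_def)
  have off: "a $ j $ k = 0 \<and> a $ j $ j / d j = a $ k $ k / d k" if jk: "j \<noteq> k" for j k
  proof -
    have v: "(r j)\<^sup>2 * a $ j $ j + 2 * r j * (s * r k) * a $ j $ k + (s * r k)\<^sup>2 * a $ k $ k = 0" if s: "s\<^sup>2 = -1" for s
    proof -
      let ?u = "r j *s axis j 1 + (s * r k) *s axis k (1::complex)"
      have sq: "d l * (?u $ l)\<^sup>2 = (if l = j then 1 else 0) + (if l = k then -1 else 0)" for l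
        using jk s r[of l] d[of l] by (auto simp: axis_def power_mult_distrib)
      have "(\<Sum>l\<in>UNIV. d l * (?u $ l)\<^sup>2) = 0" unfolding sq sum.distrib by simp
      then have "bil a ?u ?u = 0" by (rule zero)
      then show ?thesis unfolding quadratic_two[OF a] .
    qed
    have 1: "(r j)\<^sup>2 * a $ j $ j + 2 * r j * (\<i> * r k) * a $ j $ k - (r k)\<^sup>2 * a $ k $ k = 0"
      using v[of \<i>] by (simp add: power_mult_distrib)
    have 2: "(r j)\<^sup>2 * a $ j $ j - 2 * r j * (\<i> * r k) * a $ j $ k - (r k)\<^sup>2 * a $ k $ k = 0"
      using v[of "-\<i>"] by (simp add: power_mult_distrib)
    have "4 * r j * (\<i> * r k) * a $ j $ k = 0" using 1 2 by algebra
    then have z: "a $ j $ k = 0" using r by simp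
    then have "(r j)\<^sup>2 * a $ j $ j = (r k)\<^sup>2 * a $ k $ k" using 1 by simp
    then show ?thesis using z by (simp add: r)
  qed
  define k0 :: 'n where "k0 = undefined"
  define c where "c = a $ k0 $ k0 / d k0"
  have ent: "a $ j $ k = (if j = k then c * d k else 0)" for j k
  proof (cases "j = k")
    case True
    have "a $ k $ k / d k = c" using off[of k k0] unfolding c_def by (cases "k = k0") auto
    then show ?thesis using True d[of k] by (simp add: field_simps)
  qed (use off in simp)
  have "bil a u u = c * (\<Sum>k\<in>UNIV. d k * (u $ k)\<^sup>2)" for u
  proof -
    have "a $ i $ j * u $ i * u $ j = (if j = i then c * (d i * (u $ i)\<^sup>2) else 0)" for i j
      by (simp add: ent power2_eq_square)
    then show ?thesis unfolding bil_def by (simp add: sum_distrib_left)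
  qed
  then show ?thesis by blast
qed

section \<open>Real quadratic forms over the complex numbers and their diagonalisation\<close>

definition cmat :: "real^'n^'m \<Rightarrow> complex^'n^'m" where
  "cmat A = (\<chi> i j. complex_of_real (A $ i $ j))"

lemma cmat_mult: "cmat (A ** B) = cmat A ** cmat B"
  by (simp add: cmat_def matrix_matrix_mult_def vec_eq_iff)

lemma cmat_one: "cmat (mat 1) = mat 1"
  by (simp add: cmat_def mat_def vec_eq_iff)

lemma cmat_transpose: "cmat (transpose A) = transpose (cmat A)"
  by (simp add: cmat_def transpose_def vec_eq_iff)

lemma mcnj_cmat: "mcnj (cmat A) = cmat A"
  by (simp add: cmat_def mcnj_def)

lemma quadric_of_bil: "quadric_of A = {abs_proj z | z. z \<noteq> 0 \<and> bil (cmat A) z z = 0}"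
  by (simp add: quadric_of_def bil_def cmat_def)

lemma quadric_mem:
  assumes "v \<noteq> 0" shows "abs_proj v \<in> quadric_of A \<longleftrightarrow> bil (cmat A) v v = 0"
proof
  assume "abs_proj v \<in> quadric_of A"
  then obtain z where z: "z \<noteq> 0" "bil (cmat A) z z = 0" "abs_proj v = abs_proj z" unfolding quadric_of_bil by blast
  then obtain c where "v = c *s z" using abs_proj_eq_iff[OF assms] by blast
  then show "bil (cmat A) v v = 0" using z(2) by (simp add: bil_scale)
qed (use assms in \<open>auto simp: quadric_of_bil\<close>)

text \<open>The change of basis is real, which \<open>mcnj P = P\<close> records. As
  \<open>p + q\<close> exhausts the indices, no diagonal entry vanishes.\<close>

lemma has_signature_diagonal:
  fixes A :: "real^'n^'n"
  assumes "has_signature A p q" "p + q = CARD('n)"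
  shows "\<exists>(P :: complex^'n^'n) P' d. inverse_pair P P' \<and> mcnj P = P \<and> (\<forall>k. d k \<noteq> (0::real)) \<and>
    card {k. d k > 0} = p \<and> card {k. d k < 0} = q \<and>
    (\<forall>u. bil (cmat A) (P *v u) (P *v u) = (\<Sum>k\<in>UNIV. complex_of_real (d k) * (u $ k)\<^sup>2))"
proof -
  obtain R D :: "real^'n^'n" where R: "invertible R" "D = transpose R ** A ** R"
    "\<And>i j. i \<noteq> j \<Longrightarrow> D $ i $ j = 0" "card {i. D $ i $ i > 0} = p" "card {i. D $ i $ i < 0} = q"
    using assms(1) unfolding has_signature_def by blast
  obtain R' where "R ** R' = mat 1" "R' ** R = mat 1" using R(1) unfolding invertible_def by blast
  then have inv: "inverse_pair (cmat R) (cmat R')" by (simp add: inverse_pair_def cmat_mult[symmetric] cmat_one)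
  have "card ({i. D $ i $ i > 0} \<union> {i. D $ i $ i < 0}) = CARD('n)"
    using R(4,5) assms(2) by (subst card_Un_disjoint) auto
  then have "{i. D $ i $ i > 0} \<union> {i. D $ i $ i < 0} = UNIV" by (intro card_subset_eq) auto
  then have "k \<in> {i. D $ i $ i > 0} \<union> {i. D $ i $ i < 0}" for k by blast
  then have nz: "D $ k $ k \<noteq> 0" for k by (metis (lifting) UnE less_irrefl mem_Collect_eq)
  have "bil (cmat A) (cmat R *v u) (cmat R *v u) = (\<Sum>k\<in>UNIV. complex_of_real (D $ k $ k) * (u $ k)\<^sup>2)" for u
  proof -
    have "bil (cmat A) (cmat R *v u) (cmat R *v u) = bil (cmat D) u u"
      unfolding bil_pullback R(2) by (simp add: cmat_mult cmat_transpose)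
    moreover have "cmat D $ i $ j * u $ i * u $ j = (if j = i then complex_of_real (D $ i $ i) * (u $ i)\<^sup>2 else 0)" for i j
      using R(3)[of i j] by (simp add: cmat_def power2_eq_square)
    ultimately show ?thesis unfolding bil_def by simp
  qed
  then show ?thesis
    using inv nz R(4,5)
    by (intro exI[of _ "cmat R"] exI[of _ "cmat R'"] exI[of _ "\<lambda>k. D $ k $ k"]) (simp add: mcnj_cmat)
qed

section \<open>Semi-invariant forms\<close>

definition diag2 :: "complex \<Rightarrow> complex^2^2" where
  "diag2 l = (\<chi> i j. if i = j then (if i = 1 then l else 1) else 0)"

definition shear :: "complex \<Rightarrow> complex^2^2" where
  "shear s = (\<chi> i j. if i = j then 1 else if i = 1 then s else 0)"

lemma inverse_pair_diag2: "l \<noteq> 0 \<Longrightarrow> inverse_pair (diag2 l) (diag2 (1 / l))"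
  by (simp add: inverse_pair_def diag2_def matrix_matrix_mult_def vec_eq_iff forall_2 sum_2 mat_def)

lemma inverse_pair_shear: "inverse_pair (shear s) (shear (- s))"
  by (simp add: inverse_pair_def shear_def matrix_matrix_mult_def vec_eq_iff forall_2 sum_2 mat_def)

lemma sym2_diag2: "sym2 (diag2 l) $ i $ k = (if i = k then l ^ (2 - wt i) else 0)"
proof -
  have "\<forall>i k. sym2 (diag2 l) $ i $ k = (if i = k then l ^ (2 - wt i) else 0)"
    unfolding forall_3 sym2_simps by (simp add: diag2_def wt_def)
  then show ?thesis by blast
qed

lemma torus_apply:
  "(tens (sym2 (diag2 l)) (sym2 (diag2 m)) *v z) $ I = l ^ (2 - wt (fst I)) * m ^ (2 - wt (snd I)) * z $ I"
proof (cases I)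
  case (Pair i j)
  have "(\<Sum>b\<in>UNIV. sym2 (diag2 l) $ i $ a * sym2 (diag2 m) $ j $ b * z $ (a, b)) =
      sym2 (diag2 l) $ i $ a * m ^ (2 - wt j) * z $ (a, j)" for a
    by (simp add: sym2_diag2[of m] if_distrib[of "\<lambda>x. x * _"] if_distrib[of "\<lambda>x. _ * x"] cong: if_cong)
  then show ?thesis
    unfolding Pair tens_apply
    by (simp add: sym2_diag2 if_distrib[of "\<lambda>x. x * _"] cong: if_cong)
qed

text \<open>The bound 4 is 2 + 2: a coefficient of a quadratic form involves two torus weights, each
  with exponents at most 2 in \<open>l\<close> and in \<open>m\<close>.\<close>

definition distinct_weights :: "complex \<Rightarrow> complex \<Rightarrow> bool" where
  "distinct_weights l m \<longleftrightarrow> (\<forall>a b c d. a \<le> 4 \<longrightarrow> b \<le> 4 \<longrightarrow> c \<le> 4 \<longrightarrow> d \<le> 4 \<longrightarrow>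
     l ^ a * m ^ b = l ^ c * m ^ d \<longrightarrow> a = c \<and> b = d)"

lemma wt_le: "wt i \<le> 2" by (simp add: wt_def)

text \<open>Under the torus all nonzero coefficients have the same weight, and nondegeneracy forces
  that weight to be the middle one. Five coefficients survive, and the unipotent element determines
  their ratios.\<close>

lemma semi_invariant_form:
  assumes a: "transpose a = a" and nondeg: "\<And>z. a *v z = 0 \<Longrightarrow> z = 0"
    and dw: "distinct_weights l m"
    and torus: "\<And>z. bil a (tens (sym2 (diag2 l)) (sym2 (diag2 m)) *v z) (tens (sym2 (diag2 l)) (sym2 (diag2 m)) *v z) = \<rho> * bil a z z"
    and unip: "\<And>z. bil a (tens (sym2 (shear 1)) (sym2 (shear 1)) *v z) (tens (sym2 (shear 1)) (sym2 (shear 1)) *v z) = \<rho>' * bil a z z"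
  shows "\<exists>c. c \<noteq> 0 \<and> (\<forall>z. bil a z z = c * qform z)"
proof -
  have asym: "a $ I $ J = a $ J $ I" for I J
    using arg_cong[OF a, of "\<lambda>m. m $ J $ I"] by (simp add: transpose_def)
  define w where "w I = l ^ (2 - wt (fst I)) * m ^ (2 - wt (snd I))" for I
  have weight: "a $ I $ J * (w I * w J) = \<rho> * a $ I $ J" for I J
  proof -
    \<comment> \<open>Invariance is given for the values of the quadratic form;
      \<open>quadratic_zero\<close>, applied to the difference, turns it into a statement about
      coefficients.\<close>
    define b where "b = (\<chi> I J. a $ I $ J * (w I * w J) - \<rho> * a $ I $ J)"
    have "transpose b = b" by (simp add: b_def transpose_def vec_eq_iff asym mult_ac)
    moreover have "bil b z z = 0" for z
    proof -
      have "bil b z z = bil a (tens (sym2 (diag2 l)) (sym2 (diag2 m)) *v z) (tens (sym2 (diag2 l)) (sym2 (diag2 m)) *v z) - \<rho> * bil a z z"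
        unfolding bil_def torus_apply w_def[symmetric] sum_distrib_left sum_subtractf[symmetric]
        by (simp add: b_def algebra_simps)
      then show ?thesis using torus by simp
    qed
    ultimately have "b $ I $ J = 0" by (rule quadratic_zero)
    then show ?thesis by (simp add: b_def)
  qed
  have ww: "w I * w J = l ^ (2 - wt (fst I) + (2 - wt (fst J))) * m ^ (2 - wt (snd I) + (2 - wt (snd J)))" for I J
    by (simp add: w_def power_add mult_ac)
  have row: "\<exists>J. a $ I $ J \<noteq> 0" for I
  proof (rule ccontr)
    assume "\<not> (\<exists>J. a $ I $ J \<noteq> 0)"
    then have "a $ J $ I = 0" for J using asym by metis
    then have "a *v axis I 1 = 0" unfolding matrix_axis by (simp add: vec_eq_iff)
    then have "axis I (1::complex) = 0" by (rule nondeg)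
    then show False by simp
  qed
  obtain J where J: "a $ (1,1) $ J \<noteq> 0" using row by blast
  obtain J' where J': "a $ (3,3) $ J' \<noteq> 0" using row by blast
  have rho: "\<rho> = w I * w J" if "a $ I $ J \<noteq> 0" for I J using weight[of I J] that by simp
  have same: "2 - wt (fst I) + (2 - wt (fst J)) = 2 - wt (fst K) + (2 - wt (fst L)) \<and>
      2 - wt (snd I) + (2 - wt (snd J)) = 2 - wt (snd K) + (2 - wt (snd L))"
    if "a $ I $ J \<noteq> 0" "a $ K $ L \<noteq> 0" for I J K L
    by (rule dw[unfolded distinct_weights_def, rule_format])
      (use rho[OF that(1)] rho[OF that(2)] ww in simp_all)
  \<comment> \<open>The pairs \<open>(1,1), J\<close> and \<open>(3,3), J'\<close> have equal
    exponents. The index \<open>(1,1)\<close> contributes 2 to each exponent and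
    \<open>(3,3)\<close> contributes 0, while a partner contributes at most 2; so \<open>J\<close>
    contributes 0.\<close>
  have w2: "wt (fst J) = 2 \<and> wt (snd J) = 2"
    using same[OF J J'] wt_le[of "fst J"] wt_le[of "snd J"] by (simp add: wt_def split: if_splits)
  have supp: "wt (fst I) + wt (fst K) = 2 \<and> wt (snd I) + wt (snd K) = 2" if "a $ I $ K \<noteq> 0" for I K
    using same[OF J that] w2 wt_le[of "fst I"] wt_le[of "snd I"] wt_le[of "fst K"] wt_le[of "snd K"]
    by (simp add: wt_def[of 1]) arith
  have zero: "a $ (i, j) $ (k, n) = 0" if "wt i + wt k \<noteq> 2 \<or> wt j + wt n \<noteq> 2" for i j k n
    using supp[of "(i, j)" "(k, n)"] that by auto
  define al be ga de ep where "al = a $ (1,1) $ (3,3)" and "be = a $ (1,3) $ (3,1)" and "ga = a $ (1,2) $ (3,2)"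
    and "de = a $ (2,1) $ (2,3)" and "ep = a $ (2,2) $ (2,2)"
  have q: "bil a z z = 2 * al * z $ (1,1) * z $ (3,3) + 2 * be * z $ (1,3) * z $ (3,1) + 2 * ga * z $ (1,2) * z $ (3,2)
      + 2 * de * z $ (2,1) * z $ (2,3) + ep * (z $ (2,2))\<^sup>2" for z
    unfolding bil_def sum_33 sum_3 al_def be_def ga_def de_def ep_def
    by (simp add: zero wt_def power2_eq_square
        asym[of "(3,3)" "(1,1)"] asym[of "(3,1)" "(1,3)"] asym[of "(3,2)" "(1,2)"] asym[of "(2,3)" "(2,1)"])
  have sh: "(tens (sym2 (shear 1)) (sym2 (shear 1)) *v z) $ (i, j) =
     (\<Sum>k\<in>UNIV. \<Sum>l\<in>UNIV. sym2 (shear 1) $ i $ k * sym2 (shear 1) $ j $ l * z $ (k, l))" for z i j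
    by (rule tens_apply)
  note U = unip[unfolded q sh sum_3 sym2_simps]
  define e :: "3 \<Rightarrow> 3 \<Rightarrow> complex^(3 \<times> 3)" where "e i j = axis (i, j) 1" for i j
  have e: "e i j $ (k, l) = (if i = k \<and> j = l then 1 else 0)" for i j k l by (auto simp: e_def axis_def)
  \<comment> \<open>The test vectors are isotropic for the remaining form, so \<open>\<rho>'\<close>
    drops out and their sheared images give linear equations in the five coefficients.\<close>
  have 1: "2 * al + 2 * be + 2 * ga + 2 * de + ep = 0" using U[of "e 3 3"] by (simp add: e shear_def)
  have 2: "2 * de + ep = 0" using U[of "e 2 3"] by (simp add: e shear_def)
  have 3: "2 * ga + ep = 0" using U[of "e 3 2"] by (simp add: e shear_def)
  have 4: "8 * be + 6 * ga + 6 * de + 4 * ep = 0"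
    using U[of "e 2 3 + e 3 2"] by (simp add: e shear_def mult.commute)
  have de: "de = - ep / 2" using 2 by (simp add: field_simps add_eq_0_iff)
  have ga: "ga = - ep / 2" using 3 by (simp add: field_simps add_eq_0_iff)
  have be: "be = ep / 4" using 4 unfolding de ga by (simp add: field_simps)
  have al: "al = ep / 4" using 1 unfolding de ga be by (simp add: field_simps)
  have eq: "bil a z z = (ep / 2) * qform z" for z
    unfolding q qform_def al be ga de by (simp add: field_simps)
  moreover have "ep / 2 \<noteq> 0"
  proof
    assume "ep / 2 = 0"
    then have "a $ (1,1) $ J = 0" using eq by (intro quadratic_zero[OF a]) simp
    then show False using J by simp
  qed
  ultimately show ?thesis by blast
qed

section \<open>Uniqueness\<close>

lemma tens_swap: "swap33 ** tens A B ** swap33 = tens B A"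
proof (rule matrix_eqI)
  fix z
  have "(swap33 ** tens A B ** swap33 *v z) $ (i, j) = (tens B A *v z) $ (i, j)" for i j
    unfolding matrix_vector_mul_assoc[symmetric] swap33_apply swap_simp tens_apply
    by (subst sum.swap) (simp add: mult.commute swap33_apply)
  then show "swap33 ** tens A B ** swap33 *v z = tens B A *v z" by (simp add: vec_eq_iff)
qed

lemma mcnj_tens: "mcnj (tens A B) = tens (mcnj A) (mcnj B)"
  by (simp add: mcnj_def tens_def vec_eq_iff)

lemma mcnj_sym2: "mcnj (sym2 A) = sym2 (mcnj A)"
  unfolding vec_eq_iff forall_3 by (simp add: mcnj_def sym2_simps)

text \<open>The pairs acting on the product by automorphisms that commute with the structure of
  index \<open>b\<close>: a matrix and its conjugate if the factors are exchanged, two real matrices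
  otherwise.\<close>

definition compatible :: "bool \<Rightarrow> complex^2^2 \<Rightarrow> complex^2^2 \<Rightarrow> bool" where
  "compatible b A B \<longleftrightarrow> (if b then mcnj A = B else mcnj A = A \<and> mcnj B = B)"

lemma mcnj_mcnj: "mcnj (mcnj A) = A"
  by (simp add: mcnj_def vec_eq_iff)

lemma twist_tens:
  assumes "compatible b A B"
  shows "twist b ** mcnj (tens (sym2 A) (sym2 B)) ** twist b = tens (sym2 A) (sym2 B)"
proof (cases b)
  case True
  then have "mcnj A = B" "mcnj B = A" using assms mcnj_mcnj unfolding compatible_def by auto
  then show ?thesis using True by (simp add: twist_def mcnj_tens mcnj_sym2 tens_swap)
next
  case False
  then show ?thesis using assms by (simp add: twist_def compatible_def mcnj_tens mcnj_sym2)
qed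

lemma twist_twist: "twist b *v (twist b *v z) = z"
  using inverse_pair_apply(1)[OF inverse_pair_twist] .

lemma real_model_inverse:
  assumes N: "inverse_pair N N'" and k: "\<And>z. mcnj N *v z = k *s (N *v (twist b *v z))" "k \<noteq> 0"
  shows "mcnj N' *v w = (1 / k) *s (twist b *v (N' *v w))"
proof -
  let ?x = "(1 / k) *s (twist b *v (N' *v w))"
  have "mcnj N *v ?x = (1 / k) *s (mcnj N *v (twist b *v (N' *v w)))" by (simp only: vector_scalar_commute)
  also have "\<dots> = (1 / k) *s (k *s w)" by (simp add: k(1) twist_twist inverse_pair_apply[OF N])
  also have "\<dots> = w" using k(2) by simp
  finally have "mcnj N' *v (mcnj N *v ?x) = mcnj N' *v w" by simp
  then show ?thesis by (simp add: inverse_pair_apply[OF inverse_pair_mcnj[OF N]])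
qed

lemma surf_map:
  assumes N: "inverse_pair N N'" and A: "inverse_pair A A'" and B: "inverse_pair B B'"
    and v: "v \<noteq> 0" "abs_proj v \<in> surf N"
  shows "abs_proj (N ** tens (sym2 A) (sym2 B) ** N' *v v) \<in> surf N"
proof -
  obtain x y c where xy: "x \<noteq> 0" "y \<noteq> 0" "c \<noteq> 0" "v = c *s (N *v segre x y)" by (rule surf_mem[OF N v])
  have AB: "A *v x \<noteq> 0" "B *v y \<noteq> 0" using inverse_pair_nonzero[OF A] inverse_pair_nonzero[OF B] xy by blast+
  have "N ** tens (sym2 A) (sym2 B) ** N' *v v = c *s (N *v segre (A *v x) (B *v y))"
    unfolding matrix_vector_mul_assoc[symmetric] xy(4)
    by (simp add: vector_scalar_commute inverse_pair_apply[OF N] segre_apply)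
  then have "abs_proj (N ** tens (sym2 A) (sym2 B) ** N' *v v) = abs_proj (N *v segre (A *v x) (B *v y))"
    using abs_proj_scale[OF xy(3) inverse_pair_nonzero[OF N segre_nonzero[OF AB]]] by simp
  then show ?thesis unfolding surf_def using AB by blast
qed

lemma group_aut:
  assumes N: "inverse_pair N N'" and r: "real_model b N"
    and A: "inverse_pair A A'" and B: "inverse_pair B B'" and c: "compatible b A B"
  defines "M \<equiv> N ** tens (sym2 A) (sym2 B) ** N'"
  shows "pmap M \<in> aut UNIV" "restrict (pmap M) (surf N) \<in> aut (surf N)"
proof -
  let ?R = "tens (sym2 A) (sym2 B)"
  note R = inverse_pair_tens[OF A B]
  have M: "inverse_pair M (N ** (tens (sym2 A') (sym2 B') ** N'))"
    unfolding M_def by (rule conj_inverse_pair[OF N R])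
  obtain k where k: "k \<noteq> 0" "\<And>z. mcnj N *v z = k *s (N *v (twist b *v z))" using r unfolding real_model_def by blast
  have "twist b *v (mcnj ?R *v (twist b *v z)) = ?R *v z" for z
    using arg_cong[OF twist_tens[OF c], of "\<lambda>m. m *v z"] by (simp only: matrix_vector_mul_assoc matrix_mul_assoc)
  then have "mcnj M *v v = M *v v" for v
    unfolding M_def mcnj_mult matrix_vector_mul_assoc[symmetric] real_model_inverse[OF N k(2,1)] k(2)
    using k(1) by (simp add: vector_scalar_commute)
  then have real: "abs_proj (M *v vcnj v) = abs_proj (vcnj (M *v v))" for v by (simp add: vcnj_mult)
  have "restrict (pmap M) UNIV \<in> aut UNIV" by (rule aut_pmap[OF M]) (use real in auto)
  then show "pmap M \<in> aut UNIV" by (simp add: restrict_def)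
  show "restrict (pmap M) (surf N) \<in> aut (surf N)"
  proof (rule aut_pmap[OF M])
    fix v :: "complex^'a" assume v: "v \<noteq> 0"
    have "abs_proj v \<in> surf N" if h: "abs_proj (M *v v) \<in> surf N"
    proof -
      have "abs_proj (N ** tens (sym2 A') (sym2 B') ** N' *v (M *v v)) \<in> surf N"
        by (rule surf_map[OF N inverse_pair_sym[OF A] inverse_pair_sym[OF B] inverse_pair_nonzero[OF M v] h])
      moreover have "N ** tens (sym2 A') (sym2 B') ** N' *v (M *v v) = v"
        using inverse_pair_apply(1)[OF M] by (simp add: matrix_mul_assoc)
      ultimately show ?thesis by simp
    qed
    then show "abs_proj v \<in> surf N \<longleftrightarrow> abs_proj (M *v v) \<in> surf N"
      using surf_map[OF N A B v] unfolding M_def by blast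
  qed (use real cnj_surf[OF N r] in auto)
qed

lemma continuous_on_group:
  assumes "\<And>i j. continuous_on S (\<lambda>s. A s $ i $ j)" "\<And>i j. continuous_on S (\<lambda>s. B s $ i $ j)"
  shows "continuous_on S (\<lambda>s. N ** tens (sym2 (A s)) (sym2 (B s)) ** N')"
proof -
  have sym: "continuous_on S (\<lambda>s. sym2 (C s) $ i $ j)" if h: "\<And>i j. continuous_on S (\<lambda>s. C s $ i $ j)" for C i j
  proof -
    have "\<forall>i j. continuous_on S (\<lambda>s. sym2 (C s) $ i $ j)"
      unfolding forall_3 sym2_simps
      by (intro conjI continuous_on_add continuous_on_mult continuous_on_power continuous_on_const h)
    then show ?thesis by blast
  qed
  have "continuous_on S (\<lambda>s. tens (sym2 (A s)) (sym2 (B s)) $ I $ J)" for I J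
    unfolding tens_def vec_lambda_beta by (intro continuous_on_mult sym assms)
  then show ?thesis
    unfolding matrix_matrix_mult_def vec_lambda_beta
    by (intro continuous_on_vec_lambda continuous_on_sum continuous_on_mult continuous_on_const)
qed

lemma group_in_component:
  fixes A B A' B' :: "real \<Rightarrow> complex^2^2"
  assumes N: "inverse_pair N N'" and r: "real_model b N"
    and A: "\<And>s. s \<in> {0..1} \<Longrightarrow> inverse_pair (A s) (A' s)" and B: "\<And>s. s \<in> {0..1} \<Longrightarrow> inverse_pair (B s) (B' s)"
    and c: "\<And>s. s \<in> {0..1} \<Longrightarrow> compatible b (A s) (B s)"
    and start: "A 0 = mat 1" "B 0 = mat 1"
    and cont: "\<And>i j. continuous_on {0..1} (\<lambda>s. A s $ i $ j)" "\<And>i j. continuous_on {0..1} (\<lambda>s. B s $ i $ j)"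
  shows "pmap (N ** tens (sym2 (A 1)) (sym2 (B 1)) ** N') \<in> aut_id_component_ambient (surf N)"
proof -
  let ?M = "\<lambda>s. N ** tens (sym2 (A s)) (sym2 (B s)) ** N'"
  have "restrict (pmap (?M 1)) (surf N) \<in> aut_id_component (surf N)"
  proof (rule pmap_path_in_component)
    show "continuous_on {0..1} ?M" by (rule continuous_on_group[OF cont])
    show "?M 0 = mat 1" unfolding start sym2_one tens_one using N by (simp add: inverse_pair_def)
    show "restrict (pmap (?M s)) (surf N) \<in> aut (surf N)" if "s \<in> {0..1}" for s
      by (rule group_aut(2)[OF N r A[OF that] B[OF that] c[OF that]])
    show "?M s *v v \<noteq> 0" if "s \<in> {0..1}" "v \<noteq> 0" for s v
      by (rule inverse_pair_nonzero[OF conj_inverse_pair[OF N inverse_pair_tens[OF A[OF that(1)] B[OF that(1)]]] that(2)])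
  qed
  moreover have "pmap (?M 1) \<in> aut UNIV" by (rule group_aut(1)[OF N r A B c]) auto
  ultimately show ?thesis unfolding aut_id_component_ambient_def by simp
qed

text \<open>As 32 = 2^5, the exponent of 2 is \<open>a + 5 * b\<close>, and digits up to 4 in base 5
  are unique.\<close>

lemma distinct_weights_2_32: "distinct_weights 2 32"
  unfolding distinct_weights_def
proof (intro allI impI)
  fix a b c d :: nat assume le: "a \<le> 4" "b \<le> 4" "c \<le> 4" "d \<le> 4" and eq: "(2::complex) ^ a * 32 ^ b = 2 ^ c * 32 ^ d"
  have p: "(2::complex) ^ n * 32 ^ m = of_nat (2 ^ (n + 5 * m))" for n m :: nat
    by (simp add: power_add power_mult)
  have "(2::nat) ^ (a + 5 * b) = 2 ^ (c + 5 * d)" using eq unfolding p of_nat_eq_iff .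
  then have e: "a + 5 * b = c + 5 * d" by simp
  have "b = d"
  proof (rule linorder_cases[of b d])
    assume "b < d" then show ?thesis using e le by linarith
  next
    assume "d < b" then show ?thesis using e le by linarith
  qed
  then show "a = c \<and> b = d" using e by simp
qed

text \<open>Both numbers have modulus sqrt 5, so the total exponents agree. What remains is that the
  powers of 2 + i and 2 - i, the non-associate Gaussian primes above 5, differ for exponents 1 to
  4.\<close>

lemma distinct_weights_gauss: "distinct_weights (2 + \<i>) (2 - \<i>)"
  unfolding distinct_weights_def
proof (intro allI impI)
  have norms: "norm (2 + \<i>) = sqrt 5" "norm (2 - \<i>) = sqrt 5" by (simp_all add: cmod_def power2_eq_square)
  have ne: "(2 + \<i>) ^ k \<noteq> (2 - \<i>) ^ k" if "k \<le> 4" "k \<noteq> 0" for k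
  proof -
    have "k = 1 \<or> k = 2 \<or> k = 3 \<or> k = 4" using that by linarith
    then show ?thesis by (auto simp: complex_eq_iff eval_nat_numeral)
  qed
  have nz: "2 + \<i> \<noteq> 0" "2 - \<i> \<noteq> 0" by (simp_all add: complex_eq_iff)
  have half: "a = c \<and> b = d"
    if le: "a \<le> c" "c \<le> 4" "b \<le> 4" and eq: "(2 + \<i>) ^ a * (2 - \<i>) ^ b = (2 + \<i>) ^ c * (2 - \<i>) ^ d" for a b c d :: nat
  proof -
    have "sqrt 5 ^ (a + b) = sqrt 5 ^ (c + d)"
      using arg_cong[OF eq, of norm] by (simp add: norm_mult norm_power norms power_add)
    then have s: "a + b = c + d" by (subst (asm) power_inject_exp) (auto simp: real_less_rsqrt)
    define k where "k = c - a"
    have ck: "c = a + k" and bk: "b = d + k" using s le(1) by (auto simp: k_def)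
    have "((2 + \<i>) ^ a * (2 - \<i>) ^ d) * (2 - \<i>) ^ k = ((2 + \<i>) ^ a * (2 - \<i>) ^ d) * (2 + \<i>) ^ k"
      using eq unfolding ck bk power_add by (simp only: mult_ac)
    then have "(2 - \<i>) ^ k = (2 + \<i>) ^ k" using nz by simp
    then have "k = 0" using ne[of k] le(2) ck by fastforce
    then show ?thesis using ck bk by simp
  qed
  fix a b c d :: nat
  assume le: "a \<le> 4" "b \<le> 4" "c \<le> 4" "d \<le> 4" and eq: "(2 + \<i>) ^ a * (2 - \<i>) ^ b = (2 + \<i>) ^ c * (2 - \<i>) ^ d"
  show "a = c \<and> b = d"
    using half[of a c b d] half[of c a d b] le eq by (cases "a \<le> c") auto
qed

text \<open>The torus element has to be real for the structure of index \<open>b\<close>, hence the conjugate weights when \<open>b\<close> swaps the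
  factors, and the segments from 1 to the weights must avoid 0.\<close>

definition weight_pair :: "bool \<Rightarrow> complex \<times> complex" where
  "weight_pair b = (if b then (2 + \<i>, 2 - \<i>) else (2, 32))"

text \<open>An element of the identity component of the surface restricts to an automorphism of the
  quadric, so it preserves the complex zero set of the form. For a nondegenerate form the zero set
  determines the form up to a scalar, so the element acts by a scalar on it; one torus element and
  one unipotent element then suffice.\<close>

lemma invariant_form_of_surf:
  fixes N :: "complex^(3 \<times> 3)^'n" and P :: "complex^'n^'n"
  assumes N: "inverse_pair N N'" and r: "real_model b N"
    and sub: "aut_id_component_ambient (surf N) \<subseteq> aut_id_component_ambient (quadric_of A)"
    and sym: "transpose A = A" and P: "inverse_pair P P'"
    and d: "\<And>k. d k \<noteq> (0::real)"
    and diag: "\<And>u. bil (cmat A) (P *v u) (P *v u) = (\<Sum>k\<in>UNIV. complex_of_real (d k) * (u $ k)\<^sup>2)"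
  shows "\<exists>c. c \<noteq> 0 \<and> (\<forall>z. bil (cmat A) (N *v z) (N *v z) = c * qform z)"
proof -
  let ?Q = "quadric_of A"
  define a where "a = transpose N ** cmat A ** N"
  have symc: "transpose (cmat A) = cmat A" using sym by (simp add: cmat_transpose[symmetric])
  have a: "transpose a = a" unfolding a_def by (rule transpose_pullback[OF symc])
  have az: "bil (cmat A) (N *v z) (N *v w) = bil a z w" for z w unfolding a_def by (rule bil_pullback)
  have semi: "\<exists>\<rho>. \<forall>z. bil a (R *v z) (R *v z) = \<rho> * bil a z z"
    if R: "inverse_pair R R'" and comp: "pmap (N ** R ** N') \<in> aut_id_component_ambient (surf N)" for R R'
  proof -
    let ?M = "N ** R ** N'"
    note M = conj_inverse_pair[OF N R]
    have "restrict (pmap ?M) ?Q \<in> aut_id_component ?Q"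
      using comp sub unfolding aut_id_component_ambient_def by blast
    then have "connected_component_of (aut_topology ?Q) (restrict id ?Q) (restrict (pmap ?M) ?Q)"
      unfolding aut_id_component_def by simp
    from connected_component_in_topspace[OF this]
    have autM: "restrict (pmap ?M) ?Q \<in> aut ?Q" by (simp add: topspace_aut_topology)
    have im: "pmap ?M p \<in> ?Q" if "p \<in> ?Q" for p using aut_image[OF autM that] that by simp
    have pres: "bil (cmat A) (?M *v v) (?M *v v) = 0" if v: "bil (cmat A) v v = 0" for v
    proof (cases "v = 0")
      case True then show ?thesis by (simp add: bil_def)
    next
      case False
      have "pmap ?M (abs_proj v) \<in> ?Q" using im quadric_mem[OF False] v by blast
      then have "abs_proj (?M *v v) \<in> ?Q" using pmap_abs[OF False inverse_pair_nonzero[OF M False]] by simp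
      then show ?thesis using quadric_mem[OF inverse_pair_nonzero[OF M False]] by blast
    qed
    define e where "e = transpose (?M ** P) ** cmat A ** (?M ** P)"
    have e: "bil e u u = bil (cmat A) (?M *v (P *v u)) (?M *v (P *v u))" for u
      unfolding e_def bil_pullback[symmetric] matrix_vector_mul_assoc ..
    have "\<exists>\<rho>. \<forall>u. bil e u u = \<rho> * (\<Sum>k\<in>UNIV. complex_of_real (d k) * (u $ k)\<^sup>2)"
    proof (rule zero_set_diagonal)
      show "transpose e = e" unfolding e_def by (rule transpose_pullback[OF symc])
      show "complex_of_real (d k) \<noteq> 0" for k using d by simp
      show "bil e u u = 0" if "(\<Sum>k\<in>UNIV. complex_of_real (d k) * (u $ k)\<^sup>2) = 0" for u
        unfolding e using pres[of "P *v u"] diag[of u] that by simp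
    qed
    then obtain \<rho> where \<rho>: "\<And>u. bil e u u = \<rho> * (\<Sum>k\<in>UNIV. complex_of_real (d k) * (u $ k)\<^sup>2)" by blast
    have "bil a (R *v z) (R *v z) = \<rho> * bil a z z" for z
    proof -
      have "bil a (R *v z) (R *v z) = bil e (P' *v (N *v z)) (P' *v (N *v z))"
        unfolding e inverse_pair_apply[OF P] matrix_vector_mul_assoc[symmetric] inverse_pair_apply[OF N] az ..
      also have "\<dots> = \<rho> * bil (cmat A) (P *v (P' *v (N *v z))) (P *v (P' *v (N *v z)))" unfolding \<rho> diag ..
      finally show ?thesis unfolding inverse_pair_apply[OF P] az .
    qed
    then show ?thesis by blast
  qed
  \<comment> \<open>For \<open>N *v z\<close> in the radical, adding it to the basis vector
    \<open>x = P *v axis k 1\<close> leaves the value of the form unchanged; in diagonal coordinates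
    the values differ by \<open>2 * d k * u $ k\<close>.\<close>
  have nondeg: "z = 0" if z: "a *v z = 0" for z
  proof (rule ccontr)
    assume "z \<noteq> 0"
    define u where "u = P' *v (N *v z)"
    have "u \<noteq> 0" unfolding u_def using inverse_pair_nonzero[OF inverse_pair_sym[OF P] inverse_pair_nonzero[OF N \<open>z \<noteq> 0\<close>]] .
    then obtain k where k: "u $ k \<noteq> 0" by (metis vec_eq_iff zero_index)
    have zero: "bil (cmat A) (N *v z) w = 0" for w
    proof -
      have "bil (cmat A) (N *v z) (N *v (N' *v w)) = bil a (N' *v w) z" unfolding az by (rule bil_sym[OF a])
      then show ?thesis using z by (simp add: inverse_pair_apply[OF N] bil_vec)
    qed
    define x where "x = P *v axis k 1"
    have Nz: "N *v z = P *v u" by (simp add: u_def inverse_pair_apply[OF P])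
    have "bil (cmat A) (N *v z + x) (N *v z + x) = bil (cmat A) (N *v z) (N *v z) + 2 * bil (cmat A) (N *v z) x + bil (cmat A) x x"
      by (simp only: bil_add bil_sym[OF symc, of x "N *v z"]) (simp only: mult_2 add.assoc)
    then have "bil (cmat A) (N *v z + x) (N *v z + x) = bil (cmat A) x x" by (simp add: zero)
    moreover have "N *v z + x = P *v (u + axis k 1)" unfolding x_def Nz by (simp only: matrix_vector_right_distrib)
    moreover have "bil (cmat A) (N *v z) (N *v z) = 0" by (rule zero)
    ultimately have "(\<Sum>i\<in>UNIV. complex_of_real (d i) * ((u + axis k 1) $ i)\<^sup>2) = (\<Sum>i\<in>UNIV. complex_of_real (d i) * (axis k 1 $ i)\<^sup>2)"
      "(\<Sum>i\<in>UNIV. complex_of_real (d i) * (u $ i)\<^sup>2) = 0"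
      unfolding x_def diag[symmetric] Nz by simp_all
    moreover have "(\<Sum>i\<in>UNIV. complex_of_real (d i) * ((u + axis k 1) $ i)\<^sup>2) =
       (\<Sum>i\<in>UNIV. complex_of_real (d i) * (u $ i)\<^sup>2) + (\<Sum>i\<in>UNIV. complex_of_real (d i) * (axis k 1 $ i)\<^sup>2)
        + (\<Sum>i\<in>UNIV. (if i = k then 2 * complex_of_real (d i) * u $ i else 0))"
      unfolding sum.distrib[symmetric] by (intro sum.cong refl) (simp add: axis_def power2_eq_square algebra_simps)
    ultimately have "(\<Sum>i\<in>UNIV. (if i = k then 2 * complex_of_real (d i) * u $ i else 0)) = 0" by simp
    then show False using k d[of k] by simp
  qed
  obtain l m where lm: "weight_pair b = (l, m)" by fastforce
  have dw: "distinct_weights l m" using lm distinct_weights_2_32 distinct_weights_gauss by (auto simp: weight_pair_def split: if_splits)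
  have lmnz: "1 + complex_of_real s * (l - 1) \<noteq> 0" "1 + complex_of_real s * (m - 1) \<noteq> 0" if "s \<in> {0..1}" for s
    using lm that by (auto simp: weight_pair_def complex_eq_iff add_eq_0_iff split: if_splits)
  let ?A = "\<lambda>s. diag2 (1 + complex_of_real s * (l - 1))" and ?B = "\<lambda>s. diag2 (1 + complex_of_real s * (m - 1))"
  have "pmap (N ** tens (sym2 (?A 1)) (sym2 (?B 1)) ** N') \<in> aut_id_component_ambient (surf N)"
  proof (rule group_in_component[OF N r])
    show "inverse_pair (?A s) (diag2 (1 / (1 + complex_of_real s * (l - 1))))"
      "inverse_pair (?B s) (diag2 (1 / (1 + complex_of_real s * (m - 1))))" if "s \<in> {0..1}" for s
      using lmnz[OF that] inverse_pair_diag2 by blast+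
    show "compatible b (?A s) (?B s)" if "s \<in> {0..1}" for s
      using lm by (auto simp: compatible_def diag2_def mcnj_def vec_eq_iff weight_pair_def forall_2 split: if_splits)
    show "?A 0 = mat 1" "?B 0 = mat 1" by (simp_all add: diag2_def mat_def vec_eq_iff)
    show "continuous_on {0..1} (\<lambda>s. ?A s $ i $ j)" "continuous_on {0..1} (\<lambda>s. ?B s $ i $ j)" for i j
      by (cases "i = j"; cases "i = 1"; simp add: diag2_def; intro continuous_intros)+
  qed
  then have "pmap (N ** tens (sym2 (diag2 l)) (sym2 (diag2 m)) ** N') \<in> aut_id_component_ambient (surf N)" by simp
  moreover have "inverse_pair (tens (sym2 (diag2 l)) (sym2 (diag2 m))) (tens (sym2 (diag2 (1 / l))) (sym2 (diag2 (1 / m))))"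
    using lmnz[of 1] by (intro inverse_pair_tens inverse_pair_diag2) simp_all
  ultimately obtain \<rho> where \<rho>: "\<And>z. bil a (tens (sym2 (diag2 l)) (sym2 (diag2 m)) *v z) (tens (sym2 (diag2 l)) (sym2 (diag2 m)) *v z) = \<rho> * bil a z z"
    using semi by blast
  \<comment> \<open>A real shear acting equally on both factors is compatible with either structure,
    so one path serves for both.\<close>
  let ?U = "\<lambda>s. shear (complex_of_real s)"
  have "pmap (N ** tens (sym2 (?U 1)) (sym2 (?U 1)) ** N') \<in> aut_id_component_ambient (surf N)"
  proof (rule group_in_component[OF N r inverse_pair_shear inverse_pair_shear])
    show "compatible b (?U s) (?U s)" for s
      by (auto simp: compatible_def shear_def mcnj_def vec_eq_iff forall_2)
    show "?U 0 = mat 1" "?U 0 = mat 1" by (simp_all add: shear_def mat_def vec_eq_iff forall_2)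
    show "continuous_on {0..1} (\<lambda>s. ?U s $ i $ j)" "continuous_on {0..1} (\<lambda>s. ?U s $ i $ j)" for i j
      by (cases "i = j"; cases "i = 1"; simp add: shear_def; intro continuous_intros)+
  qed
  then have "pmap (N ** tens (sym2 (shear 1)) (sym2 (shear 1)) ** N') \<in> aut_id_component_ambient (surf N)" by simp
  then obtain \<rho>' where \<rho>': "\<And>z. bil a (tens (sym2 (shear 1)) (sym2 (shear 1)) *v z) (tens (sym2 (shear 1)) (sym2 (shear 1)) *v z) = \<rho>' * bil a z z"
    using semi[OF inverse_pair_tens[OF inverse_pair_shear inverse_pair_shear]] by blast
  show ?thesis unfolding az by (rule semi_invariant_form[OF a nondeg dw \<rho> \<rho>'])
qed

text \<open>Both models have the same index \<open>b\<close>, so their twists cancel in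
  \<open>M ** N'\<close>, which therefore commutes with conjugation up to the scalar
  \<open>l / k\<close>.\<close>

lemma models_equivalent:
  fixes N M :: "complex^(3 \<times> 3)^'n::finite"
  assumes N: "inverse_pair N N'" "real_model b N" and M: "inverse_pair M M'" "real_model b M"
    and c: "c \<noteq> 0" "\<And>z. bil (cmat A) (N *v z) (N *v z) = c * qform z"
    and c': "c' \<noteq> 0" "\<And>z. bil (cmat A) (M *v z) (M *v z) = c' * qform z"
  shows "\<exists>f\<in>aut (quadric_of A). f ` surf N = surf M"
proof
  let ?Q = "quadric_of A" and ?T = "M ** N'"
  note T = inverse_pair_mult[OF M(1) inverse_pair_sym[OF N(1)]]
  have Qform: "bil (cmat A) v v = c * qform (N' *v v)" for v
    using c(2)[of "N' *v v"] by (simp add: inverse_pair_apply[OF N(1)])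
  have Q: "?Q = quad N"
  proof (intro set_eqI)
    fix p :: "'n proj"
    obtain v where v: "v \<noteq> 0" "p = abs_proj v" by (rule proj_cases)
    show "p \<in> ?Q \<longleftrightarrow> p \<in> quad N"
      unfolding v(2) quadric_mem[OF v(1)] quad_mem[OF N(1) v(1)] Qform using c(1) by simp
  qed
  obtain k where k: "k \<noteq> 0" "\<And>z. mcnj N *v z = k *s (N *v (twist b *v z))" using N(2) unfolding real_model_def by blast
  obtain l where l: "l \<noteq> 0" "\<And>z. mcnj M *v z = l *s (M *v (twist b *v z))" using M(2) unfolding real_model_def by blast
  have cT: "mcnj ?T *v v = (l / k) *s (?T *v v)" for v
    unfolding mcnj_mult matrix_vector_mul_assoc[symmetric] real_model_inverse[OF N(1) k(2,1)] l(2)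
    by (simp add: vector_scalar_commute twist_twist)
  show "restrict (pmap ?T) ?Q \<in> aut ?Q"
  proof (rule aut_pmap[OF T])
    fix v :: "complex^'n" assume v: "v \<noteq> 0"
    have "bil (cmat A) (?T *v v) (?T *v v) = c' * qform (N' *v v)"
      unfolding matrix_vector_mul_assoc[symmetric] c'(2) ..
    then show "abs_proj v \<in> ?Q \<longleftrightarrow> abs_proj (?T *v v) \<in> ?Q"
      unfolding quadric_mem[OF v] quadric_mem[OF inverse_pair_nonzero[OF T v]] Qform using c(1) c'(1) by simp
    have "l / k \<noteq> 0" using k(1) l(1) by simp
    then show "abs_proj (?T *v vcnj v) = abs_proj (vcnj (?T *v v))"
      unfolding vcnj_mult cT using abs_proj_scale[OF _ inverse_pair_nonzero[OF T, of "vcnj v"], of "l / k"] v by simp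
  qed (use cnj_quad[OF N] Q in blast)
  have val: "restrict (pmap ?T) ?Q (abs_proj (N *v segre x y)) = abs_proj (M *v segre x y)" if xy: "x \<noteq> 0" "y \<noteq> 0" for x y
  proof -
    have nz: "N *v segre x y \<noteq> 0" by (rule inverse_pair_nonzero[OF N(1) segre_nonzero[OF xy]])
    have "abs_proj (N *v segre x y) \<in> ?Q" unfolding Q using surf_subset_quad xy unfolding surf_def by blast
    moreover have "?T *v (N *v segre x y) = M *v segre x y"
      by (simp add: matrix_vector_mul_assoc[symmetric] inverse_pair_apply[OF N(1)])
    ultimately show ?thesis using pmap_abs[OF nz inverse_pair_nonzero[OF T nz]] by simp
  qed
  show "restrict (pmap ?T) ?Q ` surf N = surf M"
  proof (intro set_eqI iffI)
    fix p assume "p \<in> restrict (pmap ?T) ?Q ` surf N"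
    then show "p \<in> surf M" using val unfolding surf_def by fastforce
  next
    fix p assume "p \<in> surf M"
    then obtain x y where xy: "x \<noteq> 0" "y \<noteq> 0" "p = abs_proj (M *v segre x y)" unfolding surf_def by blast
    then have "p = restrict (pmap ?T) ?Q (abs_proj (N *v segre x y))" using val by simp
    moreover have "abs_proj (N *v segre x y) \<in> surf N" unfolding surf_def using xy by blast
    ultimately show "p \<in> restrict (pmap ?T) ?Q ` surf N" by blast
  qed
qed

section \<open>Existence\<close>

text \<open>Linear forms, real for the real structure of index \<open>b\<close>, in which \<open>qform\<close> is diagonal.\<close>

definition diag_coord :: "bool \<Rightarrow> complex^(3 \<times> 3) \<Rightarrow> 3 \<Rightarrow> 3 \<Rightarrow> complex" where
  "diag_coord b z i j =
    (if i = 2 \<and> j = 2 then z $ (2,2)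
     else if b then
       (if i = 1 \<and> j = 1 then z $ (1,1) + z $ (3,3)
        else if i = 3 \<and> j = 3 then z $ (1,1) - z $ (3,3)
        else if i = 1 \<and> j = 3 then z $ (1,3) + z $ (3,1)
        else if i = 3 \<and> j = 1 then \<i> * (z $ (1,3) - z $ (3,1))
        else if i = 1 \<and> j = 2 then (z $ (1,2) + z $ (2,1)) + (z $ (2,3) + z $ (3,2))
        else if i = 3 \<and> j = 2 then (z $ (1,2) + z $ (2,1)) - (z $ (2,3) + z $ (3,2))
        else if i = 2 \<and> j = 1 then \<i> * (z $ (1,2) - z $ (2,1)) + \<i> * (z $ (2,3) - z $ (3,2))
        else \<i> * (z $ (1,2) - z $ (2,1)) - \<i> * (z $ (2,3) - z $ (3,2)))
     else
       (if i = 1 \<and> j = 1 then z $ (1,1) + z $ (3,3)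
        else if i = 3 \<and> j = 3 then z $ (1,1) - z $ (3,3)
        else if i = 1 \<and> j = 3 then z $ (1,3) + z $ (3,1)
        else if i = 3 \<and> j = 1 then z $ (1,3) - z $ (3,1)
        else if i = 1 \<and> j = 2 then z $ (1,2) + z $ (3,2)
        else if i = 3 \<and> j = 2 then z $ (1,2) - z $ (3,2)
        else if i = 2 \<and> j = 1 then z $ (2,1) + z $ (2,3)
        else z $ (2,1) - z $ (2,3)))"

text \<open>The coefficients come from u v = ((u + v)^2 - (u - v)^2) / 4. When the factors are
  exchanged, a factor \<open>\<i>\<close> makes the antisymmetric combinations real and changes the
  sign of their squares: the pair (1,3), (3,1) becomes definite, which moves the signature from
  (5,4) to (6,3).\<close>

definition diag_sign :: "bool \<Rightarrow> 3 \<Rightarrow> 3 \<Rightarrow> real" where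
  "diag_sign b i j =
    (if i = 2 \<and> j = 2 then 2
     else if b then (if i = 3 \<and> j = 3 \<or> i = 1 \<and> j = 2 \<or> i = 2 \<and> j = 1 then -1/4 else 1/4)
     else if i = 3 \<and> j = 3 \<or> i = 3 \<and> j = 1 then -1/4
     else if i = 1 \<and> j = 2 \<or> i = 2 \<and> j = 1 then -1/2
     else if i = 3 \<and> j = 2 \<or> i = 2 \<and> j = 3 then 1/2
     else 1/4)"

lemma qform_diagonal:
  "qform z = (\<Sum>i\<in>UNIV. \<Sum>j\<in>UNIV. complex_of_real (diag_sign b i j) * (diag_coord b z i j)\<^sup>2)"
  by (cases b; simp add: sum_3 qform_def diag_sign_def diag_coord_def power2_eq_square field_simps)

lemma diag_sign_nonzero: "diag_sign b i j \<noteq> 0"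
  by (simp add: diag_sign_def)

lemma forall_33: "(\<forall>I. P I) \<longleftrightarrow> (\<forall>i j. P (i :: 3, j :: 3))"
  by auto

lemma card_diag_sign:
  "card {I. diag_sign b (fst I) (snd I) > 0} = (if b then 6 else 5)"
  "card {I. diag_sign b (fst I) (snd I) < 0} = (if b then 3 else 4)"
proof -
  have p: "{I. diag_sign b (fst I) (snd I) > 0} = (if b then {(1,1),(1,3),(3,1),(3,2),(2,3),(2,2)} else {(1,1),(1,3),(3,2),(2,3),(2,2)})"
    unfolding set_eq_iff forall_33 forall_3 by (simp add: diag_sign_def)
  have n: "{I. diag_sign b (fst I) (snd I) < 0} = (if b then {(3,3),(1,2),(2,1)} else {(3,3),(3,1),(1,2),(2,1)})"
    unfolding set_eq_iff forall_33 forall_3 by (simp add: diag_sign_def)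
  show "card {I. diag_sign b (fst I) (snd I) > 0} = (if b then 6 else 5)"
    "card {I. diag_sign b (fst I) (snd I) < 0} = (if b then 3 else 4)"
    unfolding p n by simp_all
qed

lemma diag_matrix_exists:
  "\<exists>L L'. inverse_pair L L' \<and> (\<forall>z I. (L *v z) $ I = diag_coord b z (fst I) (snd I)) \<and>
    (\<forall>z. mcnj L *v z = L *v (twist b *v z))"
proof -
  let ?f = "\<lambda>z. \<chi> I. diag_coord b z (fst I) (snd I)"
  have "Vector_Spaces.linear (*s) (*s) ?f"
    unfolding Vector_Spaces.linear_iff
    by (simp add: vec.vector_space_axioms vec_eq_iff) (simp add: diag_coord_def algebra_simps)
  then have L: "matrix ?f *v z = ?f z" for z by (rule matrix_works)
  have "z = 0" if "matrix ?f *v z = 0" for z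
  proof -
    have "\<forall>i j. diag_coord b z i j = 0" using that unfolding L vec_eq_iff forall_33 by simp
    then have "\<forall>i j. z $ (i, j) = 0"
      unfolding forall_3
      by (cases b; simp add: diag_coord_def; elim conjE; intro conjI; algebra)
    then show ?thesis by (simp add: vec_eq_iff)
  qed
  then obtain L' where L': "inverse_pair (matrix ?f) L'"
    using nonsingular_2_inverse_pair[of "matrix ?f"] by blast
  have "mcnj (matrix ?f) *v z = matrix ?f *v (twist b *v z)" for z
  proof -
    have "mcnj (matrix ?f) *v z = vcnj (matrix ?f *v vcnj z)" by (simp only: vcnj_mult vcnj_simps(1))
    also have "\<dots> = vcnj (?f (vcnj z))" by (simp only: L)
    also have "\<dots> = ?f (twist b *v z)"
      unfolding vec_eq_iff forall_33 forall_3
      by (cases b; simp add: diag_coord_def twist_def swap33_apply algebra_simps)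
    finally show ?thesis unfolding L .
  qed
  then show ?thesis
    using L' L by (intro exI[of _ "matrix ?f"] exI[of _ L']) simp
qed

lemma sign_matching:
  fixes d :: "'a::finite \<Rightarrow> real" and e :: "'b::finite \<Rightarrow> real"
  assumes "\<And>k. d k \<noteq> 0" "\<And>k. e k \<noteq> 0"
    "card {k. d k > 0} = card {k. e k > 0}" "card {k. d k < 0} = card {k. e k < 0}"
  shows "\<exists>\<sigma>. bij \<sigma> \<and> (\<forall>k. d k > 0 \<longleftrightarrow> e (\<sigma> k) > 0)"
proof -
  obtain f where f: "bij_betw f {k. d k > 0} {k. e k > 0}"
    using assms(3) finite_same_card_bij by (metis finite)
  obtain g where g: "bij_betw g {k. d k < 0} {k. e k < 0}"
    using assms(4) finite_same_card_bij by (metis finite)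
  define \<sigma> where "\<sigma> k = (if d k > 0 then f k else g k)" for k
  have "bij_betw \<sigma> {k. d k > 0} {k. e k > 0}" using f by (rule bij_betw_cong[THEN iffD1, rotated]) (simp add: \<sigma>_def)
  moreover have "bij_betw \<sigma> {k. d k < 0} {k. e k < 0}" using g by (rule bij_betw_cong[THEN iffD1, rotated]) (simp add: \<sigma>_def)
  ultimately have "bij_betw \<sigma> ({k. d k > 0} \<union> {k. d k < 0}) ({k. e k > 0} \<union> {k. e k < 0})"
    by (rule bij_betw_combine) auto
  moreover have "{k. d k > 0} \<union> {k. d k < 0} = UNIV" "{k. e k > 0} \<union> {k. e k < 0} = UNIV"
    using assms(1,2) by (auto simp: neq_iff)
  ultimately have "bij \<sigma>" by simp
  moreover have "d k > 0 \<longleftrightarrow> e (\<sigma> k) > 0" for k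
  proof (cases "d k > 0")
    case True then show ?thesis using f by (auto simp: \<sigma>_def bij_betw_def)
  next
    case False
    then have "d k < 0" using assms(1)[of k] by simp
    then have "e (g k) < 0" using g by (auto simp: bij_betw_def)
    then show ?thesis using False by (simp add: \<sigma>_def)
  qed
  ultimately show ?thesis by blast
qed

text \<open>The model is \<open>P ** E ** L\<close>: \<open>L\<close> passes to the coordinates
  diagonalising \<open>qform\<close>, which are real for the structure of index \<open>b\<close>;
  \<open>E\<close> matches signs by a permutation and rescales; \<open>P\<close> leads back to the
  coordinates of \<open>A\<close>. The sign \<open>s\<close> accounts for a form being identified
  with its negative.\<close>

lemma model_exists:
  fixes A :: "real^'n^'n"
  assumes sig: "has_signature A p q" "p + q = CARD('n)" and s: "s = 1 \<or> s = (-1 :: real)"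
    and cards: "card {I. s * diag_sign b (fst I) (snd I) > 0} = p" "card {I. s * diag_sign b (fst I) (snd I) < 0} = q"
  shows "\<exists>(N :: complex^(3 \<times> 3)^'n) N' c. inverse_pair N N' \<and> real_model b N \<and> c \<noteq> 0 \<and>
    (\<forall>z. bil (cmat A) (N *v z) (N *v z) = c * qform z)"
proof -
  obtain P P' :: "complex^'n^'n" and d where P: "inverse_pair P P'" "mcnj P = P" "\<And>k. d k \<noteq> (0::real)"
    "card {k. d k > 0} = p" "card {k. d k < 0} = q"
    "\<And>u. bil (cmat A) (P *v u) (P *v u) = (\<Sum>k\<in>UNIV. complex_of_real (d k) * (u $ k)\<^sup>2)"
    using has_signature_diagonal[OF sig] by blast
  define e where "e I = s * diag_sign b (fst I) (snd I)" for I
  have e0: "e I \<noteq> 0" for I using s diag_sign_nonzero by (auto simp: e_def)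
  have "\<exists>\<sigma>. bij \<sigma> \<and> (\<forall>k. d k > 0 \<longleftrightarrow> e (\<sigma> k) > 0)"
    by (rule sign_matching) (use P(3-5) e0 cards in \<open>simp_all add: e_def\<close>)
  then obtain \<sigma> where \<sigma>: "bij \<sigma>" "\<And>k. d k > 0 \<longleftrightarrow> e (\<sigma> k) > 0" by blast
  \<comment> \<open>Solves \<open>d k * (t k)\<^sup>2 = e (\<sigma> k)\<close> over the reals, which
    is possible because \<open>\<sigma>\<close> matches the signs.\<close>
  define t where "t k = sqrt (e (\<sigma> k) / d k)" for k
  have pos: "e (\<sigma> k) / d k > 0" for k
    using \<sigma>(2)[of k] P(3)[of k] e0[of "\<sigma> k"] by (cases "d k > 0") (auto simp: zero_less_divide_iff neq_iff)
  have t: "t k \<noteq> 0" "d k * (t k)\<^sup>2 = e (\<sigma> k)" for k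
    using pos[of k] P(3)[of k] e0[of "\<sigma> k"] by (simp_all add: t_def)
  obtain L L' :: "complex^(3 \<times> 3)^(3 \<times> 3)" where L: "inverse_pair L L'" "\<And>z I. (L *v z) $ I = diag_coord b z (fst I) (snd I)"
    "\<And>z. mcnj L *v z = L *v (twist b *v z)" using diag_matrix_exists by blast
  define E :: "complex^(3 \<times> 3)^'n" where "E = (\<chi> k J. if J = \<sigma> k then complex_of_real (t k) else 0)"
  define E' :: "complex^'n^(3 \<times> 3)" where "E' = (\<chi> J k. if J = \<sigma> k then complex_of_real (1 / t k) else 0)"
  have Ev: "(E *v z) $ k = complex_of_real (t k) * z $ \<sigma> k" for z k
    by (simp add: E_def matrix_vector_mult_def if_distrib[of "\<lambda>x. x * _"] cong: if_cong)
  have E'v: "(E' *v u) $ \<sigma> k = complex_of_real (1 / t k) * u $ k" for u k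
  proof -
    have eq: "\<sigma> k = \<sigma> l \<longleftrightarrow> l = k" for l using bij_is_inj[OF \<sigma>(1)] by (auto dest: injD)
    have "(E' *v u) $ \<sigma> k = (\<Sum>l\<in>UNIV. (if l = k then complex_of_real (1 / t l) else 0) * u $ l)"
      by (simp add: E'_def matrix_vector_mult_def eq)
    then show ?thesis by (simp add: if_distrib[of "\<lambda>x. x * _"] cong: if_cong)
  qed
  have "E ** E' = mat 1"
    by (rule matrix_eqI) (simp add: matrix_vector_mul_assoc[symmetric] vec_eq_iff Ev E'v t(1))
  moreover have "E' ** E = mat 1"
  proof (rule matrix_eqI)
    fix z
    have "(E' *v (E *v z)) $ I = z $ I" for I
    proof -
      obtain k where "I = \<sigma> k" using bij_is_surj[OF \<sigma>(1)] by (metis surjD)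
      then show ?thesis by (simp add: Ev E'v t(1))
    qed
    then show "E' ** E *v z = mat 1 *v z" by (simp add: matrix_vector_mul_assoc[symmetric] vec_eq_iff)
  qed
  ultimately have E: "inverse_pair E E'" by (simp add: inverse_pair_def)
  have cE: "mcnj E = E" by (simp add: mcnj_def E_def vec_eq_iff)
  show ?thesis
  proof (intro exI conjI allI)
    show "inverse_pair (P ** E ** L) (L' ** (E' ** P'))" by (rule inverse_pair_mult[OF inverse_pair_mult[OF P(1) E] L(1)])
    have "mcnj (P ** E ** L) *v z = 1 *s (P ** E ** L *v (twist b *v z))" for z
      by (simp add: mcnj_mult P(2) cE matrix_vector_mul_assoc[symmetric] L(3))
    then show "real_model b (P ** E ** L)" unfolding real_model_def by (intro exI[of _ 1]) simp
    show "complex_of_real s \<noteq> 0" using s by auto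
    fix z
    have "bil (cmat A) (P ** E ** L *v z) (P ** E ** L *v z) =
       (\<Sum>k\<in>UNIV. complex_of_real (d k) * ((E *v (L *v z)) $ k)\<^sup>2)"
      unfolding matrix_vector_mul_assoc[symmetric] P(6) ..
    also have "\<dots> = (\<Sum>k\<in>UNIV. complex_of_real (e (\<sigma> k)) * ((L *v z) $ \<sigma> k)\<^sup>2)"
      by (intro sum.cong refl) (simp add: Ev t(2)[symmetric] power_mult_distrib)
    also have "\<dots> = (\<Sum>I\<in>UNIV. complex_of_real (e I) * ((L *v z) $ I)\<^sup>2)"
      by (rule sum.reindex_bij_betw[OF \<sigma>(1)])
    also have "\<dots> = complex_of_real s * qform z"
      unfolding qform_diagonal[of z b] sum_33 by (simp add: e_def L(2) sum_distrib_left mult.assoc)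
    finally show "bil (cmat A) (P ** E ** L *v z) (P ** E ** L *v z) = complex_of_real s * qform z" .
  qed
qed

lemma exists_unique_surface:
  fixes A :: "real^9^9"
  assumes sig: "has_signature A p q" "p + q = 9" and s: "s = 1 \<or> s = (-1 :: real)"
    and cards: "card {I. s * diag_sign b (fst I) (snd I) > 0} = p" "card {I. s * diag_sign b (fst I) (snd I) < 0} = q"
  shows "exists_unique_upto_aut (quadric_of A) (\<lambda>X. double_segre_surface X \<and> X \<subseteq> quadric_of A \<and>
           aut_id_component_ambient X \<subseteq> aut_id_component_ambient (quadric_of A) \<and>
           real_isomorphic_prod (conj_structure b) X)"
proof -
  have sig': "p + q = CARD(9)" using sig(2) by simp
  have sym: "transpose A = A" using sig(1) unfolding has_signature_def by blast
  obtain P P' :: "complex^9^9" and d where P: "inverse_pair P P'" "\<And>k. d k \<noteq> (0::real)"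
    "\<And>u. bil (cmat A) (P *v u) (P *v u) = (\<Sum>k\<in>UNIV. complex_of_real (d k) * (u $ k)\<^sup>2)"
    using has_signature_diagonal[OF sig(1) sig'] by blast
  obtain N :: "complex^(3 \<times> 3)^9" and N' c where N: "inverse_pair N N'" "real_model b N" "c \<noteq> 0"
    "\<And>z. bil (cmat A) (N *v z) (N *v z) = c * qform z"
    using model_exists[OF sig(1) sig' s cards] by blast
  have Q: "quadric_of A = quad N"
  proof (intro set_eqI)
    fix p :: "9 proj"
    obtain v where v: "v \<noteq> 0" "p = abs_proj v" by (rule proj_cases)
    have "bil (cmat A) v v = c * qform (N' *v v)"
      using N(4)[of "N' *v v"] by (simp add: inverse_pair_apply[OF N(1)])
    then show "p \<in> quadric_of A \<longleftrightarrow> p \<in> quad N"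
      unfolding v(2) quadric_mem[OF v(1)] quad_mem[OF N(1) v(1)] using N(3) by simp
  qed
  show ?thesis
    unfolding exists_unique_upto_aut_def
  proof (intro conjI allI impI)
    show "\<exists>X. double_segre_surface X \<and> X \<subseteq> quadric_of A \<and>
           aut_id_component_ambient X \<subseteq> aut_id_component_ambient (quadric_of A) \<and>
           real_isomorphic_prod (conj_structure b) X"
      using double_segre_surf[OF N(1,2)] surf_subset_quad[of N] aut_component_extends[OF N(1,2)] unfolding Q by blast
    fix X Y :: "9 proj set"
    assume XY: "(double_segre_surface X \<and> X \<subseteq> quadric_of A \<and>
           aut_id_component_ambient X \<subseteq> aut_id_component_ambient (quadric_of A) \<and>
           real_isomorphic_prod (conj_structure b) X) \<and>
         double_segre_surface Y \<and> Y \<subseteq> quadric_of A \<and>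
           aut_id_component_ambient Y \<subseteq> aut_id_component_ambient (quadric_of A) \<and>
           real_isomorphic_prod (conj_structure b) Y"
    have model: "\<exists>M M' c. inverse_pair M M' \<and> real_model b M \<and> Z = surf M \<and> c \<noteq> 0 \<and>
        (\<forall>z. bil (cmat A) (M *v z) (M *v z) = c * qform z)"
      if Z: "double_segre_surface Z" "real_isomorphic_prod (conj_structure b) Z"
        "aut_id_component_ambient Z \<subseteq> aut_id_component_ambient (quadric_of A)" for Z
    proof -
      obtain M M' where M: "inverse_pair M M'" "Z = surf M" "real_model b M"
        by (rule double_segre_real_model[OF Z(1,2)])
      have "\<exists>c. c \<noteq> 0 \<and> (\<forall>z. bil (cmat A) (M *v z) (M *v z) = c * qform z)"
        by (rule invariant_form_of_surf[OF M(1,3) _ sym P]) (use Z(3) M(2) in simp)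
      then show ?thesis using M by blast
    qed
    obtain M M' c1 where M: "inverse_pair M M'" "real_model b M" "X = surf M" "c1 \<noteq> 0"
      "\<And>z. bil (cmat A) (M *v z) (M *v z) = c1 * qform z" using model[of X] XY by blast
    obtain L L' c2 where L: "inverse_pair L L'" "real_model b L" "Y = surf L" "c2 \<noteq> 0"
      "\<And>z. bil (cmat A) (L *v z) (L *v z) = c2 * qform z" using model[of Y] XY by blast
    show "\<exists>f\<in>aut (quadric_of A). f ` X = Y"
      unfolding M(3) L(3) by (rule models_equivalent[OF M(1,2) L(1,2) M(4,5) L(4,5)])
  qed
qed

theorem corollary2:
  fixes Q :: "9 proj set"
  shows "(quadric_of_signature 4 5 Q \<longrightarrow>
      exists_unique_upto_aut Q (\<lambda>X. double_segre_surface X \<and> X \<subseteq> Q \<and>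
           aut_id_component_ambient X \<subseteq> aut_id_component_ambient Q \<and>
           real_isomorphic_prod S1xS1_structure X)) \<and>
    (quadric_of_signature 3 6 Q \<longrightarrow>
      exists_unique_upto_aut Q (\<lambda>X. double_segre_surface X \<and> X \<subseteq> Q \<and>
           aut_id_component_ambient X \<subseteq> aut_id_component_ambient Q \<and>
           real_isomorphic_prod S2_structure X))"
proof (intro conjI impI)
  assume "quadric_of_signature 4 5 Q"
  then obtain A where A: "has_signature A 4 5 \<or> has_signature A 5 4" "Q = quadric_of A"
    unfolding quadric_of_signature_def by blast
  have S: "S1xS1_structure = conj_structure False" by (simp add: conj_structure_def)
  show "exists_unique_upto_aut Q (\<lambda>X. double_segre_surface X \<and> X \<subseteq> Q \<and>
           aut_id_component_ambient X \<subseteq> aut_id_component_ambient Q \<and>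
           real_isomorphic_prod S1xS1_structure X)"
    unfolding S A(2) using A(1)
  proof
    assume "has_signature A 4 5"
    then show "exists_unique_upto_aut (quadric_of A) (\<lambda>X. double_segre_surface X \<and> X \<subseteq> quadric_of A \<and>
           aut_id_component_ambient X \<subseteq> aut_id_component_ambient (quadric_of A) \<and>
           real_isomorphic_prod (conj_structure False) X)"
      \<comment> \<open>For index \<open>False\<close>, \<open>diag_sign\<close> has 5 positive and
        4 negative values, so signature (4,5) belongs to the negated form.\<close>
      by (rule exists_unique_surface[where s = "-1"]) (simp_all add: card_diag_sign)
  next
    assume "has_signature A 5 4"
    then show "exists_unique_upto_aut (quadric_of A) (\<lambda>X. double_segre_surface X \<and> X \<subseteq> quadric_of A \<and>
           aut_id_component_ambient X \<subseteq> aut_id_component_ambient (quadric_of A) \<and>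
           real_isomorphic_prod (conj_structure False) X)"
      by (rule exists_unique_surface[where s = 1]) (simp_all add: card_diag_sign)
  qed
next
  assume "quadric_of_signature 3 6 Q"
  then obtain A where A: "has_signature A 3 6 \<or> has_signature A 6 3" "Q = quadric_of A"
    unfolding quadric_of_signature_def by blast
  have S: "S2_structure = conj_structure True" by (simp add: conj_structure_def)
  show "exists_unique_upto_aut Q (\<lambda>X. double_segre_surface X \<and> X \<subseteq> Q \<and>
           aut_id_component_ambient X \<subseteq> aut_id_component_ambient Q \<and>
           real_isomorphic_prod S2_structure X)"
    unfolding S A(2) using A(1)
  proof
    assume "has_signature A 3 6"
    then show "exists_unique_upto_aut (quadric_of A) (\<lambda>X. double_segre_surface X \<and> X \<subseteq> quadric_of A \<and>
           aut_id_component_ambient X \<subseteq> aut_id_component_ambient (quadric_of A) \<and>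
           real_isomorphic_prod (conj_structure True) X)"
      by (rule exists_unique_surface[where s = "-1"]) (simp_all add: card_diag_sign)
  next
    assume "has_signature A 6 3"
    then show "exists_unique_upto_aut (quadric_of A) (\<lambda>X. double_segre_surface X \<and> X \<subseteq> quadric_of A \<and>
           aut_id_component_ambient X \<subseteq> aut_id_component_ambient (quadric_of A) \<and>
           real_isomorphic_prod (conj_structure True) X)"
      by (rule exists_unique_surface[where s = 1]) (simp_all add: card_diag_sign)
  qed
qed

end
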